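(* Let $2<p<3$, $u_0\in L^2(\mathbb{T}^2)$, and let $v\in L^\infty([0,\infty);L^2(\mathbb{T}^2))$ be a divergence-free vector field. Then there exists $0<T\le1$, depending only on $\|u_0\|_{L^2}$, $\sup_{t\ge0}\|v(t)\|_{L^2}$ (and $p$), such that $$\partial_t u+v\cdot\nabla u=-\Delta^2u-\nabla\cdot(|\nabla u|^{p-2}\nabla u),\qquad u(0)=u_0,$$ admits a mild solution $u$ on $[0,T]$, which is unique in $\tilde{\mathcal S}_T$.
   Context: $\mathbb{T}^2=[0,1]^2$ periodic; $\mathcal{L}=\Delta^2$, $e^{-t\mathcal{L}}f=\mathcal{F}^{-1}(e^{-t|\mathbf k|^4}\hat f(\mathbf k))$. Mild solution (advective case): $u\in C([0,T];L^2(\mathbb{T}^2))$ with $\nabla u$ locally integrable such that for all $0\le t\le T$, $$u(t)=e^{-t\mathcal{L}}u_0-\int_0^t\nabla\cdot e^{-(t-s)\mathcal{L}}\big(|\nabla u|^{p-2}\nabla u\big)(s)\,ds-\int_0^te^{-(t-s)\mathcal{L}}\big(v\cdot\nabla u\big)(s)\,ds$$ in $L^2$ (Bochner integrals). $\tilde{\mathcal S}_T$ is the Banach space of $u\in C([0,T];L^2)$ with $\sup_{0<t\le T}t^{1/4}\|\nabla u(t)\|_{L^2}<\infty$, normed by $\max\{\sup_{0\le t\le T}\|u(t)\|_{L^2},\sup_{0<t\le T}t^{1/4}\|\nabla u(t)\|_{L^2}\}$. *)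

theory Defs
  imports "HOL-Analysis.Analysis"
begin

text \<open>The torus T^2 = [0,1]^2 (periodic); functions on T^2 are represented by
  real functions on the unit square (the boundary is a null set).\<close>

definition torus_sq :: "(real \<times> real) set" where
  "torus_sq = {0..1} \<times> {0..1}"

definition L1 :: "(real \<times> real \<Rightarrow> real) \<Rightarrow> bool" where
  "L1 f \<longleftrightarrow> integrable (lebesgue_on torus_sq) f"

definition L2 :: "(real \<times> real \<Rightarrow> real) \<Rightarrow> bool" where
  "L2 f \<longleftrightarrow> f \<in> borel_measurable (lebesgue_on torus_sq)
      \<and> integrable (lebesgue_on torus_sq) (\<lambda>x. (f x)^2)"

definition L2norm :: "(real \<times> real \<Rightarrow> real) \<Rightarrow> real" where
  "L2norm f = sqrt (\<integral>x. (f x)^2 \<partial>(lebesgue_on torus_sq))"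

definition L2v :: "(real \<times> real \<Rightarrow> real \<times> real) \<Rightarrow> bool" where
  "L2v F \<longleftrightarrow> L2 (\<lambda>x. fst (F x)) \<and> L2 (\<lambda>x. snd (F x))"

definition L2normv :: "(real \<times> real \<Rightarrow> real \<times> real) \<Rightarrow> real" where
  "L2normv F = sqrt (\<integral>x. (norm (F x))^2 \<partial>(lebesgue_on torus_sq))"

definition fc :: "(real \<times> real \<Rightarrow> real) \<Rightarrow> int \<times> int \<Rightarrow> complex" where
  "fc f k = (\<integral>x. complex_of_real (f x) *
       cis (- 2 * pi * (of_int (fst k) * fst x + of_int (snd k) * snd x))
     \<partial>(lebesgue_on torus_sq))"

text \<open>Weak (distributional) gradient on the torus: u, G integrable and
  \<open>\<integral> u \<partial>_j \<phi> = - \<integral> G_j \<phi>\<close> for the test functions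
  \<open>\<phi>(x) = exp(-2 pi i k.x)\<close>, k in Z^2.\<close>

definition weak_grad :: "(real \<times> real \<Rightarrow> real) \<Rightarrow> (real \<times> real \<Rightarrow> real \<times> real) \<Rightarrow> bool" where
  "weak_grad u G \<longleftrightarrow> L1 u \<and> L1 (\<lambda>x. fst (G x)) \<and> L1 (\<lambda>x. snd (G x)) \<and>
     (\<forall>k. fc (\<lambda>x. fst (G x)) k = \<i> * complex_of_real (2 * pi * of_int (fst k)) * fc u k
        \<and> fc (\<lambda>x. snd (G x)) k = \<i> * complex_of_real (2 * pi * of_int (snd k)) * fc u k)"

text \<open>Weakly divergence-free vector field: \<open>\<integral> v . \<nabla>\<phi> = 0\<close> for all test exponentials.\<close>

definition div_free :: "(real \<times> real \<Rightarrow> real \<times> real) \<Rightarrow> bool" where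
  "div_free V \<longleftrightarrow> L1 (\<lambda>x. fst (V x)) \<and> L1 (\<lambda>x. snd (V x)) \<and>
     (\<forall>k. of_int (fst k) * fc (\<lambda>x. fst (V x)) k + of_int (snd k) * fc (\<lambda>x. snd (V x)) k = 0)"

text \<open>Fourier multiplier of the semigroup \<open>e^{-t \<Delta>^2}\<close> on [0,1]^2: the symbol of
  \<open>\<Delta>^2\<close> at the mode \<open>exp(2 pi i k.x)\<close> is \<open>|2 pi k|^4\<close>.\<close>

definition sgm :: "real \<Rightarrow> int \<times> int \<Rightarrow> real" where
  "sgm t k = exp (- t * (2 * pi)^4 * ((of_int (fst k))^2 + (of_int (snd k))^2)^2)"

definition flux :: "real \<Rightarrow> real \<times> real \<Rightarrow> real \<times> real" where
  "flux p g = (norm g powr (p - 2)) *\<^sub>R g"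

text \<open>Bochner integrability on [0,t] of an L^2(T^2)-valued map, given through its
  Fourier coefficients \<open>c s k\<close> (Parseval: L^2(T^2) = l^2(Z^2); by Pettis, since the
  space is separable, coefficientwise measurability is strong measurability).
  The k-th Fourier coefficient of the Bochner integral is then \<open>\<integral>_0^t c s k ds\<close>.\<close>

definition l2_bochner :: "real \<Rightarrow> (real \<Rightarrow> int \<times> int \<Rightarrow> complex) \<Rightarrow> bool" where
  "l2_bochner t c \<longleftrightarrow>
     (\<forall>k. (\<lambda>s. c s k) \<in> borel_measurable (lebesgue_on {0..t})) \<and>
     (AE s in lebesgue_on {0..t}. (\<lambda>k. (cmod (c s k))^2) summable_on UNIV) \<and>
     integrable (lebesgue_on {0..t}) (\<lambda>s. sqrt (infsum (\<lambda>k. (cmod (c s k))^2) UNIV))"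

definition C_L2 :: "real \<Rightarrow> (real \<Rightarrow> real \<times> real \<Rightarrow> real) \<Rightarrow> bool" where
  "C_L2 T u \<longleftrightarrow> (\<forall>t\<in>{0..T}. L2 (u t)) \<and>
     (\<forall>t\<in>{0..T}. ((\<lambda>s. L2norm (\<lambda>x. u s x - u t x)) \<longlongrightarrow> 0) (at t within {0..T}))"

text \<open>Divergence term \<open>\<nabla>\<cdot>e^{-(t-s)L}(|\<nabla>u|^{p-2}\<nabla>u)(s)\<close> and advection term
  \<open>e^{-(t-s)L}(v\<cdot>\<nabla>u)(s)\<close>, in Fourier coefficients.\<close>

definition div_term :: "real \<Rightarrow> (real \<Rightarrow> real \<times> real \<Rightarrow> real \<times> real) \<Rightarrow> real \<Rightarrow> real \<Rightarrow> int \<times> int \<Rightarrow> complex" where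
  "div_term p G t s k = complex_of_real (sgm (t - s) k) *
     (\<i> * complex_of_real (2 * pi) *
        (of_int (fst k) * fc (\<lambda>x. fst (flux p (G s x))) k
         + of_int (snd k) * fc (\<lambda>x. snd (flux p (G s x))) k))"

definition adv_term :: "(real \<Rightarrow> real \<times> real \<Rightarrow> real \<times> real) \<Rightarrow> (real \<Rightarrow> real \<times> real \<Rightarrow> real \<times> real) \<Rightarrow> real \<Rightarrow> real \<Rightarrow> int \<times> int \<Rightarrow> complex" where
  "adv_term v G t s k = complex_of_real (sgm (t - s) k) * fc (\<lambda>x. v s x \<bullet> G s x) k"

definition mild_solution ::
  "real \<Rightarrow> (real \<Rightarrow> real \<times> real \<Rightarrow> real \<times> real) \<Rightarrow> (real \<times> real \<Rightarrow> real) \<Rightarrow> real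
     \<Rightarrow> (real \<Rightarrow> real \<times> real \<Rightarrow> real) \<Rightarrow> bool" where
  "mild_solution p v u0 T u \<longleftrightarrow> C_L2 T u \<and>
     (\<exists>G. (AE t in lebesgue_on {0..T}. weak_grad (u t) (G t)) \<and>
          (\<forall>a\<in>{0<..T}. integrable (lebesgue_on ({a..T} \<times> torus_sq)) (\<lambda>(t, x). G t x)) \<and>
          (AE s in lebesgue_on {0..T}.
              L1 (\<lambda>x. fst (flux p (G s x))) \<and> L1 (\<lambda>x. snd (flux p (G s x))) \<and>
              L1 (\<lambda>x. v s x \<bullet> G s x)) \<and>
          (\<forall>t\<in>{0..T}. l2_bochner t (div_term p G t) \<and> l2_bochner t (adv_term v G t) \<and>
             (\<forall>k. fc (u t) k = complex_of_real (sgm t k) * fc u0 k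
                    - (\<integral>s. div_term p G t s k \<partial>(lebesgue_on {0..t}))
                    - (\<integral>s. adv_term v G t s k \<partial>(lebesgue_on {0..t})))))"

definition S_T :: "real \<Rightarrow> (real \<Rightarrow> real \<times> real \<Rightarrow> real) \<Rightarrow> bool" where
  "S_T T u \<longleftrightarrow> C_L2 T u \<and>
     (\<exists>G C. \<forall>t\<in>{0<..T}. weak_grad (u t) (G t) \<and> L2v (G t) \<and>
                          t powr (1/4) * L2normv (G t) \<le> C)"

text \<open>v in L^\<infinity>([0,\<infinity>); L^2(T^2)), divergence free (a representative bounded at every time).\<close>

definition adm_velocity :: "(real \<Rightarrow> real \<times> real \<Rightarrow> real \<times> real) \<Rightarrow> bool" where
  "adm_velocity v \<longleftrightarrow>
     (\<forall>t\<ge>0. L2v (v t) \<and> div_free (v t)) \<and>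
     (\<forall>k. (\<lambda>t. fc (\<lambda>x. fst (v t x)) k) \<in> borel_measurable (lebesgue_on {0..})
        \<and> (\<lambda>t. fc (\<lambda>x. snd (v t x)) k) \<in> borel_measurable (lebesgue_on {0..})) \<and>
     bdd_above ((\<lambda>t. L2normv (v t)) ` {0..})"

end

theory Submission
  imports Defs
begin

text \<open>
  Everything is done on Fourier coefficients, and only through the crude bound
  \<open>|fc f k| \<le> \<parallel>f\<parallel>\<^sub>1\<close>.  If \<open>\<parallel>\<nabla>u(s)\<parallel>\<^sub>2 \<le> R s powr (-1/4)\<close>, then the flux and the advection term
  are bounded in \<open>L\<^sup>1\<close> by a multiple of \<open>s powr (-\<beta>)\<close> with \<open>\<beta> = (p - 1) / 4 < 1/2\<close>.  Counting lattice
  points, the \<open>l\<^sup>2\<close> norm of \<open>(1 + |k|\<^sup>2) exp (-\<sigma> |k|\<^sup>4)\<close> is of order \<open>\<sigma> powr (-3/4)\<close>, so a Beta integral bounds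
  the \<open>H\<^sup>1\<close> norm of the Duhamel term at time \<open>t\<close> by \<open>t powr (1/4 - \<beta>) = t powr (-1/4) * t powr (1/2 - \<beta>)\<close>.  The gain
  \<open>t powr (1/2 - \<beta>)\<close> makes the Duhamel map a contraction for small times, which gives existence.  For uniqueness
  on the whole interval, where the sizes of the two solutions are not controlled by the data, the same estimate is
  used with the exponential weight \<open>exp (\<lambda> t)\<close> and \<open>\<lambda>\<close> large.

  The passage from coefficients back to functions uses a Riesz-Fischer representative that is jointly
  measurable in time and space, and Parseval's identity, which rests on the Stone-Weierstrass theorem for
  the torus embedded in \<open>\<complex> \<times> \<complex>\<close>.
\<close>

subsection \<open>The biharmonic heat kernel on the integer lattice\<close>

text \<open>A square-integrable gradient puts the flux in \<open>L1\<close>, so its coefficients are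
  merely bounded and all decay in \<open>k\<close> has to come from the semigroup. One factor
  \<open>|k|\<close> is due to the divergence and one to the \<open>H1\<close> norm; in two
  dimensions the resulting power -3/4 is still integrable in time. The hypothesis
  \<open>2 < p\<close> means \<open>\<beta> > 1/4\<close>: after the gain has been split off, the
  rest of the kernel still has a convergent Beta integral.

  The obstacle is measurability in time. The flux is nonlinear in the gradient, so its coefficients
  are no simple formula in those of \<open>u\<close>; this forces a jointly measurable
  representative. The velocity is measurable only through its coefficients, so advection is treated
  by truncated convolutions. For a solution given abstractly, measurability is read off from
  \<open>l2_bochner\<close>, and the gradients that \<open>mild_solution\<close> and
  \<open>S_T\<close> provide separately are identified by injectivity of the Fourier coefficients.

  Norms of coefficient families are bounds over all finite sets of modes, which pass to limits
  without infinite sums.\<close>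

abbreviation leb :: "real \<Rightarrow> real measure" where
  "leb t \<equiv> lebesgue_on {0..t}"

abbreviation l2n :: "('i \<Rightarrow> complex) \<Rightarrow> 'i set \<Rightarrow> real" where
  "l2n c \<equiv> L2_set (\<lambda>k. cmod (c k))"

abbreviation ksq :: "int \<times> int \<Rightarrow> real" where
  "ksq k \<equiv> (of_int (fst k))\<^sup>2 + (of_int (snd k))\<^sup>2"

text \<open>The Sobolev weight of \<open>H1\<close> without factors of \<open>2 * pi\<close>. The
  summand 1 keeps \<open>sqrt (kw k)\<close> at least 1, so that \<open>H1\<close> bounds contain
  \<open>l2\<close> bounds and the bounded advection coefficients obey the same estimate as a
  divergence.\<close>

definition kw :: "int \<times> int \<Rightarrow> real" where
  "kw k = 1 + (of_int (fst k))\<^sup>2 + (of_int (snd k))\<^sup>2"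

lemma kw_ge_1: "1 \<le> kw k"
  by (simp add: kw_def)

lemma kw_pos [simp]: "0 < kw k"
  using kw_ge_1[of k] by linarith

lemma abs_fst_le_sqrt_kw: "\<bar>of_int (fst k)\<bar> \<le> sqrt (kw k)"
  by (rule real_le_rsqrt) (simp add: kw_def)

lemma abs_snd_le_sqrt_kw: "\<bar>of_int (snd k)\<bar> \<le> sqrt (kw k)"
  by (rule real_le_rsqrt) (simp add: kw_def)

lemma sgm_pos: "0 < sgm t k"
  by (simp add: sgm_def)

lemma sgm_le_1: "0 \<le> t \<Longrightarrow> sgm t k \<le> 1"
  by (simp add: sgm_def)

lemma sgm_add: "sgm (s + t) k = sgm s k * sgm t k"
  by (simp add: sgm_def exp_add [symmetric] algebra_simps)

lemma sgm_0 [simp]: "sgm 0 k = 1"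
  by (simp add: sgm_def)

lemma sgm_uminus: "sgm t (- k) = sgm t k"
  by (simp add: sgm_def)

lemma sgm_le_exp:
  assumes "0 \<le> t"
  shows "sgm t k \<le> exp (- (t * (ksq k)\<^sup>2))"
proof -
  have "1 \<le> 2 * pi" using pi_gt3 by linarith
  then have "(1::real) \<le> (2 * pi) ^ 4" by (rule one_le_power)
  then have "1 * (t * (ksq k)\<^sup>2)
      \<le> (2 * pi) ^ 4 * (t * (ksq k)\<^sup>2)"
    by (rule mult_right_mono) (use assms in simp)
  then show ?thesis by (simp add: sgm_def algebra_simps)
qed

text \<open>The tangent of \<open>y ^ 4\<close> at 1 lies below the convex graph. It bounds the
  quartic Gaussian by a geometric progression.\<close>

lemma fourth_power_ge_tangent: "4 * y - 3 \<le> (y::real) ^ 4"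
proof -
  have "y ^ 4 - (4 * y - 3) = (y\<^sup>2 - 1)\<^sup>2 + 2 * (y - 1)\<^sup>2"
    by algebra
  also have "\<dots> \<ge> 0" by simp
  finally show ?thesis by simp
qed

lemma sum_exp_quartic_nat_bound:
  fixes N :: real
  assumes "1 \<le> N"
  shows "(\<Sum>n<m. exp (- ((real n / N) ^ 4))) \<le> 2 * exp 3 * N"
proof -
  define x where "x = exp (- (4 / N))"
  have x: "0 < x" "x < 1" using assms by (auto simp: x_def)
  have "(\<Sum>n<m. exp (- ((real n / N) ^ 4))) \<le> (\<Sum>n<m. exp 3 * x ^ n)"
  proof (rule sum_mono)
    fix n
    have "- ((real n / N) ^ 4) \<le> 3 + real n * (- (4 / N))"
      using fourth_power_ge_tangent[of "real n / N"] by (simp add: field_simps)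
    then have "exp (- ((real n / N) ^ 4)) \<le> exp (3 + real n * (- (4 / N)))"
      by simp
    also have "\<dots> = exp 3 * x ^ n"
      by (simp only: exp_add x_def exp_of_nat_mult)
    finally show "exp (- ((real n / N) ^ 4)) \<le> exp 3 * x ^ n" .
  qed
  also have "\<dots> = exp 3 * (\<Sum>n<m. x ^ n)" by (simp add: sum_distrib_left)
  also have "(\<Sum>n<m. x ^ n) \<le> 1 / (1 - x)"
    using x by (subst sum_gp_strict) (auto intro!: divide_right_mono)
  \<comment> \<open>\<open>1 + y \<le> exp y\<close> bounds the ratio \<open>x\<close> away from 1
    by \<open>4 / (N + 4)\<close>, and \<open>(N + 4) / 4 \<le> 2 * N\<close> because
    \<open>1 \<le> N\<close>.\<close>
  also have "1 / (1 - x) \<le> 2 * N"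
  proof -
    have "1 + 4 / N \<le> exp (4 / N)" by (rule exp_ge_add_one_self)
    then have "x \<le> 1 / (1 + 4 / N)"
      using assms by (simp add: x_def exp_minus field_simps add_pos_pos)
    then have "4 / (N + 4) \<le> 1 - x"
      using assms by (simp add: field_simps)
    then have "1 / (1 - x) \<le> 1 / (4 / (N + 4))"
      using assms x by (intro divide_left_mono) auto
    also have "\<dots> \<le> 2 * N" using assms by simp
    finally show ?thesis .
  qed
  finally show ?thesis by simp
qed

lemma sum_exp_quartic_int_bound:
  fixes N :: real
  assumes "1 \<le> N" "finite J"
  shows "(\<Sum>n\<in>J. exp (- ((real_of_int n / N) ^ 4))) \<le> 4 * exp 3 * N"
proof -
  obtain m where m: "J \<subseteq> {- int m..int m}"
  proof -
    define m where "m = nat (Max (insert 0 (abs ` J)))"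
    have "\<bar>j\<bar> \<le> int m" if "j \<in> J" for j
      using that assms Max_ge[of "insert 0 (abs ` J)" "\<bar>j\<bar>"] by (auto simp: m_def)
    then show ?thesis by (intro that[of m]) force
  qed
  let ?e = "\<lambda>n. exp (- ((real_of_int n / N) ^ 4))"
  \<comment> \<open>Two copies of the natural numbers cover the integers; counting 0 twice is
    harmless for an upper bound and gives the factor 2.\<close>
  have sub: "{- int m..int m} \<subseteq> int ` {..<Suc m} \<union> (\<lambda>n. - int n) ` {..<Suc m}"
  proof
    fix j assume "j \<in> {- int m..int m}"
    then have "(j = int (nat j) \<and> nat j < Suc m) \<or> (j = - int (nat (- j)) \<and> nat (- j) < Suc m)"
      by auto
    then show "j \<in> int ` {..<Suc m} \<union> (\<lambda>n. - int n) ` {..<Suc m}" by blast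
  qed
  have "sum ?e J \<le> sum ?e (int ` {..<Suc m} \<union> (\<lambda>n. - int n) ` {..<Suc m})"
    using m sub by (intro sum_mono2) auto
  also have "\<dots> \<le> sum ?e (int ` {..<Suc m}) + sum ?e ((\<lambda>n. - int n) ` {..<Suc m})"
    by (subst sum.union_inter [symmetric]) (auto intro!: sum_nonneg)
  also have "\<dots> = 2 * (\<Sum>n<Suc m. exp (- ((real n / N) ^ 4)))"
    by (subst (1 2) sum.reindex) (auto simp: inj_on_def)
  also have "\<dots> \<le> 2 * (2 * exp 3 * N)"
    using sum_exp_quartic_nat_bound[OF assms(1), of "Suc m"] by linarith
  finally show ?thesis by simp
qed

text \<open>Dropping the mixed term of \<open>(a^2 + b^2)^2\<close> separates the variables, and the
  sum is at most a product of two one-dimensional sums. Each counts about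
  \<open>N = s powr (-1/4)\<close> modes below the cut-off of the semigroup.\<close>

lemma sum_exp_quartic_lattice_bound:
  fixes s :: real
  assumes s: "0 < s" "s \<le> 1" and K: "finite K"
  shows "(\<Sum>k\<in>K. exp (- (s * (ksq k)\<^sup>2)))
    \<le> 16 * exp 6 * s powr (- 1 / 2)"
proof -
  define N where "N = s powr (- 1 / 4)"
  have N: "1 \<le> N" using powr_mono'[of "-1/4" 0 s] s by (simp add: N_def)
  have N4: "N ^ 4 = 1 / s"
    using s by (simp add: N_def powr_power powr_neg_one)
  have N2: "N\<^sup>2 = s powr (- 1 / 2)"
    using s by (simp add: N_def powr_power)
  let ?e = "\<lambda>n. exp (- ((real_of_int n / N) ^ 4))"
  have "(\<Sum>k\<in>K. exp (- (s * (ksq k)\<^sup>2)))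
      \<le> (\<Sum>k\<in>K. ?e (fst k) * ?e (snd k))"
  proof (rule sum_mono)
    fix k :: "int \<times> int" assume "k \<in> K"
    obtain a b where k: "k = (a, b)" by (cases k)
    have "(real_of_int a)^4 + (real_of_int b)^4 \<le> ((of_int a)\<^sup>2 + (of_int b)\<^sup>2)\<^sup>2"
      using zero_le_power2[of "real_of_int a * of_int b"]
      by (simp add: power2_eq_square power4_eq_xxxx algebra_simps)
    then have "s * ((real_of_int a)^4 + (real_of_int b)^4) \<le> s * ((of_int a)\<^sup>2 + (of_int b)\<^sup>2)\<^sup>2"
      using s by (intro mult_left_mono) auto
    then show "exp (- (s * (ksq k)\<^sup>2)) \<le> ?e (fst k) * ?e (snd k)"
      by (simp add: k power_divide N4 exp_add [symmetric] algebra_simps)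
  qed
  also have "\<dots> \<le> (\<Sum>k\<in>fst ` K \<times> snd ` K. ?e (fst k) * ?e (snd k))"
    using K by (intro sum_mono2) (auto intro: rev_image_eqI)
  also have "\<dots> = (\<Sum>n\<in>fst ` K. ?e n) * (\<Sum>n\<in>snd ` K. ?e n)"
    by (simp add: sum_product sum.cartesian_product case_prod_beta)
  also have "\<dots> \<le> (4 * exp 3 * N) * (4 * exp 3 * N)"
    using K N by (intro mult_mono sum_exp_quartic_int_bound sum_nonneg) auto
  also have "\<dots> = 16 * exp 6 * N\<^sup>2"
    using exp_add[of 3 "3::real"] by (simp add: power2_eq_square)
  finally show ?thesis by (simp add: N2)
qed

text \<open>Trades the polynomial weight for part of the exponential:
  \<open>(1 + r)^2 \<le> 2 * (1 + r^2)\<close>, then \<open>s \<le> 1\<close> and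
  \<open>1 + x \<le> exp x\<close> with \<open>x = s * r^2\<close>.\<close>

lemma kw_sq_le:
  assumes s: "0 < s" "s \<le> 1"
  shows "(kw k)\<^sup>2 \<le> 2 / s * exp (s * (ksq k)\<^sup>2)"
proof -
  define r where "r = (real_of_int (fst k))\<^sup>2 + (of_int (snd k))\<^sup>2"
  have "(kw k)\<^sup>2 = (1 + r)\<^sup>2" by (simp add: kw_def r_def add.assoc)
  also have "\<dots> \<le> 2 * (1 + r\<^sup>2)"
    using sum_squares_bound[of 1 r] by (simp add: power2_eq_square algebra_simps)
  also have "1 + r\<^sup>2 \<le> (1 + s * r\<^sup>2) / s"
    using s by (simp add: field_simps)
  also have "\<dots> \<le> exp (s * r\<^sup>2) / s"
    using s by (intro divide_right_mono) auto
  finally show ?thesis by (simp add: r_def)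
qed

lemma kw_sgm_sq_le:
  assumes s: "0 < s" "s \<le> 1"
  shows "kw k * (sgm s k)\<^sup>2 \<le> sqrt 2 * s powr (- 1 / 2) * exp (- (s * (ksq k)\<^sup>2))"
proof -
  define E where "E = s * ((real_of_int (fst k))\<^sup>2 + (of_int (snd k))\<^sup>2)\<^sup>2"
  have E0: "E \<ge> 0" using s by (simp add: E_def)
  have "kw k \<le> sqrt (2 / s * exp E)"
    using kw_sq_le[OF s, of k] by (intro real_le_rsqrt) (simp add: E_def)
  also have "\<dots> = sqrt 2 * s powr (- 1 / 2) * exp (E / 2)"
  proof (rule real_sqrt_unique)
    have "(s powr (- 1 / 2))\<^sup>2 = 1 / s"
      using s by (simp add: powr_power powr_neg_one)
    moreover have "(exp (E / 2))\<^sup>2 = exp E" by (simp flip: exp_double)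
    ultimately show "(sqrt 2 * s powr (- 1 / 2) * exp (E / 2))\<^sup>2 = 2 / s * exp E"
      by (simp add: power_mult_distrib)
  qed simp
  also have "\<dots> \<le> sqrt 2 * s powr (- 1 / 2) * exp E"
    using s E0 by (intro mult_left_mono) auto
  finally have *: "kw k \<le> sqrt 2 * s powr (- 1 / 2) * exp E" .
  have "sgm s k \<le> exp (- E)" using sgm_le_exp[of s k] s by (simp add: E_def)
  then have "(sgm s k)\<^sup>2 \<le> (exp (- E))\<^sup>2"
    using sgm_pos[of s k] by (intro power_mono) auto
  then have "kw k * (sgm s k)\<^sup>2 \<le> (sqrt 2 * s powr (- 1 / 2) * exp E) * (exp (- E))\<^sup>2"
    using * by (intro mult_mono) (auto simp: kw_pos)
  also have "\<dots> = sqrt 2 * s powr (- 1 / 2) * exp (- E)"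
    by (simp add: power2_eq_square exp_minus)
  finally show ?thesis by (simp add: E_def)
qed

text \<open>The factor 2 of \<open>kw_sq_le\<close> times the constant \<open>16 * exp 6\<close> of
  the lattice sum, under the square root of the \<open>l2\<close> norm.\<close>

definition kernel_const :: real where "kernel_const = sqrt (32 * exp 6)"

lemma kernel_const_pos: "0 < kernel_const"
  by (simp add: kernel_const_def)

text \<open>Squaring the semigroup gives two copies of the exponential: one absorbs the weight at
  the price \<open>2 / s\<close>, the other is summed over the lattice at the price
  \<open>s powr (-1/2)\<close>. The full weight \<open>kw\<close> combines one derivative from the
  divergence and one from the \<open>H1\<close> norm.\<close>

lemma L2_set_kw_sgm:
  assumes s: "0 < s" "s \<le> 1" and K: "finite K"
  shows "L2_set (\<lambda>k. kw k * sgm s k) K \<le> kernel_const * s powr (- 3 / 4)"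
proof -
  let ?e = "\<lambda>k::int \<times> int. exp (- (s * (ksq k)\<^sup>2))"
  have "(\<Sum>k\<in>K. (kw k * sgm s k)\<^sup>2) \<le> (\<Sum>k\<in>K. 2 / s * ?e k)"
  proof (rule sum_mono)
    fix k
    have "(kw k * sgm s k)\<^sup>2 = (kw k)\<^sup>2 * (sgm s k)\<^sup>2" by (simp add: power_mult_distrib)
    also have "\<dots> \<le> (2 / s * (1 / ?e k)) * (?e k)\<^sup>2"
      using kw_sq_le[OF s, of k] sgm_le_exp[of s k] sgm_pos[of s k] s
      by (intro mult_mono power_mono) (auto simp: exp_minus divide_simps less_imp_le)
    also have "\<dots> = 2 / s * ?e k" by (simp add: power2_eq_square)
    finally show "(kw k * sgm s k)\<^sup>2 \<le> 2 / s * ?e k" .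
  qed
  also have "\<dots> = 2 / s * (\<Sum>k\<in>K. ?e k)" by (simp add: sum_distrib_left)
  also have "\<dots> \<le> 2 / s * (16 * exp 6 * s powr (- 1 / 2))"
    using s by (intro mult_left_mono sum_exp_quartic_lattice_bound K) auto
  also have "\<dots> = 32 * exp 6 * s powr (- 3 / 2)"
    using s powr_add[of s "-1" "-1/2"] by (simp add: powr_minus_divide)
  also have "\<dots> = (kernel_const * s powr (- 3 / 4))\<^sup>2"
    using s by (simp add: kernel_const_def power_mult_distrib powr_power)
  finally show ?thesis
    unfolding L2_set_def using kernel_const_pos s by (intro real_le_lsqrt) (auto intro: sum_nonneg)
qed

text \<open>Counterpart with the divergence only, for the \<open>L2\<close> size of the Duhamel term
  and for Bochner integrability of its integrand.\<close>

lemma L2_set_sqrt_kw_sgm: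
  assumes s: "0 < s" "s \<le> 1" and K: "finite K"
  shows "L2_set (\<lambda>k. sqrt (kw k) * sgm s k) K \<le> kernel_const * s powr (- 1 / 2)"
proof -
  let ?e = "\<lambda>k::int \<times> int. exp (- (s * (ksq k)\<^sup>2))"
  have "(\<Sum>k\<in>K. (sqrt (kw k) * sgm s k)\<^sup>2) \<le> (\<Sum>k\<in>K. sqrt 2 * s powr (- 1 / 2) * ?e k)"
    using kw_sgm_sq_le[OF s] by (intro sum_mono) (simp add: power_mult_distrib less_imp_le)
  also have "\<dots> = sqrt 2 * s powr (- 1 / 2) * (\<Sum>k\<in>K. ?e k)" by (simp add: sum_distrib_left)
  also have "\<dots> \<le> 2 * s powr (- 1 / 2) * (16 * exp 6 * s powr (- 1 / 2))"
    using s by (intro mult_mono sum_exp_quartic_lattice_bound K sum_nonneg) (auto intro: real_le_lsqrt)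
  also have "\<dots> = (kernel_const * s powr (- 1 / 2))\<^sup>2"
    by (simp add: kernel_const_def power_mult_distrib power2_eq_square)
  finally show ?thesis
    unfolding L2_set_def using kernel_const_pos s by (intro real_le_lsqrt) (auto intro: sum_nonneg)
qed

lemma sqrt_kw_sgm_le:
  assumes s: "0 < s" "s \<le> 1"
  shows "sqrt (kw k) * sgm s k \<le> 2 * s powr (- 1 / 4)"
proof -
  have "(sqrt (kw k) * sgm s k)\<^sup>2 = kw k * (sgm s k)\<^sup>2"
    by (simp add: power_mult_distrib less_imp_le)
  also have "\<dots> \<le> sqrt 2 * s powr (- 1 / 2) * exp (- (s * (ksq k)\<^sup>2))"
    by (rule kw_sgm_sq_le[OF s])
  also have "\<dots> \<le> 4 * s powr (- 1 / 2) * 1"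
    using s by (intro mult_mono) (auto intro: real_le_lsqrt)
  also have "\<dots> = (2 * s powr (- 1 / 4))\<^sup>2"
    using s by (simp add: power_mult_distrib powr_power)
  finally show ?thesis by (rule power2_le_imp_le) simp
qed

section \<open>Minkowski's integral inequality and Beta-integral bounds for Duhamel terms\<close>

lemma L2_set_integral_le:
  fixes c :: "'a \<Rightarrow> 'b \<Rightarrow> complex"
  assumes c: "\<And>k. k \<in> K \<Longrightarrow> integrable M (\<lambda>s. c s k)" and B: "integrable M B"
    and le: "AE s in M. l2n (c s) K \<le> B s"
  shows "L2_set (\<lambda>k. cmod (\<integral>s. c s k \<partial>M)) K \<le> (\<integral>s. B s \<partial>M)"
proof -
  define x where "x k = (\<integral>s. c s k \<partial>M)" for k
  define X where "X = l2n x K"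
  have X0: "X \<ge> 0" by (simp add: X_def)
  have B0: "0 \<le> (\<integral>s. B s \<partial>M)"
    using le by (intro integral_nonneg_AE) (auto elim!: eventually_mono intro: order_trans[OF L2_set_nonneg])
  \<comment> \<open>Duality: the vector of integrals is paired with itself, the pairing is moved
    under the integral, and Cauchy-Schwarz there leaves
    \<open>X^2 \<le> X * (integral of B)\<close>.\<close>
  have "complex_of_real (X\<^sup>2) = (\<Sum>k\<in>K. cnj (x k) * x k)"
    by (simp add: X_def L2_set_def sum_nonneg complex_norm_square mult.commute del: of_real_power flip: of_real_power)
  also have "\<dots> = (\<integral>s. (\<Sum>k\<in>K. cnj (x k) * c s k) \<partial>M)"
    by (subst Bochner_Integration.integral_sum) (auto simp: x_def c)
  finally have "X\<^sup>2 = cmod (\<integral>s. (\<Sum>k\<in>K. cnj (x k) * c s k) \<partial>M)"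
    by (metis abs_power2 norm_of_real)
  also have "\<dots> \<le> (\<integral>s. cmod (\<Sum>k\<in>K. cnj (x k) * c s k) \<partial>M)"
    by (rule integral_norm_bound)
  also have "\<dots> \<le> (\<integral>s. X * B s \<partial>M)"
  proof (rule integral_mono_AE)
    show "AE s in M. cmod (\<Sum>k\<in>K. cnj (x k) * c s k) \<le> X * B s"
      using le
    proof (rule eventually_mono)
      fix s assume s: "l2n (c s) K \<le> B s"
      have "cmod (\<Sum>k\<in>K. cnj (x k) * c s k) \<le> (\<Sum>k\<in>K. \<bar>cmod (x k)\<bar> * \<bar>cmod (c s k)\<bar>)"
        by (rule sum_norm_le) (simp add: norm_mult)
      also have "\<dots> \<le> X * l2n (c s) K"
        unfolding X_def by (rule L2_set_mult_ineq)
      also have "\<dots> \<le> X * B s" using s X0 by (rule mult_left_mono)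
      finally show "cmod (\<Sum>k\<in>K. cnj (x k) * c s k) \<le> X * B s" .
    qed
  qed (use c B in auto)
  also have "\<dots> = X * (\<integral>s. B s \<partial>M)" by simp
  finally have "X * X \<le> X * (\<integral>s. B s \<partial>M)" by (simp add: power2_eq_square)
  then have "X \<le> (\<integral>s. B s \<partial>M)" using X0 B0 by (cases "X = 0") auto
  then show ?thesis by (simp add: X_def x_def)
qed

text \<open>Euler's Beta integral after the substitution \<open>s = t * x\<close>; the powers of
  \<open>t\<close> are collected afterwards.\<close>

lemma has_bochner_integral_beta_kernel:
  fixes a b t :: real
  assumes t: "0 < t" and a: "a < 1" and b: "b < 1"
  shows "has_bochner_integral (leb t) (\<lambda>s. (t - s) powr (- a) * s powr (- b))
    (Beta (1 - b) (1 - a) * t powr (1 - a - b))"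
proof -
  let ?f = "\<lambda>s. (t - s) powr (- a) * s powr (- b)"
  have im: "(\<lambda>x. x * t) ` {0..1} = {0..t}"
    using image_mult_atLeastAtMost[of t 0 1] t by (simp add: mult.commute[of _ t])
  have "((\<lambda>x. x powr (1 - b - 1) * (1 - x) powr (1 - a - 1)) has_integral Beta (1 - b) (1 - a)) (cbox 0 1)"
    using has_integral_Beta_real[of "1 - b" "1 - a"] a b by simp
  then have "((\<lambda>s. (s / t) powr (- b) * (1 - s / t) powr (- a)) has_integral t * Beta (1 - b) (1 - a)) {0..t}"
    using has_integral_affinity[of "\<lambda>x. x powr (1 - b - 1) * (1 - x) powr (1 - a - 1)" "Beta (1 - b) (1 - a)" 0 1 "1 / t" 0] t
    by (simp add: im mult.commute[of t])
  then have "((\<lambda>s. t powr (- a - b) * ((s / t) powr (- b) * (1 - s / t) powr (- a)))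
      has_integral t powr (- a - b) * (t * Beta (1 - b) (1 - a))) {0..t}"
    by (rule has_integral_mult_right)
  moreover have "t powr (- a - b) * ((s / t) powr (- b) * (1 - s / t) powr (- a)) = ?f s" if "s \<in> {0..t}" for s
  proof -
    have "(1 - s / t) = (t - s) / t" using t by (simp add: field_simps)
    then show ?thesis using t that
      by (simp add: powr_divide powr_minus powr_diff inverse_eq_divide)
  qed
  moreover have "t powr (- a - b) * (t * Beta (1 - b) (1 - a)) = Beta (1 - b) (1 - a) * t powr (1 - a - b)"
    using t powr_add[of t 1 "- a - b"] by (simp add: algebra_simps)
  ultimately have hi: "(?f has_integral Beta (1 - b) (1 - a) * t powr (1 - a - b)) {0..t}"
    using has_integral_cong[of "{0..t}" ?f "\<lambda>s. t powr (- a - b) * ((s / t) powr (- b) * (1 - s / t) powr (- a))"] by simp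
  have "?f absolutely_integrable_on {0..t}"
    using hi by (intro nonnegative_absolutely_integrable_1) (auto simp: has_integral_integrable)
  then have i: "integrable (leb t) ?f"
    by (simp add: set_integrable_def integrable_restrict_space)
  then show ?thesis
    using hi by (simp add: has_bochner_integral_iff lebesgue_integral_eq_integral integral_unique)
qed

lemma beta_kernel_integrable:
  fixes a b t :: real
  assumes "a < 1" "b < 1"
  shows "integrable (leb t) (\<lambda>s. (t - s) powr (- a) * s powr (- b))"
proof -
  consider "0 < t" | "t = 0" | "t < 0" by linarith
  then show ?thesis
  proof cases
    case 1
    then show ?thesis
      using has_bochner_integral_beta_kernel[OF _ assms, of t] by (simp add: has_bochner_integral_iff)
  next
    case 2
    \<comment> \<open>The interval is the single point 0, where the integrand vanishes by the
      convention \<open>0 powr x = 0\<close>.\<close>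
    have "(\<lambda>s. indicator {0..0} s *\<^sub>R ((0 - s) powr (- a) * s powr (- b))) = (\<lambda>_. 0)"
      by (auto simp: fun_eq_iff indicator_def)
    with 2 show ?thesis by (simp add: integrable_restrict_space)
  qed auto
qed

lemma integrable_of_bound_on_Icc:
  fixes f :: "real \<Rightarrow> 'b::{banach, second_countable_topology}"
  assumes "f \<in> borel_measurable (leb t)" "b < 1"
    and "AE s in leb t. norm (f s) \<le> C * s powr (- b)"
  shows "integrable (leb t) f"
proof (rule Bochner_Integration.integrable_bound)
  show "integrable (leb t) (\<lambda>s. \<bar>C\<bar> * ((t - s) powr (- 0) * s powr (- b)))"
    using beta_kernel_integrable[of 0 b t] assms by (intro integrable_mult_right) auto
  \<comment> \<open>The dominating function is the Beta kernel with first exponent 0. Since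
    \<open>0 powr 0\<close> is 0, its first factor equals 1 only away from
    \<open>s = t\<close>.\<close>
  have "AE s in leb t. s \<noteq> t"
    using AE_lborel_singleton[of t] by (auto intro!: AE_completion simp: AE_restrict_space_iff)
  with assms(3) show "AE s in leb t. norm (f s) \<le> norm (\<bar>C\<bar> * ((t - s) powr (- 0) * s powr (- b)))"
  proof eventually_elim
    case (elim s)
    have "C * s powr (- b) \<le> \<bar>C\<bar> * s powr (- b)" by (intro mult_right_mono) auto
    with elim show ?case by (auto simp: abs_mult)
  qed
qed fact

lemma borel_measurable_lebesgue_on: "f \<in> borel_measurable borel \<Longrightarrow> f \<in> borel_measurable (lebesgue_on S)"
  by (simp add: measurable_completion measurable_restrict_space1)

lemma measurable_sgm_diff [measurable]: "(\<lambda>s. sgm (t - s) k) \<in> borel_measurable (lebesgue_on S)"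
  by (rule borel_measurable_lebesgue_on) (simp add: sgm_def)

lemma duhamel_integrable:
  fixes n :: "real \<Rightarrow> complex"
  assumes [measurable]: "n \<in> borel_measurable (leb t)" and "b < 1"
    and le: "AE s in leb t. cmod (n s) \<le> C * s powr (- b)"
  shows "integrable (leb t) (\<lambda>s. complex_of_real (sgm (t - s) k) * n s)"
proof (rule integrable_of_bound_on_Icc)
  show "AE s in leb t. cmod (complex_of_real (sgm (t - s) k) * n s) \<le> C * s powr (- b)"
    using le AE_space
  proof eventually_elim
    case (elim s)
    have "sgm (t - s) k * cmod (n s) \<le> 1 * cmod (n s)"
      using elim by (intro mult_right_mono sgm_le_1) auto
    with elim show ?case using sgm_pos[of "t - s" k] by (simp add: norm_mult)
  qed
qed (use \<open>b < 1\<close> in auto)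

text \<open>The weight \<open>exp (l * s)\<close> makes the Duhamel operator a contraction on long time
  intervals when \<open>l\<close> is large; with \<open>l = 0\<close> the smallness comes from the length of the interval.\<close>

lemma duhamel_bound:
  fixes n :: "real \<Rightarrow> int \<times> int \<Rightarrow> complex"
  assumes t: "0 < t" "t \<le> 1" and b: "1 / 4 < b" "b < 1 / 2" and L: "0 \<le> L" and K: "finite K" and l: "0 \<le> l"
    and n: "\<And>k. (\<lambda>s. n s k) \<in> borel_measurable (leb t)"
    and le: "AE s in leb t. \<forall>k. cmod (n s k) \<le> L * sqrt (kw k) * s powr (- b) * exp (l * s)"
    and kappa: "\<And>s. 0 < s \<Longrightarrow> s \<le> t \<Longrightarrow> exp (- (l * s)) * s powr (1 / 2 - b) \<le> kappa"
  shows "L2_set (\<lambda>k. sqrt (kw k) * cmod (\<integral>s. complex_of_real (sgm (t - s) k) * n s k \<partial>leb t)) K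
    \<le> L * kernel_const * Beta (1 - b) (b - 1 / 4) * kappa * t powr (- 1 / 4) * exp (l * t)"
proof -
  let ?M = "leb t"
  \<comment> \<open>The kernel power -3/4 will be written as \<open>(1/2 - b) + (- ?a)\<close>. The
    first part becomes \<open>kappa\<close>; the second integrates against
    \<open>s powr (-b)\<close> to exactly \<open>t powr (-1/4)\<close>, since
    \<open>?a + b = 5/4\<close>, and \<open>?a < 1\<close> because \<open>1/4 < b\<close>.\<close>
  let ?a = "5 / 4 - b"
  define B where "B s = (L * kernel_const * kappa * exp (l * t)) * ((t - s) powr (- ?a) * s powr (- b))" for s
  have Bi: "has_bochner_integral ?M B
      ((L * kernel_const * kappa * exp (l * t)) * (Beta (1 - b) (1 - ?a) * t powr (1 - ?a - b)))"
    unfolding B_def using t b by (intro has_bochner_integral_mult_right has_bochner_integral_beta_kernel) auto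
  have ne: "AE s in ?M. s \<noteq> t"
    using AE_lborel_singleton[of t] by (auto intro!: AE_completion simp: AE_restrict_space_iff)
  have int: "integrable ?M (\<lambda>s. complex_of_real (sqrt (kw k)) * (complex_of_real (sgm (t - s) k) * n s k))" for k
  proof (intro integrable_mult_right duhamel_integrable[where b = b and C = "L * sqrt (kw k) * exp (l * t)"])
    show "AE s in ?M. cmod (n s k) \<le> L * sqrt (kw k) * exp (l * t) * s powr (- b)"
      using le AE_space
    proof eventually_elim
      case (elim s)
      have "L * sqrt (kw k) * s powr (- b) * exp (l * s) \<le> L * sqrt (kw k) * s powr (- b) * exp (l * t)"
        using elim l L by (intro mult_left_mono) (auto intro!: mult_left_mono simp: less_imp_le)
      with elim(1)[rule_format, of k] show ?case by (simp add: ac_simps)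
    qed
  qed (use n b in auto)
  have "L2_set (\<lambda>k. cmod (\<integral>s. complex_of_real (sqrt (kw k)) * (complex_of_real (sgm (t - s) k) * n s k) \<partial>?M)) K
      \<le> (\<integral>s. B s \<partial>?M)"
  proof (rule L2_set_integral_le)
    show "integrable ?M B" using Bi by (simp add: has_bochner_integral_iff)
    show "AE s in ?M. L2_set (\<lambda>k. cmod (complex_of_real (sqrt (kw k)) * (complex_of_real (sgm (t - s) k) * n s k))) K \<le> B s"
      using le ne AE_space
    proof eventually_elim
      case (elim s)
      define q where "q = t - s"
      have q: "0 < q" "q \<le> t" "q \<le> 1" using elim t by (auto simp: q_def)
      define A where "A = L * s powr (- b) * exp (l * s)"
      have A: "A \<ge> 0" using L by (simp add: A_def)
      have "L2_set (\<lambda>k. cmod (complex_of_real (sqrt (kw k)) * (complex_of_real (sgm q k) * n s k))) K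
          \<le> L2_set (\<lambda>k. A * (kw k * sgm q k)) K"
      proof (rule L2_set_mono)
        fix k
        have "cmod (complex_of_real (sqrt (kw k)) * (complex_of_real (sgm q k) * n s k))
            = sqrt (kw k) * sgm q k * cmod (n s k)"
          using sgm_pos[of q k] by (simp add: norm_mult less_imp_le)
        also have "\<dots> \<le> sqrt (kw k) * sgm q k * (L * sqrt (kw k) * s powr (- b) * exp (l * s))"
          using elim(1)[rule_format, of k] sgm_pos[of q k] by (intro mult_left_mono) (auto simp: less_imp_le)
        also have "\<dots> = A * ((sqrt (kw k) * sqrt (kw k)) * sgm q k)" by (simp add: A_def)
        finally show "cmod (complex_of_real (sqrt (kw k)) * (complex_of_real (sgm q k) * n s k)) \<le> A * (kw k * sgm q k)"
          by (simp add: less_imp_le)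
      qed simp
      also have "\<dots> = A * L2_set (\<lambda>k. kw k * sgm q k) K"
        using A by (simp add: L2_set_right_distrib)
      also have "\<dots> \<le> A * (kernel_const * q powr (- 3 / 4))"
        by (intro mult_left_mono L2_set_kw_sgm q K A)
      also have "q powr (- 3 / 4) = q powr (1 / 2 - b) * q powr (- ?a)"
        by (simp flip: powr_add)
      also have "A * (kernel_const * (q powr (1 / 2 - b) * q powr (- ?a)))
          = L * kernel_const * exp (l * t) * s powr (- b) * q powr (- ?a) * (exp (- (l * q)) * q powr (1 / 2 - b))"
      \<comment> \<open>The weight at time \<open>s\<close> is the weight at time \<open>t\<close>
        times a decay in the elapsed time \<open>q = t - s\<close>; that decay is what makes
        \<open>kappa\<close> small for large \<open>l\<close>.\<close>
      proof -
        have "exp (l * s) = exp (l * t) * exp (- (l * q))"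
          by (simp add: q_def algebra_simps flip: exp_add)
        then show ?thesis by (simp add: A_def)
      qed
      also have "\<dots> \<le> L * kernel_const * exp (l * t) * s powr (- b) * q powr (- ?a) * kappa"
        using kappa[OF q(1,2)] L kernel_const_pos by (intro mult_left_mono) auto
      also have "\<dots> = B s" by (simp add: B_def q_def)
      finally show ?case by (simp add: q_def)
    qed
  qed (use int in auto)
  also have "(\<integral>s. B s \<partial>?M) = (L * kernel_const * kappa * exp (l * t)) * (Beta (1 - b) (1 - ?a) * t powr (1 - ?a - b))"
    using Bi by (simp add: has_bochner_integral_iff)
  also have "(\<lambda>k. cmod (\<integral>s. complex_of_real (sqrt (kw k)) * (complex_of_real (sgm (t - s) k) * n s k) \<partial>?M))
      = (\<lambda>k. sqrt (kw k) * cmod (\<integral>s. complex_of_real (sgm (t - s) k) * n s k \<partial>?M))"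
    by (simp add: norm_mult less_imp_le)
  finally show ?thesis by (simp add: mult_ac)
qed

lemma L2_set_sgm_mult_le:
  assumes "0 < q" "q \<le> 1" "0 \<le> L" "finite K" "\<And>k. cmod (n k) \<le> L * sqrt (kw k)"
  shows "L2_set (\<lambda>k. cmod (complex_of_real (sgm q k) * n k)) K \<le> L * kernel_const * q powr (- 1 / 2)"
proof -
  have "L2_set (\<lambda>k. cmod (complex_of_real (sgm q k) * n k)) K \<le> L2_set (\<lambda>k. L * (sqrt (kw k) * sgm q k)) K"
  proof (rule L2_set_mono)
    fix k
    have "sgm q k * cmod (n k) \<le> sgm q k * (L * sqrt (kw k))"
      using assms(5)[of k] sgm_pos[of q k] by (intro mult_left_mono) auto
    then show "cmod (complex_of_real (sgm q k) * n k) \<le> L * (sqrt (kw k) * sgm q k)"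
      using sgm_pos[of q k] by (simp add: norm_mult mult_ac)
  qed simp
  also have "\<dots> = L * L2_set (\<lambda>k. sqrt (kw k) * sgm q k) K"
    using assms by (simp add: L2_set_right_distrib)
  also have "\<dots> \<le> L * (kernel_const * q powr (- 1 / 2))"
    by (intro mult_left_mono L2_set_sqrt_kw_sgm assms)
  finally show ?thesis by simp
qed

text \<open>Without the \<open>H1\<close> weight the kernel power is -1/2, so the bound carries the
  exponent \<open>1/2 - b\<close>. For \<open>b < 1/2\<close> it vanishes as \<open>t\<close> tends
  to 0, which yields continuity at the initial time.\<close>

lemma duhamel_bound_L2:
  fixes n :: "real \<Rightarrow> int \<times> int \<Rightarrow> complex"
  assumes t: "0 < t" "t \<le> 1" and b: "b < 1" and L: "0 \<le> L" and K: "finite K"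
    and n: "\<And>k. (\<lambda>s. n s k) \<in> borel_measurable (leb t)"
    and le: "AE s in leb t. \<forall>k. cmod (n s k) \<le> L * sqrt (kw k) * s powr (- b)"
  shows "L2_set (\<lambda>k. cmod (\<integral>s. complex_of_real (sgm (t - s) k) * n s k \<partial>leb t)) K
    \<le> L * kernel_const * Beta (1 - b) (1 / 2) * t powr (1 / 2 - b)"
proof -
  let ?M = "leb t"
  define B where "B s = (L * kernel_const) * ((t - s) powr (- (1 / 2)) * s powr (- b))" for s
  have Bi: "has_bochner_integral ?M B ((L * kernel_const) * (Beta (1 - b) (1 - 1 / 2) * t powr (1 - 1 / 2 - b)))"
    unfolding B_def using t b by (intro has_bochner_integral_mult_right has_bochner_integral_beta_kernel) auto
  have ne: "AE s in ?M. s \<noteq> t"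
    using AE_lborel_singleton[of t] by (auto intro!: AE_completion simp: AE_restrict_space_iff)
  have "L2_set (\<lambda>k. cmod (\<integral>s. complex_of_real (sgm (t - s) k) * n s k \<partial>?M)) K \<le> (\<integral>s. B s \<partial>?M)"
  proof (rule L2_set_integral_le)
    show "integrable ?M (\<lambda>s. complex_of_real (sgm (t - s) k) * n s k)" for k
    proof (rule duhamel_integrable[where b = b and C = "L * sqrt (kw k)"])
      show "AE s in ?M. cmod (n s k) \<le> L * sqrt (kw k) * s powr (- b)"
        using le by eventually_elim blast
    qed (use n b in auto)
    show "integrable ?M B" using Bi by (simp add: has_bochner_integral_iff)
    show "AE s in ?M. L2_set (\<lambda>k. cmod (complex_of_real (sgm (t - s) k) * n s k)) K \<le> B s"
      using le ne AE_space
    proof eventually_elim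
      case (elim s)
      have "L2_set (\<lambda>k. cmod (complex_of_real (sgm (t - s) k) * n s k)) K
          \<le> (L * s powr (- b)) * kernel_const * (t - s) powr (- 1 / 2)"
        using elim(2,3) t L K elim(1)[rule_format] by (intro L2_set_sgm_mult_le) (auto simp: mult_ac)
      then show ?case by (simp add: B_def mult_ac)
    qed
  qed
  then show ?thesis using Bi by (simp add: has_bochner_integral_iff mult_ac)
qed

section \<open>The torus as a probability space\<close>

abbreviation tor :: "(real \<times> real) measure" where
  "tor \<equiv> lebesgue_on torus_sq"

lemma torus_sq_cbox: "torus_sq = cbox (0, 0) (1, 1)"
  by (simp add: torus_sq_def cbox_Pair_eq)

lemma torus_sq_borel [measurable]: "torus_sq \<in> sets borel"
  by (simp add: torus_sq_cbox)

lemma torus_sq_lebesgue [measurable]: "torus_sq \<in> sets lebesgue"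
  by (simp add: torus_sq_cbox)

lemma emeasure_tor: "emeasure tor (space tor) = 1"
  by (simp add: emeasure_restrict_space torus_sq_cbox space_restrict_space emeasure_lborel_cbox_eq
      Basis_prod_def inner_prod_def)

lemma finite_measure_tor: "finite_measure tor"
  by (rule finite_measureI) (use emeasure_tor in simp)

interpretation tor: finite_measure tor
  by (rule finite_measure_tor)

lemma measure_tor: "measure tor (space tor) = 1"
  using emeasure_tor by (simp add: measure_def)

lemma borel_measurable_tor: "f \<in> borel_measurable borel \<Longrightarrow> f \<in> borel_measurable tor"
  by (simp add: measurable_completion measurable_restrict_space1)

text \<open>Gives access to Fubini: \<open>lborel\<close> on the plane is a product measure, whereas
  its completion is not the product of the completed factors.\<close>

lemma integral_tor_eq_lborel:
  fixes f :: "real \<times> real \<Rightarrow> 'a::{banach, second_countable_topology}"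
  assumes "f \<in> borel_measurable borel"
  shows "(\<integral>x. f x \<partial>tor) = (\<integral>x. indicator torus_sq x *\<^sub>R f x \<partial>lborel)"
proof -
  have "(\<integral>x. f x \<partial>tor) = (\<integral>x. indicator torus_sq x *\<^sub>R f x \<partial>lebesgue)"
    by (subst integral_restrict_space) auto
  also have "\<dots> = (\<integral>x. indicator torus_sq x *\<^sub>R f x \<partial>lborel)"
    using assms by (intro integral_completion) auto
  finally show ?thesis .
qed

subsection \<open>Square-integrable functions\<close>

lemma L2_integrable_mult:
  assumes f: "L2 f" and g: "L2 g"
  shows "integrable tor (\<lambda>x. f x * g x)"
proof (rule Bochner_Integration.integrable_bound)
  show "integrable tor (\<lambda>x. (f x)\<^sup>2 + (g x)\<^sup>2)" using assms by (auto simp: L2_def)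
  have "norm (f x * g x) \<le> norm ((f x)\<^sup>2 + (g x)\<^sup>2)" for x
  proof -
    have "0 \<le> \<bar>f x\<bar> * \<bar>g x\<bar>" by simp
    moreover have "2 * (\<bar>f x\<bar> * \<bar>g x\<bar>) \<le> (f x)\<^sup>2 + (g x)\<^sup>2"
      using sum_squares_bound[of "\<bar>f x\<bar>" "\<bar>g x\<bar>"] by (simp add: mult.assoc)
    ultimately have "\<bar>f x\<bar> * \<bar>g x\<bar> \<le> (f x)\<^sup>2 + (g x)\<^sup>2" by linarith
    then show ?thesis by (simp add: abs_mult)
  qed
  then show "AE x in tor. norm (f x * g x) \<le> norm ((f x)\<^sup>2 + (g x)\<^sup>2)" by simp
qed (use assms in \<open>auto simp: L2_def\<close>)

lemma L2_I:
  assumes "f \<in> borel_measurable tor" "integrable tor g" "AE x in tor. (f x)\<^sup>2 \<le> g x"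
  shows "L2 f"
  unfolding L2_def using assms
  by (auto intro!: Bochner_Integration.integrable_bound[OF assms(2)] elim!: eventually_mono)

lemma L2_add: "L2 f \<Longrightarrow> L2 g \<Longrightarrow> L2 (\<lambda>x. f x + g x)"
  using L2_integrable_mult[of f g] by (auto simp: L2_def power2_sum mult.assoc)

lemma L2_cmult: "L2 f \<Longrightarrow> L2 (\<lambda>x. c * f x)"
  by (auto simp: L2_def power_mult_distrib)

lemma L2_diff: "L2 f \<Longrightarrow> L2 g \<Longrightarrow> L2 (\<lambda>x. f x - g x)"
  using L2_add[of f "\<lambda>x. - 1 * g x"] L2_cmult[of g "- 1"] by simp

lemma L2_const: "L2 (\<lambda>x. c)"
  by (simp add: L2_def)

lemma L2_abs: "L2 f \<Longrightarrow> L2 (\<lambda>x. \<bar>f x\<bar>)"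
  by (auto simp: L2_def)

lemma L2_bounded:
  assumes "f \<in> borel_measurable tor" "\<And>x. \<bar>f x\<bar> \<le> C"
  shows "L2 f"
proof (rule L2_I)
  show "AE x in tor. (f x)\<^sup>2 \<le> C\<^sup>2"
    using assms(2) abs_ge_self[of C] unfolding abs_le_square_iff[symmetric] by (intro AE_I2) (rule order_trans)
qed (use assms in auto)

lemma L2_imp_L1: "L2 f \<Longrightarrow> L1 f"
  using L2_integrable_mult[of f "\<lambda>_. 1"] L2_const[of 1] by (simp add: L1_def)

lemma L2norm_nonneg [simp]: "0 \<le> L2norm f"
  by (simp add: L2norm_def)

lemma L2norm_sq: "(L2norm f)\<^sup>2 = (\<integral>x. (f x)\<^sup>2 \<partial>tor)"
  by (simp add: L2norm_def)

lemma L2norm_abs: "L2norm (\<lambda>x. \<bar>f x\<bar>) = L2norm f"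
  by (simp add: L2norm_def)

text \<open>The quadratic form given by the integral of \<open>(a * |f| - b * |g|)^2\<close> is
  nonnegative. It is evaluated at \<open>a = G + e\<close>, \<open>b = F + e\<close>; the positive
  \<open>e\<close> permits cancellation when a norm vanishes and is then sent to 0.\<close>

lemma L2_Cauchy_Schwarz:
  assumes f: "L2 f" and g: "L2 g"
  shows "(\<integral>x. \<bar>f x * g x\<bar> \<partial>tor) \<le> L2norm f * L2norm g"
proof -
  define F G P where "F = L2norm f" and "G = L2norm g" and "P = (\<integral>x. \<bar>f x\<bar> * \<bar>g x\<bar> \<partial>tor)"
  have pos: "0 \<le> a\<^sup>2 * F\<^sup>2 - 2 * a * b * P + b\<^sup>2 * G\<^sup>2" for a b
  proof -
    have "0 \<le> (\<integral>x. (a * \<bar>f x\<bar> - b * \<bar>g x\<bar>)\<^sup>2 \<partial>tor)" by simp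
    also have "\<dots> = (\<integral>x. a\<^sup>2 * (f x)\<^sup>2 - 2 * a * b * (\<bar>f x\<bar> * \<bar>g x\<bar>) + b\<^sup>2 * (g x)\<^sup>2 \<partial>tor)"
      by (rule Bochner_Integration.integral_cong) (auto simp: power2_diff power_mult_distrib)
    also have "\<dots> = a\<^sup>2 * F\<^sup>2 - 2 * a * b * P + b\<^sup>2 * G\<^sup>2"
      using L2_integrable_mult[OF L2_abs[OF f] L2_abs[OF g]] f g
      by (simp add: L2_def F_def G_def P_def L2norm_sq)
    finally show ?thesis .
  qed
  have FG: "0 \<le> F" "0 \<le> G" by (auto simp: F_def G_def)
  have le: "P \<le> (F + e) * (G + e)" if e: "0 < e" for e
  proof -
    define x y where "x = F + e" and "y = G + e"
    have xy: "0 < x" "0 < y" "F \<le> x" "G \<le> y" using FG e by (auto simp: x_def y_def)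
    have "y\<^sup>2 * F\<^sup>2 \<le> y\<^sup>2 * x\<^sup>2" "x\<^sup>2 * G\<^sup>2 \<le> x\<^sup>2 * y\<^sup>2"
      using FG xy by (auto intro!: mult_left_mono power_mono)
    with pos[of y x] have "(x * y) * P \<le> (x * y) * (x * y)"
      by (simp add: power2_eq_square mult_ac)
    moreover have "0 < x * y" using xy by simp
    ultimately have "P \<le> x * y" by (simp only: mult_le_cancel_left_pos)
    then show ?thesis by (simp add: x_def y_def)
  qed
  have "((\<lambda>e. (F + e) * (G + e)) \<longlongrightarrow> (F + 0) * (G + 0)) (at_right 0)" by (intro tendsto_intros)
  then have "P \<le> (F + 0) * (G + 0)"
    by (rule tendsto_lowerbound) (auto simp: eventually_at_right_field le intro!: exI[of _ 1])
  then have "P \<le> F * G" by simp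
  then show ?thesis by (simp add: P_def F_def G_def abs_mult)
qed

lemma integral_abs_le_L2norm:
  assumes "L2 f" shows "(\<integral>x. \<bar>f x\<bar> \<partial>tor) \<le> L2norm f"
  using L2_Cauchy_Schwarz[OF assms L2_const[of 1]] measure_tor by (simp add: L2norm_def)

lemma L2norm_triangle:
  assumes f: "L2 f" and g: "L2 g"
  shows "L2norm (\<lambda>x. f x + g x) \<le> L2norm f + L2norm g"
proof (rule power2_le_imp_le)
  have i: "integrable tor (\<lambda>x. f x * g x)" by (rule L2_integrable_mult[OF f g])
  have "(L2norm (\<lambda>x. f x + g x))\<^sup>2 = (\<integral>x. (f x)\<^sup>2 + (g x)\<^sup>2 + 2 * (f x * g x) \<partial>tor)"
    unfolding L2norm_sq by (rule Bochner_Integration.integral_cong) (auto simp: power2_sum)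
  also have "\<dots> = (L2norm f)\<^sup>2 + (L2norm g)\<^sup>2 + 2 * (\<integral>x. f x * g x \<partial>tor)"
    using f g i by (simp add: L2_def L2norm_sq)
  also have "(\<integral>x. f x * g x \<partial>tor) \<le> (\<integral>x. \<bar>f x * g x\<bar> \<partial>tor)"
    using i by (intro integral_mono) auto
  also have "\<dots> \<le> L2norm f * L2norm g" by (rule L2_Cauchy_Schwarz[OF f g])
  finally show "(L2norm (\<lambda>x. f x + g x))\<^sup>2 \<le> (L2norm f + L2norm g)\<^sup>2"
    by (simp add: power2_sum)
qed simp

lemma L2norm_minus_commute: "L2norm (\<lambda>x. f x - g x) = L2norm (\<lambda>x. g x - f x)"
  by (simp add: L2norm_def power2_commute)

lemma L2norm_diff_triangle:
  assumes "L2 f" "L2 g" "L2 h"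
  shows "L2norm (\<lambda>x. f x - h x) \<le> L2norm (\<lambda>x. f x - g x) + L2norm (\<lambda>x. g x - h x)"
  using L2norm_triangle[of "\<lambda>x. f x - g x" "\<lambda>x. g x - h x"] assms by (simp add: L2_diff)

lemma L2norm_mono:
  assumes "L2 g" "f \<in> borel_measurable tor" "AE x in tor. \<bar>f x\<bar> \<le> \<bar>g x\<bar>"
  shows "L2norm f \<le> L2norm g"
proof -
  have "AE x in tor. (f x)\<^sup>2 \<le> (g x)\<^sup>2" using assms(3) by (simp add: abs_le_square_iff)
  then show ?thesis
    unfolding L2norm_def using assms
    by (intro real_sqrt_le_mono integral_mono_AE)
      (auto simp: L2_def intro!: Bochner_Integration.integrable_bound[of tor "\<lambda>x. (g x)\<^sup>2"])
qed

lemma L2norm_cong_AE: "AE x in tor. f x = g x \<Longrightarrow> f \<in> borel_measurable tor \<Longrightarrow> g \<in> borel_measurable tor \<Longrightarrow> L2norm f = L2norm g"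
  unfolding L2norm_def by (intro arg_cong[of _ _ sqrt] integral_cong_AE) auto

lemma L2_Fatou:
  assumes g: "\<And>i. L2 (g i)" "\<And>i. L2norm (g i) \<le> B" and h: "h \<in> borel_measurable tor"
    and lim: "AE x in tor. (\<lambda>i. g i x) \<longlonglongrightarrow> h x"
  shows "L2 h" "L2norm h \<le> B"
proof -
  have B0: "0 \<le> B" using g(2)[of 0] L2norm_nonneg[of "g 0"] by linarith
  have gi: "(\<integral>\<^sup>+x. ennreal ((g i x)\<^sup>2) \<partial>tor) \<le> ennreal (B\<^sup>2)" for i
    using g[of i] by (subst nn_integral_eq_integral) (auto simp: L2_def L2norm_sq[symmetric] intro!: ennreal_leI power_mono)
  have "(\<integral>\<^sup>+x. ennreal ((h x)\<^sup>2) \<partial>tor) \<le> (\<integral>\<^sup>+x. liminf (\<lambda>i. ennreal ((g i x)\<^sup>2)) \<partial>tor)"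
  proof (rule nn_integral_mono_AE)
    show "AE x in tor. ennreal ((h x)\<^sup>2) \<le> liminf (\<lambda>i. ennreal ((g i x)\<^sup>2))"
      using lim
    proof eventually_elim
      case (elim x)
      then have "(\<lambda>i. ennreal ((g i x)\<^sup>2)) \<longlonglongrightarrow> ennreal ((h x)\<^sup>2)"
        by (intro tendsto_ennrealI tendsto_power)
      from lim_imp_Liminf[OF _ this] show ?case by simp
    qed
  qed
  also have "\<dots> \<le> liminf (\<lambda>i. \<integral>\<^sup>+x. ennreal ((g i x)\<^sup>2) \<partial>tor)"
    using g(1) by (intro nn_integral_liminf) (auto simp: L2_def)
  also have "\<dots> \<le> ennreal (B\<^sup>2)"
    using Liminf_mono[of "\<lambda>i. \<integral>\<^sup>+x. ennreal ((g i x)\<^sup>2) \<partial>tor" "\<lambda>_. ennreal (B\<^sup>2)" sequentially] gi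
    by (simp add: Liminf_const)
  finally have *: "(\<integral>\<^sup>+x. ennreal ((h x)\<^sup>2) \<partial>tor) \<le> ennreal (B\<^sup>2)" .
  then have int: "integrable tor (\<lambda>x. (h x)\<^sup>2)"
    using h by (intro integrableI_bounded) (auto simp: top_unique less_top intro: le_less_trans)
  then show "L2 h" using h by (simp add: L2_def)
  have "ennreal (\<integral>x. (h x)\<^sup>2 \<partial>tor) \<le> ennreal (B\<^sup>2)"
    using * int by (simp add: nn_integral_eq_integral)
  then have "(L2norm h)\<^sup>2 \<le> B\<^sup>2" by (simp add: L2norm_sq)
  then show "L2norm h \<le> B" using B0 by (rule power2_le_imp_le)
qed

text \<open>The series of absolute increments has a finite integral, by summing the geometric
  bounds, hence is finite almost everywhere; there the sequence converges by telescoping.\<close>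

lemma AE_convergent_of_geometric_L1:
  fixes f :: "nat \<Rightarrow> 'a \<Rightarrow> real"
  assumes f: "\<And>j. integrable M (f j)" and le: "\<And>j. (\<integral>x. \<bar>f (Suc j) x - f j x\<bar> \<partial>M) \<le> (1 / 2) ^ j"
  shows "AE x in M. convergent (\<lambda>j. f j x)"
proof -
  have [measurable]: "f j \<in> borel_measurable M" for j using f by auto
  have nn: "(\<integral>\<^sup>+x. ennreal \<bar>f (Suc j) x - f j x\<bar> \<partial>M) \<le> ennreal ((1 / 2) ^ j)" for j
    using le[of j] f by (subst nn_integral_eq_integral) (auto intro!: ennreal_leI)
  have "(\<integral>\<^sup>+x. (\<Sum>j. ennreal \<bar>f (Suc j) x - f j x\<bar>) \<partial>M) = (\<Sum>j. \<integral>\<^sup>+x. ennreal \<bar>f (Suc j) x - f j x\<bar> \<partial>M)"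
    by (intro nn_integral_suminf) auto
  also have "\<dots> \<le> (\<Sum>j. ennreal ((1 / 2) ^ j))"
    by (intro suminf_le nn) auto
  also have "\<dots> = ennreal (\<Sum>j. (1 / 2) ^ j)"
    by (intro suminf_ennreal2) (auto intro: summable_geometric)
  also have "\<dots> < \<infinity>" by simp
  finally have "AE x in M. (\<Sum>j. ennreal \<bar>f (Suc j) x - f j x\<bar>) \<noteq> \<infinity>"
    by (intro nn_integral_PInf_AE) auto
  then show ?thesis
  proof eventually_elim
    case (elim x)
    then have "summable (\<lambda>j. \<bar>f (Suc j) x - f j x\<bar>)"
      by (intro summable_suminf_not_top) auto
    then have "summable (\<lambda>j. f (Suc j) x - f j x)"
      by (rule summable_rabs_cancel)
    then have "convergent (\<lambda>n. f n x - f 0 x)"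
      by (simp add: summable_iff_convergent sum_lessThan_telescope[of "\<lambda>i. f i x"])
    then have "convergent (\<lambda>n. f n x - f 0 x + f 0 x)"
      by (intro convergent_add convergent_const)
    then show ?case by simp
  qed
qed

subsection \<open>Trigonometric polynomials\<close>

definition ek :: "int \<times> int \<Rightarrow> real \<times> real \<Rightarrow> complex" where
  "ek k x = cis (2 * pi * (of_int (fst k) * fst x + of_int (snd k) * snd x))"

lemma ek_0 [simp]: "ek 0 x = 1"
  by (simp add: ek_def)

lemma ek_add: "ek (j + k) x = ek j x * ek k x"
  by (simp add: ek_def cis_mult algebra_simps)

lemma cnj_ek: "cnj (ek k x) = ek (- k) x"
  by (simp add: ek_def cis_cnj ring_distribs)

lemma norm_ek [simp]: "cmod (ek k x) = 1"
  by (simp add: ek_def)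

lemma ek_borel [measurable]: "ek k \<in> borel_measurable borel"
  unfolding ek_def cis_conv_exp by (intro borel_measurable_continuous_onI continuous_intros)

lemma ek_tor [measurable]: "ek k \<in> borel_measurable tor"
  by (rule borel_measurable_tor) simp

lemma fc_eq: "fc f k = (\<integral>x. complex_of_real (f x) * ek (- k) x \<partial>tor)"
  unfolding fc_def ek_def by (simp add: algebra_simps)

lemma integrable_ek [simp]: "integrable tor (ek k)"
  by (rule tor.integrable_const_bound[of _ 1]) auto

lemma integrable_mult_ek:
  fixes f :: "real \<times> real \<Rightarrow> complex"
  assumes "integrable tor f" shows "integrable tor (\<lambda>x. f x * ek k x)"
  using assms by (rule Bochner_Integration.integrable_bound) (use assms in \<open>auto simp: norm_mult\<close>)

lemma integral_cis_unit_interval: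
  "has_bochner_integral lborel (\<lambda>x. indicator {0..1} x *\<^sub>R cis (2 * pi * (of_int n * x)))
     (if n = 0 then 1 else 0)"
proof (cases "n = 0")
  case True
  have "has_bochner_integral lborel (\<lambda>x::real. indicator {0..1} x *\<^sub>R (1::complex)) (complex_of_real 1 - complex_of_real 0)"
  proof (rule has_bochner_integral_FTC_Icc[of 0 1 complex_of_real "\<lambda>_. 1"])
    show "(complex_of_real has_vector_derivative 1) (at x within {0..1})" for x
      using has_vector_derivative_of_real[of "\<lambda>x. x" 1 "at x within {0..1}"]
      by (simp add: has_real_derivative_iff_has_vector_derivative[symmetric])
  qed auto
  then show ?thesis using True by simp
next
  case False
  define w where "w = \<i> * complex_of_real (2 * pi * of_int n)"
  have w: "w \<noteq> 0" using False by (simp add: w_def)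
  have e: "cis (2 * pi * (of_int n * x)) = exp (x *\<^sub>R w)" for x
    by (simp add: cis_conv_exp w_def scaleR_conv_of_real mult_ac)
  have "has_bochner_integral lborel (\<lambda>x. indicator {0..1} x *\<^sub>R exp (x *\<^sub>R w)) (exp (1 *\<^sub>R w) / w - exp (0 *\<^sub>R w) / w)"
  proof (rule has_bochner_integral_FTC_Icc)
    fix x :: real
    have "((\<lambda>x. exp (x *\<^sub>R w)) has_vector_derivative exp (x *\<^sub>R w) * w) (at x within {0..1})"
      by (rule exp_scaleR_has_vector_derivative_right)
    then have "((\<lambda>x. exp (x *\<^sub>R w) / w) has_vector_derivative exp (x *\<^sub>R w) * w / w) (at x within {0..1})"
      by (intro has_vector_derivative_divide)
    then show "((\<lambda>x. exp (x *\<^sub>R w) / w) has_vector_derivative exp (x *\<^sub>R w)) (at x within {0..1})"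
      using w by simp
  qed (auto intro!: continuous_intros)
  moreover have "exp (1 *\<^sub>R w) = 1"
    unfolding exp_eq_1 by (auto simp: w_def)
  ultimately show ?thesis using False by (simp add: e)
qed

lemma integral_ek: "(\<integral>x. ek k x \<partial>tor) = (if k = 0 then 1 else 0)"
proof -
  let ?h = "\<lambda>n x. indicator {0..1} x *\<^sub>R cis (2 * pi * (of_int n * x))"
  have h: "integrable lborel (?h n)" "(\<integral>x. ?h n x \<partial>lborel) = (if n = 0 then 1 else 0)" for n
    using integral_cis_unit_interval[of n] by (auto simp: has_bochner_integral_iff)
  obtain a b where k: "k = (a, b)" by (cases k)
  have eq: "indicator torus_sq x *\<^sub>R ek k x = ?h a (fst x) * ?h b (snd x)" for x
    by (auto simp: ek_def k torus_sq_def indicator_def cis_mult algebra_simps mem_Times_iff)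
  have int: "integrable (lborel \<Otimes>\<^sub>M lborel) (\<lambda>(x, y). ?h a x * ?h b y)"
  proof (rule lborel_pair.Fubini_integrable)
    have [measurable]: "?h n \<in> borel_measurable lborel" for n using h(1)[of n] by (rule borel_measurable_integrable)
    show "(\<lambda>(x, y). ?h a x * ?h b y) \<in> borel_measurable (lborel \<Otimes>\<^sub>M lborel)" by measurable
    show "integrable lborel (\<lambda>x. \<integral>y. norm (case (x, y) of (x, y) \<Rightarrow> ?h a x * ?h b y) \<partial>lborel)"
      using integrable_norm[OF h(1)[of a]] by (simp add: norm_mult del: norm_scaleR mult_scaleR_left mult_scaleR_right)
    show "AE x in lborel. integrable lborel (\<lambda>y. case (x, y) of (x, y) \<Rightarrow> ?h a x * ?h b y)"
      using h(1)[of b] by (simp del: mult_scaleR_left mult_scaleR_right)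
  qed
  have "(\<integral>x. ek k x \<partial>tor) = (\<integral>x. ?h a (fst x) * ?h b (snd x) \<partial>lborel)"
    by (subst integral_tor_eq_lborel) (auto simp: eq)
  also have "\<dots> = (\<integral>z. (case z of (x, y) \<Rightarrow> ?h a x * ?h b y) \<partial>(lborel \<Otimes>\<^sub>M lborel))"
    by (simp add: lborel_prod case_prod_beta)
  also have "\<dots> = (\<integral>x. (\<integral>y. ?h a x * ?h b y \<partial>lborel) \<partial>lborel)"
    by (rule lborel_pair.integral_fst[symmetric, OF int])
  also have "\<dots> = (\<integral>x. ?h a x * (\<integral>y. ?h b y \<partial>lborel) \<partial>lborel)"
    by (intro Bochner_Integration.integral_cong refl integral_mult_right_zero)
  also have "\<dots> = (\<integral>x. ?h a x \<partial>lborel) * (\<integral>y. ?h b y \<partial>lborel)"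
    by (rule integral_mult_left_zero)
  also have "\<dots> = (if k = 0 then 1 else 0)"
    unfolding h by (auto simp: k zero_prod_def)
  finally show ?thesis .
qed

definition tp :: "(int \<times> int) set \<Rightarrow> (int \<times> int \<Rightarrow> complex) \<Rightarrow> real \<times> real \<Rightarrow> complex" where
  "tp K c x = (\<Sum>k\<in>K. c k * ek k x)"

lemma tp_borel [measurable]: "tp K c \<in> borel_measurable borel"
  unfolding tp_def by measurable

lemma tp_tor [measurable]: "tp K c \<in> borel_measurable tor"
  by (rule borel_measurable_tor) simp

lemma norm_tp_le: "cmod (tp K c x) \<le> (\<Sum>k\<in>K. cmod (c k))"
  unfolding tp_def by (rule sum_norm_le) (simp add: norm_mult)

lemma integral_norm_tp_sq:
  assumes K: "finite K"
  shows "(\<integral>x. (cmod (tp K c x))\<^sup>2 \<partial>tor) = (\<Sum>k\<in>K. (cmod (c k))\<^sup>2)"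
proof -
  have "complex_of_real (\<integral>x. (cmod (tp K c x))\<^sup>2 \<partial>tor) = (\<integral>x. complex_of_real ((cmod (tp K c x))\<^sup>2) \<partial>tor)"
    by (rule integral_complex_of_real [symmetric])
  also have "\<dots> = (\<integral>x. (\<Sum>k\<in>K. \<Sum>j\<in>K. c k * cnj (c j) * ek (k - j) x) \<partial>tor)"
  proof (rule Bochner_Integration.integral_cong)
    fix x
    have "complex_of_real ((cmod (tp K c x))\<^sup>2) = tp K c x * cnj (tp K c x)"
      by (simp only: complex_norm_square)
    also have "\<dots> = (\<Sum>k\<in>K. \<Sum>j\<in>K. (c k * ek k x) * (cnj (c j) * ek (- j) x))"
      by (simp add: tp_def sum_product cnj_ek)
    also have "\<dots> = (\<Sum>k\<in>K. \<Sum>j\<in>K. c k * cnj (c j) * ek (k - j) x)"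
      by (intro sum.cong refl) (use ek_add in \<open>simp add: diff_conv_add_uminus del: add_uminus_conv_diff\<close>)
    finally show "complex_of_real ((cmod (tp K c x))\<^sup>2) = (\<Sum>k\<in>K. \<Sum>j\<in>K. c k * cnj (c j) * ek (k - j) x)" .
  qed simp
  also have "\<dots> = (\<Sum>k\<in>K. \<Sum>j\<in>K. c k * cnj (c j) * (\<integral>x. ek (k - j) x \<partial>tor))"
    by (subst Bochner_Integration.integral_sum, simp, intro sum.cong refl)
       (subst Bochner_Integration.integral_sum, auto)
  also have "\<dots> = (\<Sum>k\<in>K. \<Sum>j\<in>K. if j = k then c k * cnj (c j) else 0)"
    by (intro sum.cong refl) (auto simp: integral_ek)
  also have "\<dots> = (\<Sum>k\<in>K. c k * cnj (c k))"
    using K by (intro sum.cong refl) simp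
  also have "\<dots> = complex_of_real (\<Sum>k\<in>K. (cmod (c k))\<^sup>2)"
    by (simp only: of_real_sum complex_norm_square)
  finally show ?thesis by (simp only: of_real_eq_iff)
qed

lemma L2_Re_tp: "L2 (\<lambda>x. Re (tp K c x))"
proof (rule L2_bounded)
  show "\<bar>Re (tp K c x)\<bar> \<le> (\<Sum>k\<in>K. cmod (c k))" for x
    using abs_Re_le_cmod[of "tp K c x"] norm_tp_le[of K c x] by linarith
qed auto

lemma L2norm_Re_tp_le:
  assumes "finite K" shows "L2norm (\<lambda>x. Re (tp K c x)) \<le> l2n c K"
proof -
  have "(\<integral>x. (Re (tp K c x))\<^sup>2 \<partial>tor) \<le> (\<integral>x. (cmod (tp K c x))\<^sup>2 \<partial>tor)"
  proof (rule integral_mono)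
    show "integrable tor (\<lambda>x. (Re (tp K c x))\<^sup>2)" using L2_Re_tp by (simp add: L2_def)
    show "integrable tor (\<lambda>x. (cmod (tp K c x))\<^sup>2)"
      by (rule tor.integrable_const_bound[of _ "(\<Sum>k\<in>K. cmod (c k))\<^sup>2"]) (auto intro!: power_mono norm_tp_le)
    show "(Re (tp K c x))\<^sup>2 \<le> (cmod (tp K c x))\<^sup>2" for x
      by (simp add: cmod_power2)
  qed
  then show ?thesis
    unfolding L2norm_def L2_set_def integral_norm_tp_sq[OF assms] by (rule real_sqrt_le_mono)
qed

lemma tp_diff: "tp K c x - tp K d x = tp K (\<lambda>k. c k - d k) x"
  by (simp add: tp_def sum_subtractf algebra_simps)

lemma tp_Diff: "finite K \<Longrightarrow> J \<subseteq> K \<Longrightarrow> tp K c x - tp J c x = tp (K - J) c x"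
  by (simp add: tp_def sum_diff)

lemma fc_norm_le: "cmod (fc f k) \<le> (\<integral>x. \<bar>f x\<bar> \<partial>tor)"
  unfolding fc_eq by (rule order_trans[OF integral_norm_bound]) (simp add: norm_mult)

lemma fc_norm_le_L2: "L2 f \<Longrightarrow> cmod (fc f k) \<le> L2norm f"
  using fc_norm_le[of f k] integral_abs_le_L2norm[of f] by simp

lemma fc_diff: "L1 f \<Longrightarrow> L1 g \<Longrightarrow> fc (\<lambda>x. f x - g x) k = fc f k - fc g k"
  unfolding fc_eq L1_def
  by (subst Bochner_Integration.integral_diff [symmetric])
     (auto simp: algebra_simps intro!: integrable_mult_ek)

lemma fc_uminus: "fc f (- k) = cnj (fc f k)"
proof -
  have "cnj (fc f k) = (\<integral>x. cnj (complex_of_real (f x) * ek (- k) x) \<partial>tor)"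
    unfolding fc_eq by (rule Bochner_Integration.integral_cnj [symmetric])
  then show ?thesis by (simp add: fc_eq cnj_ek)
qed

text \<open>Taking the real part projects the coefficients onto the Hermitian ones,
  \<open>c (- k) = cnj (c k)\<close>. The formula needs both \<open>k\<close> and \<open>- k\<close>
  among the modes.\<close>

lemma fc_Re_tp:
  assumes K: "finite K" "k \<in> K" "- k \<in> K"
  shows "fc (\<lambda>x. Re (tp K c x)) k = (c k + cnj (c (- k))) / 2"
proof -
  have "complex_of_real (Re (tp K c x)) * ek (- k) x
      = (\<Sum>j\<in>K. (c j * ek (j - k) x + cnj (c j) * ek (- j - k) x) / 2)" for x
  proof -
    have "complex_of_real (Re (tp K c x)) = (tp K c x + cnj (tp K c x)) / 2"
      by (simp add: complex_add_cnj)
    also have "\<dots> = (\<Sum>j\<in>K. (c j * ek j x + cnj (c j) * ek (- j) x) / 2)"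
      by (simp add: tp_def cnj_ek sum.distrib sum_divide_distrib add_divide_distrib)
    finally show ?thesis
      using ek_add[of _ "- k" x] by (simp add: sum_distrib_right ring_distribs mult.assoc add_divide_distrib)
  qed
  then have fc_sum: "fc (\<lambda>x. Re (tp K c x)) k
      = (\<Sum>j\<in>K. (c j * (\<integral>x. ek (j - k) x \<partial>tor) + cnj (c j) * (\<integral>x. ek (- j - k) x \<partial>tor)) / 2)"
    unfolding fc_eq by (simp del: diff_conv_add_uminus)
  have neg: "- j - k = 0 \<longleftrightarrow> j = - k" for j :: "int \<times> int"
    by (auto simp: prod_eq_iff)
  have "(\<Sum>j\<in>K. (c j * (\<integral>x. ek (j - k) x \<partial>tor) + cnj (c j) * (\<integral>x. ek (- j - k) x \<partial>tor)) / 2)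
      = (\<Sum>j\<in>K. (if j = k then c k / 2 else 0) + (if j = - k then cnj (c (- k)) / 2 else 0))"
    by (intro sum.cong refl) (auto simp: integral_ek add_divide_distrib neg)
  also have "\<dots> = (c k + cnj (c (- k))) / 2"
    using K by (simp add: sum.distrib add_divide_distrib)
  finally show ?thesis by (simp add: fc_sum)
qed

subsection \<open>The Riesz-Fischer theorem with a measurable choice of representative\<close>

definition kbox :: "nat \<Rightarrow> (int \<times> int) set" where
  "kbox n = {- int n..int n} \<times> {- int n..int n}"

lemma finite_kbox [simp]: "finite (kbox n)"
  by (simp add: kbox_def)

lemma kbox_mono: "m \<le> n \<Longrightarrow> kbox m \<subseteq> kbox n"
  by (auto simp: kbox_def)

lemma uminus_in_kbox: "k \<in> kbox n \<Longrightarrow> - k \<in> kbox n"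
  by (auto simp: kbox_def mem_Times_iff)

lemma finite_subset_kbox:
  assumes "finite K" obtains n where "K \<subseteq> kbox n"
proof -
  define n where "n = nat (Max (insert 0 ((\<lambda>k. max \<bar>fst k\<bar> \<bar>snd k\<bar>) ` K)))"
  have "k \<in> kbox n" if "k \<in> K" for k
  proof -
    have "max \<bar>fst k\<bar> \<bar>snd k\<bar> \<le> int n"
      using that assms Max_ge[of "insert 0 ((\<lambda>k. max \<bar>fst k\<bar> \<bar>snd k\<bar>) ` K)" "max \<bar>fst k\<bar> \<bar>snd k\<bar>"]
      by (auto simp: n_def)
    then show ?thesis by (cases k) (auto simp: kbox_def)
  qed
  then show ?thesis by (intro that[of n]) auto
qed

text \<open>Bounding every finite partial norm expresses square summability with norm at most
  \<open>B\<close>, and this form is closed under pointwise limits of the coefficients.\<close>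

definition l2_le :: "('i \<Rightarrow> complex) \<Rightarrow> real \<Rightarrow> bool" where
  "l2_le c B \<longleftrightarrow> (\<forall>K. finite K \<longrightarrow> l2n c K \<le> B)"

lemma l2_leI: "(\<And>K. finite K \<Longrightarrow> l2n c K \<le> B) \<Longrightarrow> l2_le c B"
  by (simp add: l2_le_def)

lemma l2_leD: "l2_le c B \<Longrightarrow> finite K \<Longrightarrow> l2n c K \<le> B"
  by (simp add: l2_le_def)

lemma l2_le_nonneg: "l2_le c B \<Longrightarrow> 0 \<le> B"
  using l2_leD[of c B "{}"] by simp

lemma l2_le_norm: "l2_le c B \<Longrightarrow> cmod (c k) \<le> B"
  using l2_leD[of c B "{k}"] by simp

lemma l2_le_weaken: "l2_le c B \<Longrightarrow> B \<le> C \<Longrightarrow> l2_le c C"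
  unfolding l2_le_def by (blast intro: order_trans)

lemma l2_le_mono:
  assumes "l2_le d B" "\<And>k. cmod (c k) \<le> cmod (d k)" shows "l2_le c B"
  by (rule l2_leI, rule order_trans[OF L2_set_mono l2_leD[OF assms(1)]]) (use assms(2) in auto)

lemma l2_le_scale:
  assumes "l2_le c B" "\<And>k. cmod (d k) \<le> a * cmod (c k)" "0 \<le> a" shows "l2_le d (a * B)"
proof (rule l2_leI)
  fix K :: "'a set" assume K: "finite K"
  have "l2n d K \<le> L2_set (\<lambda>k. a * cmod (c k)) K"
    by (rule L2_set_mono) (use assms in auto)
  also have "\<dots> = a * l2n c K" using assms by (simp add: L2_set_right_distrib)
  also have "\<dots> \<le> a * B" by (intro mult_left_mono l2_leD assms K)
  finally show "l2n d K \<le> a * B" .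
qed

lemma l2_le_add:
  assumes "l2_le c B" "l2_le d D" shows "l2_le (\<lambda>k. c k + d k) (B + D)"
proof (rule l2_leI)
  fix K :: "'a set" assume K: "finite K"
  have "L2_set (\<lambda>k. cmod (c k + d k)) K \<le> L2_set (\<lambda>k. cmod (c k) + cmod (d k)) K"
    by (rule L2_set_mono) (auto intro: norm_triangle_ineq)
  also have "\<dots> \<le> l2n c K + l2n d K" by (rule L2_set_triangle_ineq)
  also have "\<dots> \<le> B + D" by (intro add_mono l2_leD assms K)
  finally show "L2_set (\<lambda>k. cmod (c k + d k)) K \<le> B + D" .
qed

lemma l2_le_diff:
  assumes "l2_le c B" "l2_le d D" shows "l2_le (\<lambda>k. c k - d k) (B + D)"
  using l2_le_add[OF assms(1), of "\<lambda>k. - d k" D] assms(2) by (simp add: l2_le_def)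

lemma l2_le_LIMSEQ:
  assumes "\<And>n. l2_le (c n) (B n)" "\<And>k. (\<lambda>n. c n k) \<longlonglongrightarrow> d k" "B \<longlonglongrightarrow> D"
  shows "l2_le d D"
proof (rule l2_leI)
  fix K :: "'a set" assume "finite K"
  have "(\<lambda>n. l2n (c n) K) \<longlonglongrightarrow> l2n d K"
    unfolding L2_set_def by (intro tendsto_intros assms)
  then show "l2n d K \<le> D"
    using assms(1,3) \<open>finite K\<close> by (intro LIMSEQ_le) (auto intro!: l2_leD)
qed

text \<open>The partial sums are taken along levels at which the tail is at most \<open>(1/4) ^ j\<close>;
  the levels depend measurably on the coefficients.\<close>

definition lvl :: "(int \<times> int \<Rightarrow> complex) \<Rightarrow> nat \<Rightarrow> nat" where
  "lvl c j = (LEAST n. \<forall>m\<ge>n. (\<Sum>k\<in>kbox m - kbox n. (cmod (c k))\<^sup>2) \<le> (1 / 4) ^ j)"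

definition RF :: "(int \<times> int \<Rightarrow> complex) \<Rightarrow> real \<times> real \<Rightarrow> real" where
  "RF c x = lim (\<lambda>j. Re (tp (kbox (lvl c j)) c x))"

lemma RF_borel [measurable]: "RF c \<in> borel_measurable borel"
  unfolding RF_def by (rule borel_measurable_lim_metric) simp

lemma RF_tor [measurable]: "RF c \<in> borel_measurable tor"
  by (rule borel_measurable_tor) simp

text \<open>For fixed \<open>j\<close> the level is a measurable function of the parameter with
  countably many values, so the truncation at a varying level is pieced together from truncations at
  fixed levels. A subsequence chosen without such control would spoil measurability in the
  parameter.\<close>

lemma RF_jointly_measurable:
  assumes [measurable]: "\<And>k. (\<lambda>p. c p k) \<in> borel_measurable P"
  shows "(\<lambda>z. RF (c (fst z)) (snd z)) \<in> borel_measurable (P \<Otimes>\<^sub>M borel)"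
  unfolding RF_def
proof (rule borel_measurable_lim_metric)
  fix j
  have lv: "(\<lambda>p. lvl (c p) j) \<in> measurable P (count_space UNIV)"
    unfolding lvl_def by measurable
  have lv2: "(\<lambda>z. lvl (c (fst z)) j) \<in> measurable (P \<Otimes>\<^sub>M borel) (count_space UNIV)"
    by (rule measurable_compose[OF measurable_fst lv])
  have "(\<lambda>z. Re (tp (kbox n) (c (fst z)) (snd z))) \<in> borel_measurable (P \<Otimes>\<^sub>M borel)" for n
  proof -
    have [measurable]: "(\<lambda>z. c (fst z) k) \<in> borel_measurable (P \<Otimes>\<^sub>M borel)" for k
      by (rule measurable_compose[OF measurable_fst assms])
    show ?thesis unfolding tp_def by measurable
  qed
  from measurable_compose_countable[OF this lv2]
  show "(\<lambda>z. Re (tp (kbox (lvl (c (fst z)) j)) (c (fst z)) (snd z))) \<in> borel_measurable (P \<Otimes>\<^sub>M borel)" .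
qed

lemma sum_kbox_tail_small:
  assumes c: "l2_le c B" and e: "0 < e"
  shows "\<exists>n. \<forall>m\<ge>n. (\<Sum>k\<in>kbox m - kbox n. (cmod (c k))\<^sup>2) \<le> e"
proof -
  define S where "S n = (\<Sum>k\<in>kbox n. (cmod (c k))\<^sup>2)" for n
  have "incseq S" unfolding S_def incseq_def by (auto intro!: sum_mono2 dest: kbox_mono)
  moreover have "S n \<le> B\<^sup>2" for n
  proof -
    have "(l2n c (kbox n))\<^sup>2 \<le> B\<^sup>2"
      by (intro power_mono l2_leD[OF c]) auto
    then show ?thesis by (simp add: S_def L2_set_def sum_nonneg)
  qed
  ultimately have "Cauchy S" by (metis incseq_convergent LIMSEQ_imp_Cauchy)
  then obtain N where N: "\<And>m n. m \<ge> N \<Longrightarrow> n \<ge> N \<Longrightarrow> norm (S m - S n) < e"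
    using e by (meson CauchyD)
  have "(\<Sum>k\<in>kbox m - kbox N. (cmod (c k))\<^sup>2) \<le> e" if "m \<ge> N" for m
    using N[of m N] that kbox_mono[OF that] by (simp add: S_def sum_diff)
  then show ?thesis by blast
qed

lemma lvl_tail:
  assumes c: "l2_le c B" and m: "lvl c j \<le> m"
  shows "(\<Sum>k\<in>kbox m - kbox (lvl c j). (cmod (c k))\<^sup>2) \<le> (1 / 4) ^ j"
proof -
  have "\<exists>n. \<forall>m\<ge>n. (\<Sum>k\<in>kbox m - kbox n. (cmod (c k))\<^sup>2) \<le> (1 / 4) ^ j"
    by (rule sum_kbox_tail_small[OF c]) simp
  from LeastI_ex[OF this] m show ?thesis unfolding lvl_def by blast
qed

lemma lvl_mono:
  assumes c: "l2_le c B" and ij: "j \<le> i"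
  shows "lvl c j \<le> lvl c i"
  unfolding lvl_def[of c j]
proof (rule Least_le, intro allI impI)
  fix m assume "lvl c i \<le> m"
  from lvl_tail[OF c this]
  have "(\<Sum>k\<in>kbox m - kbox (lvl c i). (cmod (c k))\<^sup>2) \<le> (1 / 4) ^ i" .
  also have "\<dots> \<le> (1 / 4) ^ j" by (rule power_decreasing[OF ij]) auto
  finally show "(\<Sum>k\<in>kbox m - kbox (lvl c i). (cmod (c k))\<^sup>2) \<le> (1 / 4) ^ j" .
qed

lemma L2norm_tp_lvl_le:
  assumes c: "l2_le c B" and n: "lvl c j \<le> n"
  shows "L2norm (\<lambda>x. Re (tp (kbox n) c x) - Re (tp (kbox (lvl c j)) c x)) \<le> (1 / 2) ^ j"
proof -
  have "L2norm (\<lambda>x. Re (tp (kbox n) c x) - Re (tp (kbox (lvl c j)) c x)) = L2norm (\<lambda>x. Re (tp (kbox n - kbox (lvl c j)) c x))"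
    using tp_Diff[OF finite_kbox kbox_mono[OF n], of c] by (simp flip: minus_complex.simps)
  also have "\<dots> \<le> l2n c (kbox n - kbox (lvl c j))"
    by (rule L2norm_Re_tp_le) simp
  also have "\<dots> \<le> sqrt ((1 / 4) ^ j)"
    unfolding L2_set_def by (rule real_sqrt_le_mono) (rule lvl_tail[OF c n])
  also have "\<dots> = (1 / 2) ^ j"
    by (simp add: real_sqrt_power real_sqrt_divide)
  finally show ?thesis .
qed

text \<open>Consecutive truncations differ by at most \<open>(1/2) ^ j\<close> in \<open>L2\<close>,
  hence in \<open>L1\<close> on a space of mass 1, so they converge almost everywhere. Fatou applied
  to the shifted sequence carries the bound over to the limit.\<close>

lemma RF_lvl:
  assumes c: "l2_le c B"
  shows "L2 (\<lambda>x. RF c x - Re (tp (kbox (lvl c j)) c x))"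
    and "L2norm (\<lambda>x. RF c x - Re (tp (kbox (lvl c j)) c x)) \<le> (1 / 2) ^ j"
proof -
  define f where "f j x = Re (tp (kbox (lvl c j)) c x)" for j x
  have f: "L2 (f j)" for j unfolding f_def by (rule L2_Re_tp)
  have "AE x in tor. convergent (\<lambda>j. f j x)"
  proof (rule AE_convergent_of_geometric_L1)
    show "integrable tor (f j)" for j using L2_imp_L1[OF f] by (simp add: L1_def)
    show "(\<integral>x. \<bar>f (Suc j) x - f j x\<bar> \<partial>tor) \<le> (1 / 2) ^ j" for j
      using integral_abs_le_L2norm[OF L2_diff[OF f f], of "Suc j" j]
        L2norm_tp_lvl_le[OF c lvl_mono[OF c], of j "Suc j"] by (simp add: f_def)
  qed
  then have lim: "AE x in tor. (\<lambda>i. f i x) \<longlonglongrightarrow> RF c x"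
    by eventually_elim (simp add: RF_def f_def convergent_LIMSEQ_iff)
  have lim2: "AE x in tor. (\<lambda>i. f (i + j) x - f j x) \<longlonglongrightarrow> RF c x - f j x"
    using lim
  proof eventually_elim
    case (elim x)
    from tendsto_diff[OF LIMSEQ_ignore_initial_segment[OF this] tendsto_const] show ?case .
  qed
  have le: "L2norm (\<lambda>x. f (i + j) x - f j x) \<le> (1 / 2) ^ j" for i
    unfolding f_def by (intro L2norm_tp_lvl_le[OF c] lvl_mono[OF c]) simp
  have m: "(\<lambda>x. RF c x - f j x) \<in> borel_measurable tor" unfolding f_def by measurable
  show "L2 (\<lambda>x. RF c x - Re (tp (kbox (lvl c j)) c x))"
    using L2_Fatou(1)[OF L2_diff[OF f f] le m lim2] by (simp add: f_def)
  show "L2norm (\<lambda>x. RF c x - Re (tp (kbox (lvl c j)) c x)) \<le> (1 / 2) ^ j"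
    using L2_Fatou(2)[OF L2_diff[OF f f] le m lim2] by (simp add: f_def)
qed

lemma L2_RF:
  assumes "l2_le c B" shows "L2 (RF c)"
  using L2_add[OF RF_lvl(1)[OF assms, of 0] L2_Re_tp[of "kbox (lvl c 0)" c]] by simp

lemma RF_approx:
  assumes c: "l2_le c B"
  shows "(\<lambda>n. L2norm (\<lambda>x. RF c x - Re (tp (kbox n) c x))) \<longlonglongrightarrow> 0"
proof (rule LIMSEQ_I)
  fix e :: real assume e: "0 < e"
  obtain j where j: "(1 / 2) ^ j < e / 2"
    using e real_arch_pow_inv[of "e / 2" "1 / 2"] by auto
  show "\<exists>no. \<forall>n\<ge>no. norm (L2norm (\<lambda>x. RF c x - Re (tp (kbox n) c x)) - 0) < e"
  proof (intro exI allI impI)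
    fix n assume n: "lvl c j \<le> n"
    have "L2norm (\<lambda>x. RF c x - Re (tp (kbox n) c x))
        \<le> L2norm (\<lambda>x. RF c x - Re (tp (kbox (lvl c j)) c x)) + L2norm (\<lambda>x. Re (tp (kbox (lvl c j)) c x) - Re (tp (kbox n) c x))"
      by (intro L2norm_diff_triangle L2_RF[OF c] L2_Re_tp)
    also have "\<dots> \<le> (1 / 2) ^ j + (1 / 2) ^ j"
      using L2norm_tp_lvl_le[OF c n]
      by (intro add_mono RF_lvl(2)[OF c]) (subst L2norm_minus_commute)
    finally show "norm (L2norm (\<lambda>x. RF c x - Re (tp (kbox n) c x)) - 0) < e" using j by simp
  qed
qed

text \<open>The levels of \<open>c\<close>, \<open>d\<close> and \<open>c - d\<close> need not
  agree, so linearity of \<open>RF\<close> is not immediate. All functions are therefore compared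
  with partial sums over a common box.\<close>

lemma L2norm_RF_diff_le:
  assumes c: "l2_le c B" and d: "l2_le d C" and cd: "l2_le (\<lambda>k. c k - d k) D"
  shows "L2norm (\<lambda>x. RF c x - RF d x) \<le> D"
proof -
  let ?a = "\<lambda>n x. Re (tp (kbox n) c x)" and ?b = "\<lambda>n x. Re (tp (kbox n) d x)"
  have "L2norm (\<lambda>x. RF c x - RF d x) \<le> L2norm (\<lambda>x. RF c x - ?a n x) + (D + L2norm (\<lambda>x. RF d x - ?b n x))" for n
  proof -
    have "L2norm (\<lambda>x. RF c x - RF d x) \<le> L2norm (\<lambda>x. RF c x - ?a n x) + L2norm (\<lambda>x. ?a n x - RF d x)"
      by (intro L2norm_diff_triangle L2_RF[OF c] L2_RF[OF d] L2_Re_tp)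
    moreover have "L2norm (\<lambda>x. ?a n x - RF d x) \<le> L2norm (\<lambda>x. ?a n x - ?b n x) + L2norm (\<lambda>x. ?b n x - RF d x)"
      by (intro L2norm_diff_triangle L2_RF[OF d] L2_Re_tp)
    moreover have "L2norm (\<lambda>x. ?a n x - ?b n x) \<le> D"
    proof -
      have "L2norm (\<lambda>x. ?a n x - ?b n x) = L2norm (\<lambda>x. Re (tp (kbox n) (\<lambda>k. c k - d k) x))"
        by (simp flip: tp_diff)
      also have "\<dots> \<le> D" by (rule order_trans[OF L2norm_Re_tp_le l2_leD[OF cd]]) auto
      finally show ?thesis .
    qed
    ultimately show ?thesis using L2norm_minus_commute[of "?b n" "RF d"] by linarith
  qed
  moreover have "(\<lambda>n. L2norm (\<lambda>x. RF c x - ?a n x) + (D + L2norm (\<lambda>x. RF d x - ?b n x))) \<longlonglongrightarrow> 0 + (D + 0)"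
    by (intro tendsto_intros RF_approx[OF c] RF_approx[OF d])
  ultimately show ?thesis by (intro LIMSEQ_le_const) auto
qed

lemma RF_0: "RF (\<lambda>k. 0) = (\<lambda>x. 0)"
  by (simp add: RF_def tp_def fun_eq_iff)

lemma L2norm_RF_le: "l2_le c B \<Longrightarrow> L2norm (RF c) \<le> B"
  using L2norm_RF_diff_le[of c B "\<lambda>k. 0" 0 B] by (simp add: RF_0 l2_le_def L2_set_def[of "\<lambda>k. 0"])

lemma fc_RF:
  assumes c: "l2_le c B"
  shows "fc (RF c) k = (c k + cnj (c (- k))) / 2"
proof -
  obtain N where N: "{k} \<subseteq> kbox N" using finite_subset_kbox[of "{k}"] by blast
  have "cmod (fc (RF c) k - (c k + cnj (c (- k))) / 2) \<le> L2norm (\<lambda>x. RF c x - Re (tp (kbox n) c x))" if n: "n \<ge> N" for n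
  proof -
    have k: "k \<in> kbox n" using N kbox_mono[OF n] by auto
    have "fc (RF c) k - (c k + cnj (c (- k))) / 2 = fc (\<lambda>x. RF c x - Re (tp (kbox n) c x)) k"
      by (simp add: fc_diff L2_imp_L1 L2_RF[OF c] L2_Re_tp fc_Re_tp k uminus_in_kbox)
    then show ?thesis by (simp add: fc_norm_le_L2 L2_diff L2_RF[OF c] L2_Re_tp)
  qed
  then have "cmod (fc (RF c) k - (c k + cnj (c (- k))) / 2) \<le> 0"
    by (intro LIMSEQ_le_const[OF RF_approx[OF c]]) auto
  then show ?thesis by simp
qed

subsection \<open>Uniqueness of Fourier coefficients and Parseval's identity\<close>

text \<open>Complex values make the class closed under multiplication by each mode, hence by all
  trigonometric polynomials; this module structure is what Stone-Weierstrass exploits.\<close>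

definition annihilated :: "(real \<times> real \<Rightarrow> complex) \<Rightarrow> bool" where
  "annihilated g \<longleftrightarrow> integrable tor g \<and> (\<forall>k. (\<integral>x. g x * ek k x \<partial>tor) = 0)"

lemma annihilated_add: "annihilated g \<Longrightarrow> annihilated h \<Longrightarrow> annihilated (\<lambda>x. g x + h x)"
  by (auto simp: annihilated_def distrib_right integrable_mult_ek)

lemma annihilated_cmult: "annihilated g \<Longrightarrow> annihilated (\<lambda>x. g x * a)"
  by (auto simp: annihilated_def mult.commute[of _ a] mult.assoc)

lemma annihilated_mult_ek: "annihilated g \<Longrightarrow> annihilated (\<lambda>x. g x * ek j x)"
  by (simp add: annihilated_def integrable_mult_ek mult.assoc del: split_paired_All flip: ek_add)

definition torus_map :: "real \<times> real \<Rightarrow> complex \<times> complex" where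
  "torus_map x = (ek (1, 0) x, ek (0, 1) x)"

lemma continuous_on_torus_map: "continuous_on S torus_map"
  unfolding torus_map_def ek_def cis_conv_exp by (intro continuous_intros)

text \<open>On the embedded torus a real linear functional is a combination of the four modes
  \<open>(1, 0)\<close>, \<open>(-1, 0)\<close>, \<open>(0, 1)\<close>, \<open>(0, -1)\<close>.
  Products are handled by applying the induction hypotheses in succession, which is why
  \<open>g\<close> is generalized.\<close>

lemma annihilated_mult_polynomial:
  assumes "real_polynomial_function q"
  shows "annihilated g \<Longrightarrow> annihilated (\<lambda>x. g x * complex_of_real (q (torus_map x)))"
  using assms
proof (induction q arbitrary: g rule: real_polynomial_function.induct)
  case (linear q)
  interpret q: bounded_linear q by fact
  let ?e = "\<lambda>a b. \<lambda>x. g x * ek (a, b) x"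
  define A B C D where "A = q (1, 0)" and "B = q (\<i>, 0)" and "C = q (0, 1)" and "D = q (0, \<i>)"
  have ReIm: "complex_of_real (Re (ek k x)) = (ek k x + ek (- k) x) * (1 / 2)"
      "complex_of_real (Im (ek k x)) = (ek k x - ek (- k) x) * (1 / (2 * \<i>))" for k x
    using complex_add_cnj[of "ek k x"] complex_diff_cnj[of "ek k x"] by (auto simp: cnj_ek[symmetric])
  have qz: "q (z, w) = Re z * A + Im z * B + Re w * C + Im w * D" for z w
  proof -
    have "(z, w) = Re z *\<^sub>R (1, 0) + Im z *\<^sub>R (\<i>, 0) + Re w *\<^sub>R (0, 1) + Im w *\<^sub>R (0, \<i>)"
      by (simp add: complex_eq_iff)
    then have "q (z, w) = q (Re z *\<^sub>R (1, 0) + Im z *\<^sub>R (\<i>, 0) + Re w *\<^sub>R (0, 1) + Im w *\<^sub>R (0, \<i>))"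
      by simp
    also have "\<dots> = Re z * A + Im z * B + Re w * C + Im w * D"
      by (simp only: q.add q.scaleR A_def B_def C_def D_def real_scaleR_def)
    finally show ?thesis .
  qed
  have eq: "g x * complex_of_real (q (torus_map x)) =
      ?e 1 0 x * (A / 2 + B / (2 * \<i>)) + ?e (- 1) 0 x * (A / 2 - B / (2 * \<i>))
      + ?e 0 1 x * (C / 2 + D / (2 * \<i>)) + ?e 0 (- 1) x * (C / 2 - D / (2 * \<i>))" for x
    by (simp add: torus_map_def qz ReIm del: divide_i) (simp add: field_simps)
  show ?case
    unfolding eq by (intro annihilated_add annihilated_cmult annihilated_mult_ek linear)
next
  case (const c)
  then show ?case by (rule annihilated_cmult)
next
  case (add q r)
  then show ?case using annihilated_add[OF add.IH(1) add.IH(2), of g g] by (simp add: distrib_left)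
next
  case (mult q r)
  from mult.IH(2)[OF mult.IH(1)[OF mult.prems]] show ?case by (simp add: mult.assoc)
qed

text \<open>Polynomials approximate \<open>\<phi>\<close> uniformly on the compact product of
  circles, and the error of the integral is at most \<open>e\<close> times the \<open>L1\<close>
  norm of \<open>g\<close>.\<close>

lemma annihilated_continuous:
  fixes \<phi> :: "complex \<times> complex \<Rightarrow> real"
  assumes g: "annihilated g" and phi: "continuous_on UNIV \<phi>"
  shows "(\<integral>x. g x * complex_of_real (\<phi> (torus_map x)) \<partial>tor) = 0"
proof -
  let ?gp = "\<lambda>x. g x * complex_of_real (\<phi> (torus_map x))" and ?gq = "\<lambda>q x. g x * complex_of_real (q (torus_map x))"
  define S :: "(complex \<times> complex) set" where "S = sphere 0 1 \<times> sphere 0 1"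
  have S: "compact S" "torus_map x \<in> S" for x by (auto simp: S_def compact_Times torus_map_def)
  have gi: "integrable tor g" using g by (simp add: annihilated_def)
  have phi_m: "(\<lambda>x. \<phi> (torus_map x)) \<in> borel_measurable tor"
    by (intro borel_measurable_tor borel_measurable_continuous_onI continuous_on_compose2[OF phi] continuous_on_torus_map) auto
  have cont: "continuous_on S \<phi>" using phi continuous_on_subset by blast
  have "compact (\<phi> ` S)" by (intro compact_continuous_image cont S)
  then obtain M where M: "\<And>z. z \<in> S \<Longrightarrow> \<bar>\<phi> z\<bar> \<le> M" by (force dest: compact_imp_bounded simp: bounded_iff)
  have gphi: "integrable tor ?gp"
  proof (rule Bochner_Integration.integrable_bound)
    show "integrable tor (\<lambda>x. M * cmod (g x))" using gi by auto
    have "cmod (g x) * \<bar>\<phi> (torus_map x)\<bar> \<le> \<bar>M * cmod (g x)\<bar>" for x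
      using M[OF S(2)[of x]] mult_left_mono[of "\<bar>\<phi> (torus_map x)\<bar>" M "cmod (g x)"] by (simp add: abs_mult mult.commute)
    then show "AE x in tor. norm (?gp x) \<le> norm (M * cmod (g x))"
      by (auto simp: norm_mult)
  qed (use gi phi_m in auto)
  have le: "cmod (\<integral>x. ?gp x \<partial>tor) \<le> e * (\<integral>x. cmod (g x) \<partial>tor)" if e: "0 < e" for e
  proof -
    obtain q where q: "real_polynomial_function q" "\<And>z. z \<in> S \<Longrightarrow> \<bar>\<phi> z - q z\<bar> < e"
      using Stone_Weierstrass_real_polynomial_function[OF S(1) cont e] by blast
    have gq: "annihilated (?gq q)"
      by (rule annihilated_mult_polynomial[OF q(1) g])
    then have gq0: "(\<integral>x. ?gq q x \<partial>tor) = 0"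
      and gqi: "integrable tor (?gq q)"
      unfolding annihilated_def using ek_0 by (metis (no_types, lifting) Bochner_Integration.integral_cong mult.right_neutral, blast)
    have "(\<integral>x. ?gp x \<partial>tor)
        = (\<integral>x. ?gp x - ?gq q x \<partial>tor)"
      using gphi gqi gq0 by simp
    also have "cmod \<dots> \<le> (\<integral>x. cmod (?gp x - ?gq q x) \<partial>tor)"
      by (rule integral_norm_bound)
    also have "\<dots> \<le> (\<integral>x. e * cmod (g x) \<partial>tor)"
    proof (rule integral_mono)
      fix x
      have "cmod (?gp x - ?gq q x)
          = cmod (g x) * \<bar>\<phi> (torus_map x) - q (torus_map x)\<bar>"
        by (simp only: right_diff_distrib[symmetric] norm_mult norm_of_real of_real_diff[symmetric])
      also have "\<dots> \<le> cmod (g x) * e"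
        using q(2)[OF S(2), of x] by (intro mult_left_mono) auto
      finally show "cmod (?gp x - ?gq q x) \<le> e * cmod (g x)"
        by (simp add: mult.commute)
    qed (use gphi gqi gi in auto)
    finally show ?thesis by simp
  qed
  define I where "I = (\<integral>x. cmod (g x) \<partial>tor)"
  have I: "0 \<le> I" by (simp add: I_def)
  have "cmod (\<integral>x. ?gp x \<partial>tor) \<le> 0 + e" if "0 < e" for e
  proof -
    have "cmod (\<integral>x. ?gp x \<partial>tor) \<le> (e / (I + 1)) * I"
      using le[of "e / (I + 1)"] that I unfolding I_def[symmetric] by simp
    also have "\<dots> \<le> e" using that I by (simp add: field_simps)
    finally show ?thesis by simp
  qed
  then have "cmod (\<integral>x. ?gp x \<partial>tor) \<le> 0" by (rule field_le_epsilon)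
  then show ?thesis by simp
qed

lemma cis_2pi_eq_imp_eq:
  assumes "cis (2 * pi * a) = cis (2 * pi * b)" "0 < a" "a < 1" "0 \<le> b" "b \<le> 1"
  shows "a = b"
proof -
  have "sin (2 * pi * a) = sin (2 * pi * b) \<and> cos (2 * pi * a) = cos (2 * pi * b)"
    using assms(1) by (auto simp: complex_eq_iff)
  then obtain n where "2 * pi * a = 2 * pi * b + 2 * pi * of_int n"
    using sin_cos_eq_iff by blast
  then have "2 * pi * (a - b - of_int n) = 0" by (simp add: algebra_simps)
  then have *: "a - b = of_int n" by simp
  then have "- 1 < n" "n < 1" using assms(2-) by linarith+
  then show ?thesis using * by simp
qed

text \<open>The cut-offs \<open>\<phi> n\<close> converge to the indicator of \<open>U\<close> along
  the embedding. Keeping \<open>U\<close> inside the open square ensures that no point of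
  \<open>U\<close> has the same image as a point of the square outside \<open>U\<close>, since only
  boundary points are glued.\<close>

lemma annihilated_open:
  assumes g: "annihilated g" and U: "open U" "U \<subseteq> {0<..<1} \<times> {0<..<1}"
  shows "(\<integral>x. g x * complex_of_real (indicator U x) \<partial>tor) = 0"
proof -
  define C where "C = torus_map ` (torus_sq - U)"
  have "compact (torus_sq - U)"
    unfolding torus_sq_cbox by (intro compact_diff U) auto
  then have C: "closed C" unfolding C_def
    by (intro compact_imp_closed compact_continuous_image continuous_on_torus_map)
  \<comment> \<open>\<open>infdist\<close> to the empty set is 0 by convention, so \<open>C\<close>
    must have a point; a corner of the square always provides one.\<close>
  have "(0, 0) \<in> torus_sq - U" using U(2) by (auto simp: torus_sq_def)
  then have C0: "C \<noteq> {}" by (auto simp: C_def)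
  define \<phi> where "\<phi> n z = min 1 (real n * infdist z C)" for n z
  have phi: "continuous_on UNIV (\<phi> n)" for n unfolding \<phi>_def by (intro continuous_intros)
  have gi: "integrable tor g" using g by (simp add: annihilated_def)
  have "(\<lambda>n. \<integral>x. g x * complex_of_real (\<phi> n (torus_map x)) \<partial>tor) \<longlonglongrightarrow> (\<integral>x. g x * complex_of_real (indicator U x) \<partial>tor)"
  proof (rule integral_dominated_convergence)
    show "(\<lambda>x. g x * complex_of_real (indicator U x)) \<in> borel_measurable tor"
    proof -
      have [measurable]: "indicator U \<in> borel_measurable tor" for U' :: "(real \<times> real) set"
        using U by (intro borel_measurable_tor) auto
      show ?thesis using gi by auto
    qed
    show "(\<lambda>x. g x * complex_of_real (\<phi> n (torus_map x))) \<in> borel_measurable tor" for n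
    proof -
      have "(\<lambda>x. \<phi> n (torus_map x)) \<in> borel_measurable tor"
        by (intro borel_measurable_tor borel_measurable_continuous_onI continuous_on_compose2[OF phi] continuous_on_torus_map) auto
      then show ?thesis using gi by auto
    qed
    show "integrable tor (\<lambda>x. cmod (g x))" using gi by auto
    have "\<bar>\<phi> n z\<bar> \<le> 1" for n z by (auto simp: \<phi>_def min_def infdist_nonneg)
    then show "AE x in tor. norm (g x * complex_of_real (\<phi> n (torus_map x))) \<le> cmod (g x)" for n
      by (intro AE_I2) (simp add: norm_mult mult_left_le)
    show "AE x in tor. (\<lambda>n. g x * complex_of_real (\<phi> n (torus_map x))) \<longlonglongrightarrow> g x * complex_of_real (indicator U x)"
    proof (rule AE_I2)
      fix x assume "x \<in> space tor"
      then have x: "x \<in> torus_sq" by simp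
      have "(\<lambda>n. \<phi> n (torus_map x)) \<longlonglongrightarrow> indicator U x"
      proof (cases "x \<in> U")
        case True
        have "torus_map x \<notin> C"
        proof
          assume "torus_map x \<in> C"
          then obtain y where y: "y \<in> torus_sq" "y \<notin> U" "torus_map x = torus_map y" by (auto simp: C_def)
          have "fst x = fst y" "snd x = snd y"
            using y True U(2) by (auto simp: torus_map_def ek_def torus_sq_def mem_Times_iff intro!: cis_2pi_eq_imp_eq)
          then show False using y(2) True by (metis prod_eqI)
        qed
        then have d: "0 < infdist (torus_map x) C"
          using in_closed_iff_infdist_zero[OF C C0] infdist_nonneg[of "torus_map x" C] by fastforce
        obtain N where N: "1 / infdist (torus_map x) C < real N" using reals_Archimedean2 by blast
        have "\<phi> n (torus_map x) = 1" if "n \<ge> N" for n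
        proof -
          have "1 / infdist (torus_map x) C \<le> real n" using N that by linarith
          then have "1 \<le> real n * infdist (torus_map x) C" using d by (simp add: field_simps)
          then show ?thesis by (simp add: \<phi>_def)
        qed
        then have "\<forall>\<^sub>F n in sequentially. \<phi> n (torus_map x) = 1" by (auto simp: eventually_sequentially)
        then show ?thesis using True by (simp add: tendsto_eventually)
      next
        case False
        then have "torus_map x \<in> C" using x by (auto simp: C_def)
        then show ?thesis using False by (simp add: \<phi>_def)
      qed
      then show "(\<lambda>n. g x * complex_of_real (\<phi> n (torus_map x))) \<longlonglongrightarrow> g x * complex_of_real (indicator U x)"
        by (intro tendsto_intros)
    qed
  qed
  then show ?thesis
    using annihilated_continuous[OF g phi] by (simp add: LIMSEQ_const_iff)
qed

text \<open>The integrals of a Borel representative vanish over open sets, hence over all Borel sets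
  by a Dynkin argument, and a density with vanishing integrals is zero almost everywhere.\<close>

lemma fc_eq_0_imp_AE_eq_0:
  assumes f: "L1 f" and fc0: "\<And>k. fc f k = 0"
  shows "AE x in tor. f x = 0"
proof -
  let ?f = "\<lambda>x. indicator torus_sq x *\<^sub>R f x"
  have ann: "annihilated (\<lambda>x. complex_of_real (f x))"
    unfolding annihilated_def
  proof
    show "integrable tor (\<lambda>x. complex_of_real (f x))" using f by (simp add: L1_def)
    show "\<forall>k. (\<integral>x. complex_of_real (f x) * ek k x \<partial>tor) = 0"
    proof
      fix k show "(\<integral>x. complex_of_real (f x) * ek k x \<partial>tor) = 0"
        using fc0[of "- k"] by (simp add: fc_eq)
    qed
  qed
  have fi: "integrable lebesgue ?f" using f by (simp add: L1_def integrable_restrict_space)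
  obtain h where h: "h \<in> borel_measurable lborel" "AE x in lborel. ?f x = h x"
    using completion_ex_borel_measurable_real[of ?f lborel] fi by (auto simp: borel_measurable_integrable)
  have h_leb: "AE x in lebesgue. ?f x = h x" using h(2) by (rule AE_completion)
  have h_m: "h \<in> borel_measurable lebesgue" using h(1) by (rule measurable_completion)
  have hi: "integrable lborel h"
  proof -
    have "integrable lebesgue h"
      using integrable_cong_AE[OF _ h_m h_leb] fi by blast
    then show ?thesis using h(1) by (simp add: integrable_completion)
  qed
  have op: "(\<integral>x. indicator A x *\<^sub>R h x \<partial>lborel) = 0" if A: "open A" for A
  proof -
    \<comment> \<open>Only the part of \<open>A\<close> in the open square matters: \<open>h\<close>
      vanishes almost everywhere outside the closed square, and the boundary has measure
      zero.\<close>
    define U where "U = A \<inter> {0<..<1} \<times> {0<..<1}"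
    have U: "open U" "U \<subseteq> {0<..<1} \<times> {0<..<1}" using A by (auto simp: U_def intro!: open_Int open_Times)
    have "AE x in lborel. x \<notin> cbox (0, 0) (1, 1) - box (0::real, 0::real) (1, 1)"
      by (rule AE_not_in) (simp add: null_sets_def emeasure_Diff box_subset_cbox emeasure_lborel_cbox_eq emeasure_lborel_box_eq)
    then have AE_U: "AE x in lebesgue. x \<notin> cbox (0, 0) (1, 1) - box (0::real, 0::real) (1, 1)"
      by (rule AE_completion)
    have "(\<integral>x. indicator A x *\<^sub>R h x \<partial>lborel) = (\<integral>x. indicator A x *\<^sub>R h x \<partial>lebesgue)"
      using h(1) A by (intro integral_completion[symmetric]) auto
    also have "\<dots> = (\<integral>x. indicator torus_sq x *\<^sub>R (f x * indicator U x) \<partial>lebesgue)"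
    proof (rule integral_cong_AE)
      show "(\<lambda>x. indicator A x *\<^sub>R h x) \<in> borel_measurable lebesgue"
        using h_m A by (intro borel_measurable_scaleR borel_measurable_indicator) auto
      have "(\<lambda>x. (indicator torus_sq x *\<^sub>R f x) * indicator U x) \<in> borel_measurable lebesgue"
        using fi U by (intro borel_measurable_times borel_measurable_indicator) (auto simp: borel_measurable_integrable)
      then show "(\<lambda>x. indicator torus_sq x *\<^sub>R (f x * indicator U x)) \<in> borel_measurable lebesgue"
        by (simp add: mult.assoc)
      show "AE x in lebesgue. indicator A x *\<^sub>R h x = indicator torus_sq x *\<^sub>R (f x * indicator U x)"
        using h_leb AE_U
      proof eventually_elim
        case (elim x)
        have "x \<in> torus_sq \<Longrightarrow> x \<in> {0<..<1} \<times> {0<..<1}"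
          using elim(2) by (cases x) (auto simp: torus_sq_def cbox_Pair_eq mem_box Basis_prod_def)
        then show ?case using elim(1) by (auto simp: U_def indicator_def)
      qed
    qed
    also have "\<dots> = (\<integral>x. f x * indicator U x \<partial>tor)"
      by (rule integral_restrict_space[symmetric]) auto
    also have "\<dots> = 0"
    proof -
      have "complex_of_real (\<integral>x. f x * indicator U x \<partial>tor) = (\<integral>x. complex_of_real (f x) * complex_of_real (indicator U x) \<partial>tor)"
        by (simp flip: integral_complex_of_real)
      also have "\<dots> = 0" by (rule annihilated_open[OF ann U])
      finally show ?thesis by simp
    qed
    finally show ?thesis .
  qed
  have int: "integrable lborel (\<lambda>x. indicator A x *\<^sub>R h x)" if "A \<in> sets borel" for A
    using hi that by (intro integrable_mult_indicator) auto
  have all: "(\<integral>x. indicator A x *\<^sub>R h x \<partial>lborel) = 0" if "A \<in> sigma_sets UNIV {S. open S}" for A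
  proof (rule sigma_sets_induct_disjoint[OF _ _ that])
    show "Int_stable {S :: (real \<times> real) set. open S}" by (auto simp: Int_stable_def)
    show "(\<integral>x. indicator A x *\<^sub>R h x \<partial>lborel) = 0" if "A \<in> {S. open S}" for A using op that by simp
    show "(\<integral>x. indicator {} x *\<^sub>R h x \<partial>lborel) = 0" by simp
    show "(\<integral>x. indicator (UNIV - A) x *\<^sub>R h x \<partial>lborel) = 0"
      if A: "A \<in> sigma_sets UNIV {S. open S}" "(\<integral>x. indicator A x *\<^sub>R h x \<partial>lborel) = 0" for A
    proof -
      have "(\<integral>x. indicator (UNIV - A) x *\<^sub>R h x \<partial>lborel)
          = (\<integral>x. indicator UNIV x *\<^sub>R h x - indicator A x *\<^sub>R h x \<partial>lborel)"
        by (rule Bochner_Integration.integral_cong) (auto simp: indicator_def)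
      also have "\<dots> = 0"
        using int[of A] int[of UNIV] A op[of UNIV] by (simp add: sets_borel[symmetric])
      finally show ?thesis .
    qed
    show "(\<integral>x. indicator (\<Union>i::nat. A i) x *\<^sub>R h x \<partial>lborel) = 0"
      if A: "disjoint_family A" "range A \<subseteq> sigma_sets UNIV {S. open S}" "\<And>i. (\<integral>x. indicator (A i) x *\<^sub>R h x \<partial>lborel) = 0" for A
    proof -
      have [measurable]: "A i \<in> sets borel" for i using A(2) by (auto simp: sets_borel)
      have "set_integrable lborel (\<Union>i. A i) h" unfolding set_integrable_def by (rule int) auto
      then have "set_lebesgue_integral lborel (\<Union>i. A i) h = (\<Sum>i. set_lebesgue_integral lborel (A i) h)"
        using A(1) by (intro lebesgue_integral_countable_add) (auto simp: disjoint_family_on_def)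
      then show ?thesis using A(3) by (simp add: set_lebesgue_integral_def)
    qed
  qed auto
  have "AE x in lborel. h x = 0"
  proof (rule density_unique_real[OF hi])
    show "(\<integral>x\<in>A. h x \<partial>lborel) = (\<integral>x\<in>A. 0 \<partial>lborel)" if "A \<in> sets lborel" for A
      using all[of A] that by (simp add: set_lebesgue_integral_def sets_borel)
  qed simp
  then have "AE x in lebesgue. h x = 0" by (rule AE_completion)
  with h_leb have "AE x in lebesgue. x \<in> torus_sq \<longrightarrow> f x = 0"
    by eventually_elim (auto simp: indicator_def split: if_splits)
  then show ?thesis by (subst AE_restrict_space_iff) auto
qed

lemma fc_eq_imp_AE_eq:
  assumes "L1 f" "L1 g" "\<And>k. fc f k = fc g k"
  shows "AE x in tor. f x = g x"
proof -
  have "AE x in tor. f x - g x = 0"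
    by (rule fc_eq_0_imp_AE_eq_0) (use assms in \<open>auto simp: fc_diff\<close>, simp add: L1_def)
  then show ?thesis by simp
qed

text \<open>The half of Parseval's identity that needs completeness: \<open>f\<close> agrees almost
  everywhere with the representative rebuilt from its coefficients. These are Hermitian because
  \<open>f\<close> is real, so \<open>RF\<close> reproduces them.\<close>

lemma L2norm_le_fc:
  assumes f: "L2 f" and B: "l2_le (fc f) B"
  shows "L2norm f \<le> B"
proof -
  have "AE x in tor. f x = RF (fc f) x"
    using f B by (intro fc_eq_imp_AE_eq L2_imp_L1 L2_RF) (auto simp: fc_RF fc_uminus)
  then have "L2norm f = L2norm (RF (fc f))" using f by (intro L2norm_cong_AE) (auto simp: L2_def)
  then show ?thesis using L2norm_RF_le[OF B] by simp
qed

text \<open>Pairing \<open>f\<close> with its own partial sum gives \<open>X^2\<close>, while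
  Cauchy-Schwarz and orthonormality bound the pairing by \<open>L2norm f * X\<close>.\<close>

lemma Bessel:
  assumes f: "L2 f" shows "l2_le (fc f) (L2norm f)"
proof (rule l2_leI)
  fix K :: "(int \<times> int) set" assume K: "finite K"
  define X where "X = l2n (fc f) K"
  have X0: "0 \<le> X" by (simp add: X_def)
  have fi: "integrable tor (\<lambda>x. complex_of_real (f x))" using L2_imp_L1[OF f] by (simp add: L1_def)
  have "complex_of_real (X\<^sup>2) = (\<Sum>k\<in>K. cnj (fc f k) * fc f k)"
    by (simp add: X_def L2_set_def sum_nonneg complex_norm_square mult.commute del: of_real_power flip: of_real_power)
  also have "\<dots> = (\<integral>x. (\<Sum>k\<in>K. cnj (fc f k) * (complex_of_real (f x) * ek (- k) x)) \<partial>tor)"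
    using integrable_mult_ek[OF fi] by (subst Bochner_Integration.integral_sum) (auto simp: fc_eq)
  also have "\<dots> = (\<integral>x. complex_of_real (f x) * cnj (tp K (fc f) x) \<partial>tor)"
    by (rule Bochner_Integration.integral_cong) (auto simp: tp_def cnj_ek sum_distrib_left mult_ac)
  finally have eq: "complex_of_real (X\<^sup>2) = (\<integral>x. complex_of_real (f x) * cnj (tp K (fc f) x) \<partial>tor)" .
  have int: "integrable tor (\<lambda>x. complex_of_real (f x) * cnj (tp K (fc f) x))"
  proof -
    have "integrable tor (\<lambda>x. \<Sum>k\<in>K. cnj (fc f k) * (complex_of_real (f x) * ek (- k) x))"
      using integrable_mult_ek[OF fi] by auto
    also have "(\<lambda>x. \<Sum>k\<in>K. cnj (fc f k) * (complex_of_real (f x) * ek (- k) x)) = (\<lambda>x. complex_of_real (f x) * cnj (tp K (fc f) x))"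
      by (auto simp: fun_eq_iff tp_def cnj_ek sum_distrib_left mult_ac)
    finally show ?thesis .
  qed
  have "X\<^sup>2 = Re (\<integral>x. complex_of_real (f x) * cnj (tp K (fc f) x) \<partial>tor)"
    unfolding eq[symmetric] by simp
  also have "\<dots> = (\<integral>x. f x * Re (tp K (fc f) x) \<partial>tor)"
    using int by (simp flip: integral_Re)
  also have "\<dots> \<le> (\<integral>x. \<bar>f x * Re (tp K (fc f) x)\<bar> \<partial>tor)"
    using L2_integrable_mult[OF f L2_Re_tp] by (intro integral_mono) auto
  also have "\<dots> \<le> L2norm f * L2norm (\<lambda>x. Re (tp K (fc f) x))"
    by (rule L2_Cauchy_Schwarz[OF f L2_Re_tp])
  also have "\<dots> \<le> L2norm f * X"
    unfolding X_def by (intro mult_left_mono L2norm_Re_tp_le K) simp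
  finally have "X * X \<le> L2norm f * X" by (simp add: power2_eq_square)
  then show "l2n (fc f) K \<le> L2norm f"
    using X0 unfolding X_def[symmetric] by (cases "X = 0") auto
qed

subsection \<open>The nonlinear terms\<close>

lemma L2v_D: assumes "L2v G"
  shows "L2 (\<lambda>x. fst (G x))" "L2 (\<lambda>x. snd (G x))" "G \<in> borel_measurable tor" "L2 (\<lambda>x. norm (G x))"
proof -
  show f: "L2 (\<lambda>x. fst (G x))" and s: "L2 (\<lambda>x. snd (G x))" using assms by (auto simp: L2v_def)
  have "(\<lambda>x. (fst (G x), snd (G x))) \<in> borel_measurable tor"
    using f s by (intro borel_measurable_Pair) (auto simp: L2_def)
  then show "G \<in> borel_measurable tor" by simp
  then show "L2 (\<lambda>x. norm (G x))"
    using f s by (auto simp: L2_def norm_prod_def)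
qed

lemma L2v_diff: "L2v G \<Longrightarrow> L2v H \<Longrightarrow> L2v (\<lambda>x. G x - H x)"
  by (auto simp: L2v_def L2_diff)

lemma L2normv_eq: "L2normv G = L2norm (\<lambda>x. norm (G x))"
  by (simp add: L2normv_def L2norm_def)

lemma L2normv_le:
  assumes "L2v G"
  shows "L2normv G \<le> L2norm (\<lambda>x. fst (G x)) + L2norm (\<lambda>x. snd (G x))"
proof -
  have "L2normv G \<le> L2norm (\<lambda>x. \<bar>fst (G x)\<bar> + \<bar>snd (G x)\<bar>)"
    unfolding L2normv_eq
  proof (rule L2norm_mono)
    show "L2 (\<lambda>x. \<bar>fst (G x)\<bar> + \<bar>snd (G x)\<bar>)" by (intro L2_add L2_abs L2v_D assms)
    show "AE x in tor. \<bar>norm (G x)\<bar> \<le> \<bar>\<bar>fst (G x)\<bar> + \<bar>snd (G x)\<bar>\<bar>"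
      by (rule AE_I2) (auto simp: norm_prod_def intro: sqrt_sum_squares_le_sum_abs)
  qed (use L2v_D(4)[OF assms] in \<open>auto simp: L2_def\<close>)
  also have "\<dots> \<le> L2norm (\<lambda>x. \<bar>fst (G x)\<bar>) + L2norm (\<lambda>x. \<bar>snd (G x)\<bar>)"
    by (intro L2norm_triangle L2_abs L2v_D assms)
  finally show ?thesis by (simp add: L2norm_abs)
qed

lemma flux_0 [simp]: "flux p 0 = 0"
  by (simp add: flux_def)

text \<open>With \<open>q = p - 2\<close>, the difference is split as
  \<open>|g|^q (g - h) + (|g|^q - |h|^q) h\<close>. Since \<open>q < 1\<close>,
  \<open>(x / y)^q \<le> x / y\<close> for \<open>x \<ge> y\<close>, which bounds the second part by
  the same quantity as the first.\<close>

lemma flux_diff_le_aux: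
  assumes p: "2 < p" "p < 3" and le: "norm h \<le> norm g"
  shows "norm (flux p g - flux p h) \<le> 2 * norm g powr (p - 2) * norm (g - h)"
proof (cases "h = 0")
  case True
  then show ?thesis by (simp add: flux_def)
next
  case False
  define q x y where "q = p - 2" and "x = norm g" and "y = norm h"
  have q: "0 < q" "q < 1" and xy: "0 < y" "y \<le> x" using p le False by (auto simp: q_def x_def y_def)
  have "(x / y) powr q \<le> (x / y) powr 1" using q xy by (intro powr_mono) auto
  then have "x powr q * y \<le> x * y powr q"
    using xy by (simp add: powr_divide field_simps)
  then have "(x powr q - y powr q) * y \<le> y powr q * (x - y)" by (simp add: algebra_simps)
  also have "\<dots> \<le> x powr q * norm (g - h)"
    using xy q norm_triangle_ineq2[of g h] by (intro mult_mono powr_mono2) (auto simp: x_def y_def)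
  finally have *: "(x powr q - y powr q) * y \<le> x powr q * norm (g - h)" .
  have mono: "y powr q \<le> x powr q" using xy q by (intro powr_mono2) auto
  have "flux p g - flux p h = (x powr q) *\<^sub>R (g - h) + (x powr q - y powr q) *\<^sub>R h"
    by (simp add: flux_def q_def x_def y_def algebra_simps)
  then have "norm (flux p g - flux p h) \<le> norm ((x powr q) *\<^sub>R (g - h)) + norm ((x powr q - y powr q) *\<^sub>R h)"
    by (metis norm_triangle_ineq)
  also have "\<dots> = x powr q * norm (g - h) + (x powr q - y powr q) * y"
    using mono by (simp add: y_def)
  finally show ?thesis using * by (simp add: q_def x_def)
qed

lemma flux_diff_le:
  assumes p: "2 < p" "p < 3"
  shows "norm (flux p g - flux p h) \<le> 2 * (norm g powr (p - 2) + norm h powr (p - 2)) * norm (g - h)"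
proof (cases "norm h \<le> norm g")
  case True
  have "2 * norm g powr (p - 2) * norm (g - h) \<le> 2 * (norm g powr (p - 2) + norm h powr (p - 2)) * norm (g - h)"
    by (intro mult_right_mono) auto
  with flux_diff_le_aux[OF p True] show ?thesis by linarith
next
  case False
  have "2 * norm h powr (p - 2) * norm (h - g) \<le> 2 * (norm g powr (p - 2) + norm h powr (p - 2)) * norm (g - h)"
    unfolding norm_minus_commute[of h g] by (intro mult_right_mono) auto
  with flux_diff_le_aux[OF p, of g h] False show ?thesis
    using norm_minus_commute[of "flux p g"] by (smt (verit) flux_diff_le_aux[OF p, of g h])
qed

text \<open>Replaces Hoelder's inequality: a sublinear power is dominated by an affine function.
  With \<open>l\<close> the expected size of the gradient, the bound keeps the right power of
  \<open>l\<close>.\<close>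

lemma powr_le_scaled_linear:
  assumes "0 < q" "q < 1" "0 < l" "0 \<le> (y::real)"
  shows "y powr q \<le> l powr q * (1 + y / l)"
proof -
  have "(y / l) powr q \<le> 1 + y / l"
  proof (cases "y / l \<le> 1")
    case True
    then have "(y / l) powr q \<le> 1" using assms by (intro powr_le1) auto
    then show ?thesis using assms by (smt (verit) divide_nonneg_pos)
  next
    case False
    then have "(y / l) powr q \<le> (y / l) powr 1" using assms by (intro powr_mono) auto
    then show ?thesis using assms by simp
  qed
  then have "l powr q * (y / l) powr q \<le> l powr q * (1 + y / l)" by (intro mult_left_mono) auto
  moreover have "l powr q * (y / l) powr q = y powr q" using assms by (simp add: powr_divide)
  ultimately show ?thesis by simp
qed

lemma flux_borel [measurable]: "flux p \<in> borel_measurable borel"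
  unfolding flux_def by measurable

text \<open>The weight \<open>w\<close> is affine in the norms of \<open>G\<close> and
  \<open>H\<close>, so Cauchy-Schwarz suffices. Gradients of size at most \<open>R * l\<close> give
  \<open>w\<close> the norm \<open>2 * l powr (p - 2) * (2 + 2 * R)\<close> at most, the constant
  function being measured on a space of mass 1.\<close>

lemma flux_diff_integral:
  assumes p: "2 < p" "p < 3" and l: "0 < l" and R: "0 \<le> R"
    and G: "L2v G" "L2normv G \<le> R * l" and H: "L2v H" "L2normv H \<le> R * l"
  shows "integrable tor (\<lambda>x. flux p (G x) - flux p (H x))"
    and "(\<integral>x. norm (flux p (G x) - flux p (H x)) \<partial>tor) \<le> 4 * (1 + R) * l powr (p - 2) * L2normv (\<lambda>x. G x - H x)"
proof -
  let ?d = "\<lambda>x. norm (G x - H x)"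
  define w where "w x = 2 * l powr (p - 2) * (2 + (norm (G x) + norm (H x)) / l)" for x
  have [measurable]: "G \<in> borel_measurable tor" "H \<in> borel_measurable tor" using L2v_D(3) G H by auto
  have d: "L2 ?d" by (rule L2v_D(4)[OF L2v_diff[OF G(1) H(1)]])
  have w: "L2 w" unfolding w_def divide_inverse mult.commute[of _ "inverse l"]
    by (intro L2_cmult L2_add L2_const L2v_D(4) G H)
  have le: "norm (flux p (G x) - flux p (H x)) \<le> w x * ?d x" for x
  proof -
    have "norm (flux p (G x) - flux p (H x)) \<le> 2 * (norm (G x) powr (p - 2) + norm (H x) powr (p - 2)) * ?d x"
      by (rule flux_diff_le[OF p])
    also have "\<dots> \<le> 2 * (l powr (p - 2) * (1 + norm (G x) / l) + l powr (p - 2) * (1 + norm (H x) / l)) * ?d x"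
      using p l by (intro mult_right_mono mult_left_mono add_mono powr_le_scaled_linear) auto
    also have "\<dots> = w x * ?d x" by (simp add: w_def algebra_simps add_divide_distrib)
    finally show ?thesis .
  qed
  have w0: "0 \<le> w x" for x using l by (simp add: w_def)
  have wd: "integrable tor (\<lambda>x. w x * ?d x)" by (rule L2_integrable_mult[OF w d])
  show int: "integrable tor (\<lambda>x. flux p (G x) - flux p (H x))"
    by (rule Bochner_Integration.integrable_bound[OF wd]) (use le w0 in auto)
  have "(\<integral>x. norm (flux p (G x) - flux p (H x)) \<partial>tor) \<le> (\<integral>x. w x * ?d x \<partial>tor)"
    using int wd le by (intro integral_mono) auto
  also have "\<dots> = (\<integral>x. \<bar>w x * ?d x\<bar> \<partial>tor)" using w0 by (simp add: abs_mult)
  also have "\<dots> \<le> L2norm w * L2norm ?d" by (rule L2_Cauchy_Schwarz[OF w d])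
  also have "\<dots> \<le> (4 * (1 + R) * l powr (p - 2)) * L2norm ?d"
  proof (rule mult_right_mono)
    let ?c = "2 * l powr (p - 2)"
    have c: "L2norm (\<lambda>x. a * f x) = \<bar>a\<bar> * L2norm f" for a f
      by (simp add: L2norm_def power_mult_distrib real_sqrt_mult)
    have "L2norm w = ?c * L2norm (\<lambda>x. 2 + (inverse l * norm (G x) + inverse l * norm (H x)))"
      using c[of ?c "\<lambda>x. 2 + (inverse l * norm (G x) + inverse l * norm (H x))"]
      by (simp add: w_def[abs_def] divide_inverse algebra_simps)
    also have "\<dots> \<le> ?c * (2 + (R + R))"
    proof (rule mult_left_mono)
      have "L2norm (\<lambda>x. 2 + (inverse l * norm (G x) + inverse l * norm (H x)))
          \<le> L2norm (\<lambda>x. 2) + L2norm (\<lambda>x. inverse l * norm (G x) + inverse l * norm (H x))"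
        by (intro L2norm_triangle L2_add L2_const L2_cmult L2v_D(4) G H)
      also have "\<dots> \<le> L2norm (\<lambda>x. 2) + (L2norm (\<lambda>x. inverse l * norm (G x)) + L2norm (\<lambda>x. inverse l * norm (H x)))"
        by (intro add_left_mono L2norm_triangle L2_cmult L2v_D(4) G H)
      also have "\<dots> \<le> 2 + (R + R)"
        using G(2) H(2) l measure_tor unfolding c by (intro add_mono) (auto simp: L2norm_def[of "\<lambda>x. 2"] L2normv_eq field_simps)
      finally show "L2norm (\<lambda>x. 2 + (inverse l * norm (G x) + inverse l * norm (H x))) \<le> 2 + (R + R)" .
    qed simp
    also have "\<dots> = 4 * (1 + R) * l powr (p - 2)" by (simp add: algebra_simps)
    finally show "L2norm w \<le> 4 * (1 + R) * l powr (p - 2)" .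
  qed simp
  finally show "(\<integral>x. norm (flux p (G x) - flux p (H x)) \<partial>tor) \<le> 4 * (1 + R) * l powr (p - 2) * L2normv (\<lambda>x. G x - H x)"
    by (simp add: L2normv_eq)
qed

definition nl_flux :: "real \<Rightarrow> (real \<times> real \<Rightarrow> real \<times> real) \<Rightarrow> int \<times> int \<Rightarrow> complex" where
  "nl_flux p G k = \<i> * complex_of_real (2 * pi) *
     (of_int (fst k) * fc (\<lambda>x. fst (flux p (G x))) k + of_int (snd k) * fc (\<lambda>x. snd (flux p (G x))) k)"

definition nl_adv :: "(real \<times> real \<Rightarrow> real \<times> real) \<Rightarrow> (real \<times> real \<Rightarrow> real \<times> real) \<Rightarrow> int \<times> int \<Rightarrow> complex" where
  "nl_adv V G k = fc (\<lambda>x. V x \<bullet> G x) k"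

lemma div_term_eq: "div_term p G t s k = complex_of_real (sgm (t - s) k) * nl_flux p (G s) k"
  by (simp add: div_term_def nl_flux_def)

lemma adv_term_eq: "adv_term v G t s k = complex_of_real (sgm (t - s) k) * nl_adv (v s) (G s) k"
  by (simp add: adv_term_def nl_adv_def)

lemma L2v_0: "L2v (\<lambda>x. 0)"
  by (simp add: L2v_def L2_const)

lemma flux_L1:
  assumes p: "2 < p" "p < 3" and G: "L2v G"
  shows "L1 (\<lambda>x. fst (flux p (G x)))" "L1 (\<lambda>x. snd (flux p (G x)))"
proof -
  have "integrable tor (\<lambda>x. flux p (G x) - flux p 0)"
    using flux_diff_integral(1)[OF p, of 1 "L2normv G" G "\<lambda>x. 0"] G L2v_0
    by (simp add: L2normv_eq) (simp add: L2norm_def)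
  then have *: "integrable tor (\<lambda>x. flux p (G x))" by simp
  show "L1 (\<lambda>x. fst (flux p (G x)))" "L1 (\<lambda>x. snd (flux p (G x)))"
    unfolding L1_def using integrable_bounded_linear[OF bounded_linear_fst *]
      integrable_bounded_linear[OF bounded_linear_snd *] by auto
qed

text \<open>The factor \<open>16 * pi\<close> consists of \<open>2 * pi\<close> from
  differentiation, 2 from the two components and 4 from \<open>flux_diff_integral\<close>.\<close>

lemma nl_flux_diff_le:
  assumes p: "2 < p" "p < 3" and l: "0 < l" and R: "0 \<le> R"
    and G: "L2v G" "L2normv G \<le> R * l" and H: "L2v H" "L2normv H \<le> R * l"
  shows "cmod (nl_flux p G k - nl_flux p H k)
    \<le> 16 * pi * (1 + R) * sqrt (kw k) * l powr (p - 2) * L2normv (\<lambda>x. G x - H x)"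
proof -
  let ?I = "\<integral>x. norm (flux p (G x) - flux p (H x)) \<partial>tor"
  note fl = flux_diff_integral[OF p l R G H]
  have component: "cmod (fc (\<lambda>x. pr (flux p (G x))) k - fc (\<lambda>x. pr (flux p (H x))) k) \<le> ?I"
    if L1: "L1 (\<lambda>x. pr (flux p (G x)))" "L1 (\<lambda>x. pr (flux p (H x)))" and pr: "\<And>y z. \<bar>pr y - pr z\<bar> \<le> norm (y - z)"
    for pr :: "real \<times> real \<Rightarrow> real"
  proof -
    have "cmod (fc (\<lambda>x. pr (flux p (G x))) k - fc (\<lambda>x. pr (flux p (H x))) k)
        = cmod (fc (\<lambda>x. pr (flux p (G x)) - pr (flux p (H x))) k)"
      by (simp add: fc_diff L1)
    also have "\<dots> \<le> (\<integral>x. \<bar>pr (flux p (G x)) - pr (flux p (H x))\<bar> \<partial>tor)" by (rule fc_norm_le)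
    also have "\<dots> \<le> ?I"
      using L1 fl(1) by (intro integral_mono pr) (auto simp: L1_def)
    finally show ?thesis .
  qed
  have 1: "cmod (fc (\<lambda>x. fst (flux p (G x))) k - fc (\<lambda>x. fst (flux p (H x))) k) \<le> ?I"
    by (rule component) (auto simp: flux_L1[OF p] G H norm_prod_def)
  have 2: "cmod (fc (\<lambda>x. snd (flux p (G x))) k - fc (\<lambda>x. snd (flux p (H x))) k) \<le> ?I"
    by (rule component) (auto simp: flux_L1[OF p] G H norm_prod_def)
  have "nl_flux p G k - nl_flux p H k = \<i> * complex_of_real (2 * pi) *
      (of_int (fst k) * (fc (\<lambda>x. fst (flux p (G x))) k - fc (\<lambda>x. fst (flux p (H x))) k)
       + of_int (snd k) * (fc (\<lambda>x. snd (flux p (G x))) k - fc (\<lambda>x. snd (flux p (H x))) k))"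
    by (simp add: nl_flux_def algebra_simps)
  then have "cmod (nl_flux p G k - nl_flux p H k) = 2 * pi *
      cmod (of_int (fst k) * (fc (\<lambda>x. fst (flux p (G x))) k - fc (\<lambda>x. fst (flux p (H x))) k)
       + of_int (snd k) * (fc (\<lambda>x. snd (flux p (G x))) k - fc (\<lambda>x. snd (flux p (H x))) k))"
    by (simp add: norm_mult)
  also have "\<dots> \<le> 2 * pi * (sqrt (kw k) * ?I + sqrt (kw k) * ?I)"
    by (intro mult_left_mono order_trans[OF norm_triangle_ineq] add_mono)
      (auto simp: norm_mult less_imp_le intro!: mult_mono 1 2 abs_fst_le_sqrt_kw abs_snd_le_sqrt_kw)
  also have "\<dots> = 4 * pi * sqrt (kw k) * ?I" by simp
  also have "\<dots> \<le> 4 * pi * sqrt (kw k) * (4 * (1 + R) * l powr (p - 2) * L2normv (\<lambda>x. G x - H x))"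
    by (intro mult_left_mono fl(2)) (auto simp: less_imp_le)
  finally show ?thesis by (simp add: mult_ac)
qed

lemma adv_L1:
  assumes "L2v V" "L2v G" shows "L1 (\<lambda>x. V x \<bullet> G x)"
  unfolding L1_def inner_prod_def
  using L2_integrable_mult[OF L2v_D(1)[OF assms(1)] L2v_D(1)[OF assms(2)]]
    L2_integrable_mult[OF L2v_D(2)[OF assms(1)] L2v_D(2)[OF assms(2)]] by simp

lemma nl_adv_diff_le:
  assumes V: "L2v V" and G: "L2v G" and H: "L2v H"
  shows "cmod (nl_adv V G k - nl_adv V H k) \<le> L2normv V * L2normv (\<lambda>x. G x - H x)"
proof -
  have "cmod (nl_adv V G k - nl_adv V H k) = cmod (fc (\<lambda>x. V x \<bullet> (G x - H x)) k)"
    unfolding nl_adv_def inner_diff_right by (simp add: fc_diff adv_L1 V G H)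
  also have "\<dots> \<le> (\<integral>x. \<bar>V x \<bullet> (G x - H x)\<bar> \<partial>tor)" by (rule fc_norm_le)
  also have "\<dots> \<le> (\<integral>x. \<bar>norm (V x) * norm (G x - H x)\<bar> \<partial>tor)"
  proof (rule integral_mono)
    show "integrable tor (\<lambda>x. \<bar>V x \<bullet> (G x - H x)\<bar>)"
      using adv_L1[OF V L2v_diff[OF G H]] by (simp add: L1_def)
    show "integrable tor (\<lambda>x. \<bar>norm (V x) * norm (G x - H x)\<bar>)"
      using L2_integrable_mult[OF L2v_D(4)[OF V] L2v_D(4)[OF L2v_diff[OF G H]]] by simp
    show "\<bar>V x \<bullet> (G x - H x)\<bar> \<le> \<bar>norm (V x) * norm (G x - H x)\<bar>" for x
      using Cauchy_Schwarz_ineq2[of "V x" "G x - H x"] by simp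
  qed
  also have "\<dots> \<le> L2normv V * L2normv (\<lambda>x. G x - H x)"
    unfolding L2normv_eq by (intro L2_Cauchy_Schwarz L2v_D(4) V L2v_diff G H)
  finally show ?thesis .
qed

subsection \<open>Gradients in terms of Fourier coefficients\<close>

definition dcf :: "(int \<times> int \<Rightarrow> complex) \<Rightarrow> int \<times> int \<Rightarrow> complex" where
  "dcf c k = \<i> * complex_of_real (2 * pi * of_int (fst k)) * c k"

definition dcs :: "(int \<times> int \<Rightarrow> complex) \<Rightarrow> int \<times> int \<Rightarrow> complex" where
  "dcs c k = \<i> * complex_of_real (2 * pi * of_int (snd k)) * c k"

definition Gr :: "(int \<times> int \<Rightarrow> complex) \<Rightarrow> real \<times> real \<Rightarrow> real \<times> real" where
  "Gr c x = (RF (dcf c) x, RF (dcs c) x)"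

definition h1_le :: "(int \<times> int \<Rightarrow> complex) \<Rightarrow> real \<Rightarrow> bool" where
  "h1_le c B \<longleftrightarrow> l2_le (\<lambda>k. complex_of_real (sqrt (kw k)) * c k) B"

lemma h1_leI: "(\<And>K. finite K \<Longrightarrow> L2_set (\<lambda>k. sqrt (kw k) * cmod (c k)) K \<le> B) \<Longrightarrow> h1_le c B"
  by (simp add: h1_le_def l2_le_def norm_mult less_imp_le)

lemma h1_leD: "h1_le c B \<Longrightarrow> finite K \<Longrightarrow> L2_set (\<lambda>k. sqrt (kw k) * cmod (c k)) K \<le> B"
  by (simp add: h1_le_def l2_le_def norm_mult less_imp_le)

lemma h1_le_weaken: "h1_le c B \<Longrightarrow> B \<le> C \<Longrightarrow> h1_le c C"
  unfolding h1_le_def by (rule l2_le_weaken)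

lemma h1_le_add: "h1_le c B \<Longrightarrow> h1_le d D \<Longrightarrow> h1_le (\<lambda>k. c k + d k) (B + D)"
  using l2_le_add[of "\<lambda>k. complex_of_real (sqrt (kw k)) * c k" B "\<lambda>k. complex_of_real (sqrt (kw k)) * d k" D]
  by (simp add: h1_le_def algebra_simps)

lemma h1_le_diff: "h1_le c B \<Longrightarrow> h1_le d D \<Longrightarrow> h1_le (\<lambda>k. c k - d k) (B + D)"
  using l2_le_diff[of "\<lambda>k. complex_of_real (sqrt (kw k)) * c k" B "\<lambda>k. complex_of_real (sqrt (kw k)) * d k" D]
  by (simp add: h1_le_def algebra_simps)

lemma h1_le_uminus: "h1_le (\<lambda>k. - c k) B \<longleftrightarrow> h1_le c B"
  by (simp add: h1_le_def l2_le_def)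

lemma h1_le_0: "0 \<le> B \<Longrightarrow> h1_le (\<lambda>k. 0) B"
  by (simp add: h1_le_def l2_le_def L2_set_def)

lemma h1_le_LIMSEQ:
  assumes "\<And>n. h1_le (c n) (B n)" "\<And>k. (\<lambda>n. c n k) \<longlonglongrightarrow> d k" "B \<longlonglongrightarrow> D"
  shows "h1_le d D"
  unfolding h1_le_def
  by (rule l2_le_LIMSEQ[OF assms(1)[unfolded h1_le_def] _ assms(3)]) (intro tendsto_intros assms)

lemma h1_le_imp_l2_le:
  assumes "h1_le c B" shows "l2_le c B"
proof (rule l2_le_mono[OF assms[unfolded h1_le_def]])
  fix k
  have "1 * cmod (c k) \<le> sqrt (kw k) * cmod (c k)"
    by (intro mult_right_mono) (auto simp: kw_ge_1)
  then show "cmod (c k) \<le> cmod (complex_of_real (sqrt (kw k)) * c k)"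
    by (simp add: norm_mult less_imp_le)
qed

lemma h1_le_dcf:
  assumes "h1_le c B" shows "l2_le (dcf c) (2 * pi * B)"
proof (rule l2_le_scale[OF assms[unfolded h1_le_def]])
  show "cmod (dcf c k) \<le> 2 * pi * cmod (complex_of_real (sqrt (kw k)) * c k)" for k
    using mult_right_mono[OF abs_fst_le_sqrt_kw[of k], of "cmod (c k)"]
    by (simp add: dcf_def norm_mult abs_mult less_imp_le mult.assoc)
qed simp

lemma h1_le_dcs:
  assumes "h1_le c B" shows "l2_le (dcs c) (2 * pi * B)"
proof (rule l2_le_scale[OF assms[unfolded h1_le_def]])
  show "cmod (dcs c k) \<le> 2 * pi * cmod (complex_of_real (sqrt (kw k)) * c k)" for k
    using mult_right_mono[OF abs_snd_le_sqrt_kw[of k], of "cmod (c k)"]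
    by (simp add: dcs_def norm_mult abs_mult less_imp_le mult.assoc)
qed simp

lemma dcf_diff: "dcf (\<lambda>k. c k - d k) = (\<lambda>k. dcf c k - dcf d k)"
  by (simp add: dcf_def algebra_simps fun_eq_iff)

lemma dcs_diff: "dcs (\<lambda>k. c k - d k) = (\<lambda>k. dcs c k - dcs d k)"
  by (simp add: dcs_def algebra_simps fun_eq_iff)

lemma L2v_Gr: "h1_le c B \<Longrightarrow> L2v (Gr c)"
  unfolding L2v_def Gr_def by (auto intro: L2_RF h1_le_dcf h1_le_dcs)

lemma L2normv_Gr_diff_le:
  assumes "h1_le c B" "h1_le d C" "h1_le (\<lambda>k. c k - d k) D"
  shows "L2normv (\<lambda>x. Gr c x - Gr d x) \<le> 4 * pi * D"
proof -
  have "L2normv (\<lambda>x. Gr c x - Gr d x) \<le> L2norm (\<lambda>x. fst (Gr c x - Gr d x)) + L2norm (\<lambda>x. snd (Gr c x - Gr d x))"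
    by (intro L2normv_le L2v_diff L2v_Gr[OF assms(1)] L2v_Gr[OF assms(2)])
  also have "L2norm (\<lambda>x. fst (Gr c x - Gr d x)) \<le> 2 * pi * D"
    using L2norm_RF_diff_le[OF h1_le_dcf[OF assms(1)] h1_le_dcf[OF assms(2)]] h1_le_dcf[OF assms(3)]
    by (simp add: Gr_def dcf_diff)
  also have "L2norm (\<lambda>x. snd (Gr c x - Gr d x)) \<le> 2 * pi * D"
    using L2norm_RF_diff_le[OF h1_le_dcs[OF assms(1)] h1_le_dcs[OF assms(2)]] h1_le_dcs[OF assms(3)]
    by (simp add: Gr_def dcs_diff)
  finally show ?thesis by (simp add: mult_ac)
qed

lemma Gr_0: "Gr (\<lambda>k. 0) = (\<lambda>x. 0)"
  using RF_0 by (simp add: Gr_def fun_eq_iff dcf_def[abs_def] dcs_def[abs_def] zero_prod_def)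

lemma L2normv_Gr_le: "h1_le c B \<Longrightarrow> L2normv (Gr c) \<le> 4 * pi * B"
  using L2normv_Gr_diff_le[of c B "\<lambda>k. 0" 0 B] h1_le_0[of 0] by (simp add: Gr_0)

text \<open>The multipliers \<open>\<i> * k\<close> preserve Hermitian symmetry, so neither
  \<open>c\<close> nor its derivatives are changed by the symmetrization in
  \<open>fc_RF\<close>.\<close>

lemma weak_grad_RF:
  assumes c: "h1_le c B" and sym: "\<And>k. c (- k) = cnj (c k)"
  shows "weak_grad (RF c) (Gr c)" and "\<And>k. fc (RF c) k = c k"
proof -
  show fc_c: "fc (RF c) k = c k" for k
    using fc_RF[OF h1_le_imp_l2_le[OF c]] sym by simp
  show "weak_grad (RF c) (Gr c)"
    unfolding weak_grad_def fc_c using L2v_Gr[OF c]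
    by (simp add: L2v_def L2_imp_L1 L2_RF[OF h1_le_imp_l2_le[OF c]] del: split_paired_All)
      (simp add: Gr_def fc_RF[OF h1_le_dcf[OF c]] fc_RF[OF h1_le_dcs[OF c]] dcf_def dcs_def sym
        del: split_paired_All)
qed

text \<open>Uniqueness deals with arbitrary weak gradients rather than with \<open>Gr\<close>;
  completeness of the modes bounds them by the coefficients all the same.\<close>

lemma L2normv_weak_grad_diff_le:
  assumes G: "weak_grad u G" "L2v G" and H: "weak_grad w H" "L2v H"
    and D: "h1_le (\<lambda>k. fc u k - fc w k) D"
  shows "L2normv (\<lambda>x. G x - H x) \<le> 4 * pi * D"
proof -
  have f: "fc (\<lambda>x. fst (G x) - fst (H x)) = dcf (\<lambda>k. fc u k - fc w k)"
    using G H by (auto simp: fun_eq_iff fc_diff weak_grad_def dcf_def algebra_simps)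
  have s: "fc (\<lambda>x. snd (G x) - snd (H x)) = dcs (\<lambda>k. fc u k - fc w k)"
    using G H by (auto simp: fun_eq_iff fc_diff weak_grad_def dcs_def algebra_simps)
  have "L2normv (\<lambda>x. G x - H x) \<le> L2norm (\<lambda>x. fst (G x - H x)) + L2norm (\<lambda>x. snd (G x - H x))"
    by (intro L2normv_le L2v_diff G H)
  also have "L2norm (\<lambda>x. fst (G x - H x)) \<le> 2 * pi * D"
    unfolding fst_diff using h1_le_dcf[OF D] L2v_D[OF G(2)] L2v_D[OF H(2)] by (intro L2norm_le_fc L2_diff) (auto simp: f)
  also have "L2norm (\<lambda>x. snd (G x - H x)) \<le> 2 * pi * D"
    unfolding snd_diff using h1_le_dcs[OF D] L2v_D[OF G(2)] L2v_D[OF H(2)] by (intro L2norm_le_fc L2_diff) (auto simp: s)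
  finally show ?thesis by (simp add: mult_ac)
qed

subsection \<open>Measurability in time\<close>

text \<open>Multiplication by a mode shifts coefficients, so the product with a truncated series is
  a finite convolution and involves \<open>w\<close> only through \<open>fc w\<close>.\<close>

lemma fc_mult_Re_tp:
  assumes w: "L1 w"
  shows "fc (\<lambda>x. w x * Re (tp K d x)) k = (\<Sum>j\<in>K. (d j * fc w (k - j) + cnj (d j) * fc w (k + j)) / 2)"
proof -
  have wi: "integrable tor (\<lambda>x. complex_of_real (w x))" using w by (simp add: L1_def)
  have "complex_of_real (w x * Re (tp K d x)) * ek (- k) x
      = (\<Sum>j\<in>K. (d j * (complex_of_real (w x) * ek (- (k - j)) x) + cnj (d j) * (complex_of_real (w x) * ek (- (k + j)) x)) / 2)" for x
  proof -
    have "complex_of_real (Re (tp K d x)) = (tp K d x + cnj (tp K d x)) / 2"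
      by (simp add: complex_add_cnj)
    also have "\<dots> = (\<Sum>j\<in>K. (d j * ek j x + cnj (d j) * ek (- j) x) / 2)"
      by (simp add: tp_def cnj_ek sum.distrib sum_divide_distrib add_divide_distrib)
    finally have 1: "complex_of_real (Re (tp K d x)) = (\<Sum>j\<in>K. (d j * ek j x + cnj (d j) * ek (- j) x) / 2)" .
    have 2: "ek (- (k - j)) x = ek j x * ek (- k) x" "ek (- (k + j)) x = ek (- j) x * ek (- k) x" for j
      using ek_add[of j "- k" x] ek_add[of "- j" "- k" x] by (simp_all add: add.commute)
    show ?thesis
      unfolding of_real_mult 1 2 by (simp add: sum_distrib_left sum_distrib_right field_simps)
  qed
  then show ?thesis
    using integrable_mult_ek[OF wi] unfolding fc_eq by simp
qed

text \<open>The velocity is not assumed jointly measurable in time and space, so Fubini is out of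
  reach. The coefficient of the product is instead a limit of finite convolutions of measurable
  coefficients; the truncation error is controlled by Cauchy-Schwarz.\<close>

lemma fc_mult_RF_measurable:
  assumes w: "\<And>s. s \<in> space P \<Longrightarrow> L2 (w s)" "\<And>k. (\<lambda>s. fc (w s) k) \<in> borel_measurable P"
    and d: "\<And>s. s \<in> space P \<Longrightarrow> l2_le (d s) (B s)" "\<And>k. (\<lambda>s. d s k) \<in> borel_measurable P"
  shows "(\<lambda>s. fc (\<lambda>x. w s x * RF (d s) x) k) \<in> borel_measurable P"
proof (rule borel_measurable_LIMSEQ_metric)
  note [measurable] = w(2) d(2)
  have [measurable]: "(\<lambda>s. cnj (d s j)) \<in> borel_measurable P" for j
    using borel_measurable_continuous_onI[OF continuous_on_cnj[OF continuous_on_id]]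
    by (rule measurable_compose[OF d(2)])
  show "(\<lambda>s. \<Sum>j\<in>kbox n. (d s j * fc (w s) (k - j) + cnj (d s j) * fc (w s) (k + j)) / 2) \<in> borel_measurable P" for n
    by measurable
  fix s assume s: "s \<in> space P"
  have ws: "L2 (w s)" and ds: "l2_le (d s) (B s)" using w d s by auto
  let ?t = "\<lambda>n x. Re (tp (kbox n) (d s) x)"
  have le: "cmod (fc (\<lambda>x. w s x * ?t n x) k - fc (\<lambda>x. w s x * RF (d s) x) k) \<le> L2norm (w s) * L2norm (\<lambda>x. RF (d s) x - ?t n x)" for n
  proof -
    have d2: "L2 (\<lambda>x. ?t n x - RF (d s) x)" by (intro L2_diff L2_Re_tp L2_RF[OF ds])
    have "fc (\<lambda>x. w s x * ?t n x) k - fc (\<lambda>x. w s x * RF (d s) x) k = fc (\<lambda>x. w s x * (?t n x - RF (d s) x)) k"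
      using L2_integrable_mult[OF ws L2_Re_tp] L2_integrable_mult[OF ws L2_RF[OF ds]]
      by (simp add: right_diff_distrib fc_diff L1_def)
    also have "cmod \<dots> \<le> (\<integral>x. \<bar>w s x * (?t n x - RF (d s) x)\<bar> \<partial>tor)" by (rule fc_norm_le)
    also have "\<dots> \<le> L2norm (w s) * L2norm (\<lambda>x. ?t n x - RF (d s) x)" by (rule L2_Cauchy_Schwarz[OF ws d2])
    finally show ?thesis by (simp add: L2norm_minus_commute[of "?t n"])
  qed
  have lim0: "(\<lambda>n. L2norm (w s) * L2norm (\<lambda>x. RF (d s) x - ?t n x)) \<longlonglongrightarrow> 0"
    using tendsto_mult_left[OF RF_approx[OF ds], of "L2norm (w s)"] by simp
  have "(\<lambda>n. fc (\<lambda>x. w s x * ?t n x) k - fc (\<lambda>x. w s x * RF (d s) x) k) \<longlonglongrightarrow> 0"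
    using le by (intro Lim_null_comparison[OF _ lim0] always_eventually allI)
  then have "(\<lambda>n. fc (\<lambda>x. w s x * ?t n x) k) \<longlonglongrightarrow> fc (\<lambda>x. w s x * RF (d s) x) k"
    by (simp add: LIM_zero_iff)
  then show "(\<lambda>n. \<Sum>j\<in>kbox n. (d s j * fc (w s) (k - j) + cnj (d s j) * fc (w s) (k + j)) / 2)
      \<longlonglongrightarrow> fc (\<lambda>x. w s x * RF (d s) x) k"
    by (simp add: fc_mult_Re_tp L2_imp_L1[OF ws])
qed

lemma nl_adv_measurable:
  assumes v: "\<And>s. s \<in> space P \<Longrightarrow> L2v (v s)"
      "\<And>k. (\<lambda>s. fc (\<lambda>x. fst (v s x)) k) \<in> borel_measurable P"
      "\<And>k. (\<lambda>s. fc (\<lambda>x. snd (v s x)) k) \<in> borel_measurable P"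
    and c: "\<And>s. s \<in> space P \<Longrightarrow> h1_le (c s) (B s)" "\<And>k. (\<lambda>s. c s k) \<in> borel_measurable P"
  shows "(\<lambda>s. nl_adv (v s) (Gr (c s)) k) \<in> borel_measurable P"
proof -
  note [measurable] = c(2)
  have m1: "(\<lambda>s. fc (\<lambda>x. fst (v s x) * RF (dcf (c s)) x) k) \<in> borel_measurable P"
    by (rule fc_mult_RF_measurable[where B = "\<lambda>s. 2 * pi * B s"])
      (use v c h1_le_dcf in \<open>auto simp: L2v_def dcf_def\<close>)
  have m2: "(\<lambda>s. fc (\<lambda>x. snd (v s x) * RF (dcs (c s)) x) k) \<in> borel_measurable P"
    by (rule fc_mult_RF_measurable[where B = "\<lambda>s. 2 * pi * B s"])
      (use v c h1_le_dcs in \<open>auto simp: L2v_def dcs_def\<close>)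
  have "nl_adv (v s) (Gr (c s)) k
      = fc (\<lambda>x. fst (v s x) * RF (dcf (c s)) x) k + fc (\<lambda>x. snd (v s x) * RF (dcs (c s)) x) k"
    if s: "s \<in> space P" for s
  proof -
    have "integrable tor (\<lambda>x. fst (v s x) * RF (dcf (c s)) x)" "integrable tor (\<lambda>x. snd (v s x) * RF (dcs (c s)) x)"
      using L2v_D[OF v(1)[OF s]] L2_RF[OF h1_le_dcf[OF c(1)[OF s]]] L2_RF[OF h1_le_dcs[OF c(1)[OF s]]]
      by (auto intro: L2_integrable_mult)
    then have "integrable tor (\<lambda>x. complex_of_real (fst (v s x) * RF (dcf (c s)) x) * ek (- k) x)"
      "integrable tor (\<lambda>x. complex_of_real (snd (v s x) * RF (dcs (c s)) x) * ek (- k) x)"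
      by (auto intro!: integrable_mult_ek simp del: of_real_mult)
    then show ?thesis
      unfolding nl_adv_def fc_eq by (subst Bochner_Integration.integral_add[symmetric])
        (auto simp: Gr_def inner_prod_def distrib_right)
  qed
  with m1 m2 show ?thesis by (simp cong: measurable_cong)
qed

lemma fc_parametric_measurable:
  assumes h: "(\<lambda>z. h (fst z) (snd z)) \<in> borel_measurable (P \<Otimes>\<^sub>M borel)"
  shows "(\<lambda>s. fc (h s) k) \<in> borel_measurable P"
proof -
  have hs: "h s \<in> borel_measurable borel" if "s \<in> space P" for s
    using measurable_compose[OF measurable_Pair1'[OF that] h] by simp
  have "(\<lambda>z. indicator torus_sq (snd z) *\<^sub>R (complex_of_real (h (fst z) (snd z)) * ek (- k) (snd z)))
      \<in> borel_measurable (P \<Otimes>\<^sub>M lborel)"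
    using h by (simp cong: measurable_cong_sets)
  then have "(\<lambda>(s, x). indicator torus_sq x *\<^sub>R (complex_of_real (h s x) * ek (- k) x)) \<in> borel_measurable (P \<Otimes>\<^sub>M lborel)"
    by (simp add: case_prod_beta)
  then have "(\<lambda>s. \<integral>x. indicator torus_sq x *\<^sub>R (complex_of_real (h s x) * ek (- k) x) \<partial>lborel) \<in> borel_measurable P"
    by (rule lborel.borel_measurable_lebesgue_integral)
  moreover have "fc (h s) k = (\<integral>x. indicator torus_sq x *\<^sub>R (complex_of_real (h s x) * ek (- k) x) \<partial>lborel)"
    if "s \<in> space P" for s
    unfolding fc_eq using hs[OF that] by (subst integral_tor_eq_lborel) auto
  ultimately show ?thesis by (simp cong: measurable_cong)
qed

lemma Gr_jointly_measurable:
  assumes c: "\<And>k. (\<lambda>s. c s k) \<in> borel_measurable P"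
  shows "(\<lambda>z. Gr (c (fst z)) (snd z)) \<in> borel_measurable (P \<Otimes>\<^sub>M borel)"
  unfolding Gr_def using c
  by (intro borel_measurable_Pair RF_jointly_measurable) (auto simp: dcf_def dcs_def)

text \<open>No convolution formula is available for a nonlinear function of the gradient; here the
  joint measurability of the representative is essential.\<close>

lemma nl_flux_measurable:
  assumes c: "\<And>k. (\<lambda>s. c s k) \<in> borel_measurable P"
  shows "(\<lambda>s. nl_flux p (Gr (c s)) k) \<in> borel_measurable P"
proof -
  have "(\<lambda>z. flux p (Gr (c (fst z)) (snd z))) \<in> borel_measurable (P \<Otimes>\<^sub>M borel)"
    by (rule measurable_compose[OF Gr_jointly_measurable[OF c] flux_borel])
  then have f: "(\<lambda>z. fst (flux p (Gr (c (fst z)) (snd z)))) \<in> borel_measurable (P \<Otimes>\<^sub>M borel)"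
    and s: "(\<lambda>z. snd (flux p (Gr (c (fst z)) (snd z)))) \<in> borel_measurable (P \<Otimes>\<^sub>M borel)"
    by (auto intro!: measurable_compose[of _ _ borel fst] measurable_compose[of _ _ borel snd] borel_measurable_continuous_onI
        continuous_intros)
  have "(\<lambda>s. fc (\<lambda>x. fst (flux p (Gr (c s) x))) k) \<in> borel_measurable P"
    "(\<lambda>s. fc (\<lambda>x. snd (flux p (Gr (c s) x))) k) \<in> borel_measurable P"
    using fc_parametric_measurable[OF f] fc_parametric_measurable[OF s] by auto
  then show ?thesis unfolding nl_flux_def by measurable
qed

declare split_paired_All [simp del] split_paired_Ex [simp del]

subsection \<open>Bochner integrability of the Duhamel integrands\<close>

text \<open>Writes the infinite sum as a countable supremum of finite sums, which makes it
  measurable in a parameter whether or not it converges.\<close>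

lemma infsum_eq_enn2real_SUP_kbox:
  fixes f :: "int \<times> int \<Rightarrow> real"
  assumes f: "\<And>k. 0 \<le> f k"
  shows "infsum f UNIV = enn2real (SUP n. ennreal (sum f (kbox n)))"
proof -
  define S where "S = (SUP n. ennreal (sum f (kbox n)))"
  have fin: "ennreal (sum f F) \<le> S" if F: "finite F" for F
  proof -
    obtain n where "F \<subseteq> kbox n" using finite_subset_kbox[OF F] .
    then have "ennreal (sum f F) \<le> ennreal (sum f (kbox n))"
      using f by (intro ennreal_leI sum_mono2) auto
    also have "\<dots> \<le> S" unfolding S_def by (rule SUP_upper) simp
    finally show ?thesis .
  qed
  show ?thesis
  proof (cases "S < top")
    case True
    then obtain B where B: "S = ennreal B" "0 \<le> B" by (cases S) auto
    then have le: "sum f F \<le> B" if "finite F" for F using fin[OF that] by simp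
    have sm: "f summable_on UNIV"
      using f le by (intro nonneg_bdd_above_summable_on) (auto intro!: bdd_aboveI[of _ B])
    have "infsum f UNIV \<le> B" by (rule infsum_le_finite_sums[OF sm le])
    moreover have "S \<le> ennreal (infsum f UNIV)"
      unfolding S_def using f by (intro SUP_least ennreal_leI finite_sum_le_infsum[OF sm]) auto
    ultimately have "infsum f UNIV = B" using B infsum_nonneg[of UNIV f] f by (simp add: antisym)
    then show ?thesis using B by (simp add: S_def[symmetric])
  next
    \<comment> \<open>Two default values agree: \<open>infsum\<close> of a family that is not
      summable and \<open>enn2real\<close> of \<open>top\<close> are both 0.\<close>
    case False
    have "\<not> f summable_on UNIV"
    proof
      assume sm: "f summable_on UNIV"
      have "S \<le> ennreal (infsum f UNIV)"
        unfolding S_def using f by (intro SUP_least ennreal_leI finite_sum_le_infsum[OF sm]) auto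
      with False show False by (metis ennreal_less_top le_less_trans)
    qed
    then show ?thesis using False by (simp add: infsum_not_exists S_def[symmetric] less_top[symmetric])
  qed
qed

lemma l2_le_imp_infsum:
  assumes "l2_le c B"
  shows "(\<lambda>k. (cmod (c k))\<^sup>2) summable_on UNIV" "sqrt (infsum (\<lambda>k. (cmod (c k))\<^sup>2) UNIV) \<le> B"
proof -
  have B: "0 \<le> B" by (rule l2_le_nonneg[OF assms])
  have le: "(\<Sum>k\<in>F. (cmod (c k))\<^sup>2) \<le> B\<^sup>2" if "finite F" for F
    using power_mono[OF l2_leD[OF assms that], of 2] by (simp add: L2_set_def sum_nonneg)
  show sm: "(\<lambda>k. (cmod (c k))\<^sup>2) summable_on UNIV"
    using le by (intro nonneg_bdd_above_summable_on) (auto intro!: bdd_aboveI[of _ "B\<^sup>2"])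
  have "infsum (\<lambda>k. (cmod (c k))\<^sup>2) UNIV \<le> B\<^sup>2" by (rule infsum_le_finite_sums[OF sm le])
  then show "sqrt (infsum (\<lambda>k. (cmod (c k))\<^sup>2) UNIV) \<le> B" using B by (simp add: real_le_lsqrt)
qed

lemma AE_lebesgue_on_Icc_pos: "AE s in leb t. 0 < s \<and> s \<le> t \<and> s \<noteq> t"
proof -
  have "AE s in lebesgue. s \<noteq> 0" "AE s in lebesgue. s \<noteq> t"
    by (auto intro!: AE_completion AE_lborel_singleton)
  then have "AE s in lebesgue. s \<in> {0..t} \<longrightarrow> 0 < s \<and> s \<le> t \<and> s \<noteq> t"
    by eventually_elim auto
  then show ?thesis by (subst AE_restrict_space_iff) auto
qed

lemma AE_lebesgue_on_Icc_mono:
  assumes "AE s in leb T. P s" "t \<le> T"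
  shows "AE s in leb t. P s"
proof -
  have "AE s in lebesgue. s \<in> {0..T} \<longrightarrow> P s" using assms(1) by (subst (asm) AE_restrict_space_iff) auto
  then have "AE s in lebesgue. s \<in> {0..t} \<longrightarrow> P s" by eventually_elim (use assms(2) in auto)
  then show ?thesis by (subst AE_restrict_space_iff) auto
qed

lemma l2_bochner_duhamel:
  fixes n :: "real \<Rightarrow> int \<times> int \<Rightarrow> complex"
  assumes t: "t \<le> 1" and b: "b < 1" and L: "0 \<le> L"
    and n: "\<And>k. (\<lambda>s. n s k) \<in> borel_measurable (leb t)"
    and le: "AE s in leb t. \<forall>k. cmod (n s k) \<le> L * sqrt (kw k) * s powr (- b)"
  shows "l2_bochner t (\<lambda>s k. complex_of_real (sgm (t - s) k) * n s k)"
proof -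
  let ?M = "leb t"
  let ?c = "\<lambda>s k. complex_of_real (sgm (t - s) k) * n s k"
  have m [measurable]: "(\<lambda>s. ?c s k) \<in> borel_measurable ?M" for k using n[of k] by measurable
  have bd: "AE s in ?M. l2_le (?c s) (L * kernel_const * ((t - s) powr (- (1 / 2)) * s powr (- b)))"
    using le AE_lebesgue_on_Icc_pos
  proof eventually_elim
    case (elim s)
    show ?case
    proof (rule l2_leI)
      fix K :: "(int \<times> int) set" assume K: "finite K"
      have "l2n (?c s) K \<le> (L * s powr (- b)) * kernel_const * (t - s) powr (- 1 / 2)"
        using elim(2) t L K elim(1)[rule_format] by (intro L2_set_sgm_mult_le) (auto simp: mult_ac)
      then show "l2n (?c s) K \<le> L * kernel_const * ((t - s) powr (- (1 / 2)) * s powr (- b))"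
        by (simp add: mult_ac)
    qed
  qed
  have im: "(\<lambda>s. sqrt (infsum (\<lambda>k. (cmod (?c s k))\<^sup>2) UNIV)) \<in> borel_measurable ?M"
    unfolding infsum_eq_enn2real_SUP_kbox[OF zero_le_power2] by measurable
  have ib: "AE s in ?M. norm (sqrt (infsum (\<lambda>k. (cmod (?c s k))\<^sup>2) UNIV))
      \<le> norm (L * kernel_const * ((t - s) powr (- (1 / 2)) * s powr (- b)))"
    using bd
  proof eventually_elim
    case (elim s)
    show ?case using l2_le_imp_infsum(2)[OF elim] l2_le_nonneg[OF elim] by (simp add: infsum_nonneg)
  qed
  have "integrable ?M (\<lambda>s. L * kernel_const * ((t - s) powr (- (1 / 2)) * s powr (- b)))"
    using b by (intro integrable_mult_right beta_kernel_integrable) auto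
  then have "integrable ?M (\<lambda>s. sqrt (infsum (\<lambda>k. (cmod (?c s k))\<^sup>2) UNIV))"
    by (rule Bochner_Integration.integrable_bound[OF _ im ib])
  moreover have "AE s in ?M. (\<lambda>k. (cmod (?c s k))\<^sup>2) summable_on UNIV"
    using bd by eventually_elim (rule l2_le_imp_infsum(1))
  ultimately show ?thesis using m unfolding l2_bochner_def by blast
qed

subsection \<open>The Duhamel operator\<close>

definition duhamel :: "(real \<Rightarrow> int \<times> int \<Rightarrow> complex) \<Rightarrow> real \<Rightarrow> int \<times> int \<Rightarrow> complex" where
  "duhamel n t k = (\<integral>s. complex_of_real (sgm (t - s) k) * n s k \<partial>leb t)"

lemma duhamel_0: "duhamel n 0 k = 0"
  unfolding duhamel_def by (rule integral_eq_zero_AE) (use AE_lebesgue_on_Icc_pos[of 0] in eventually_elim, auto)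

text \<open>For a single mode the semigroup extends to negative times, so
  \<open>sgm (t - s) k\<close> factors as \<open>sgm t k * sgm (- s) k\<close> and continuity
  reduces to that of an indefinite integral.\<close>

lemma duhamel_continuous:
  fixes n :: "real \<Rightarrow> int \<times> int \<Rightarrow> complex"
  assumes n: "(\<lambda>s. n s k) \<in> borel_measurable (leb T)" and b: "b < 1"
    and le: "AE s in leb T. cmod (n s k) \<le> C * s powr (- b)"
  shows "continuous_on {0..T} (\<lambda>t. duhamel n t k)"
proof -
  let ?g = "\<lambda>s. complex_of_real (sgm (- s) k) * n s k"
  have "integrable (leb T) (\<lambda>s. complex_of_real (sgm (- T) k) * (complex_of_real (sgm (T - s) k) * n s k))"
    by (intro integrable_mult_right duhamel_integrable[OF n b le])
  also have "(\<lambda>s. complex_of_real (sgm (- T) k) * (complex_of_real (sgm (T - s) k) * n s k)) = ?g"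
    by (simp add: fun_eq_iff mult.assoc[symmetric] flip: of_real_mult sgm_add)
  finally have int: "integrable (leb T) ?g" .
  have "continuous_on {0..T} (\<lambda>t. complex_of_real (sgm t k) * integral {0..t} ?g)"
    by (intro continuous_intros indefinite_integral_continuous_1 integrable_on_lebesgue_on int)
      (auto simp: sgm_def intro!: continuous_intros)
  moreover have "complex_of_real (sgm t k) * integral {0..t} ?g = duhamel n t k" if t: "t \<in> {0..T}" for t
  proof -
    have "integrable (leb t) ?g"
      using integrable_subinterval[of 0 T ?g 0 t] int t by (simp add: integrable_restrict_space)
    then have "integral {0..t} ?g = (\<integral>s. ?g s \<partial>leb t)"
      by (simp add: lebesgue_integral_eq_integral)
    then have "complex_of_real (sgm t k) * integral {0..t} ?g = (\<integral>s. complex_of_real (sgm t k) * ?g s \<partial>leb t)"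
      by simp
    also have "(\<lambda>s. complex_of_real (sgm t k) * ?g s) = (\<lambda>s. complex_of_real (sgm (t - s) k) * n s k)"
      by (simp add: fun_eq_iff mult.assoc[symmetric] flip: of_real_mult sgm_add)
    finally show ?thesis by (simp add: duhamel_def)
  qed
  ultimately show ?thesis by (rule continuous_on_eq)
qed

lemma duhamel_diff:
  fixes n m :: "real \<Rightarrow> int \<times> int \<Rightarrow> complex"
  assumes "(\<lambda>s. n s k) \<in> borel_measurable (leb t)" "(\<lambda>s. m s k) \<in> borel_measurable (leb t)" "b < 1"
    and "AE s in leb t. cmod (n s k) \<le> C * s powr (- b)"
    and "AE s in leb t. cmod (m s k) \<le> D * s powr (- b)"
  shows "duhamel n t k - duhamel m t k = duhamel (\<lambda>s k. n s k - m s k) t k"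
  unfolding duhamel_def
  using duhamel_integrable[OF assms(1,3,4), of k] duhamel_integrable[OF assms(2,3,5), of k]
  by (simp add: right_diff_distrib)

subsection \<open>Picard iteration\<close>

lemma sgm_h1_le:
  assumes U: "l2_le U a" and t: "0 < t" "t \<le> 1"
  shows "h1_le (\<lambda>k. complex_of_real (sgm t k) * U k) (2 * a * t powr (- 1 / 4))"
proof -
  have "l2_le (\<lambda>k. complex_of_real (sqrt (kw k)) * (complex_of_real (sgm t k) * U k)) ((2 * t powr (- 1 / 4)) * a)"
  proof (rule l2_le_scale[OF U])
    show "cmod (complex_of_real (sqrt (kw k)) * (complex_of_real (sgm t k) * U k)) \<le> 2 * t powr (- 1 / 4) * cmod (U k)" for k
      using mult_right_mono[OF sqrt_kw_sgm_le[OF t, of k], of "cmod (U k)"] sgm_pos[of t k]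
      by (simp add: norm_mult less_imp_le mult.assoc)
  qed simp
  then show ?thesis by (simp add: h1_le_def mult_ac)
qed

locale advected_flux =
  fixes p b :: real and v :: "real \<Rightarrow> real \<times> real \<Rightarrow> real \<times> real"
  assumes p: "2 < p" "p < 3" and v: "adm_velocity v" and vb: "0 \<le> t \<Longrightarrow> L2normv (v t) \<le> b"
begin

definition beta :: real where "beta = (p - 1) / 4"

lemma beta: "1 / 4 < beta" "beta < 1 / 2" "beta < 1"
  using p by (auto simp: beta_def)

lemma b_nonneg: "0 \<le> b"
  using vb[of 0] by (simp add: L2normv_eq order_trans[OF L2norm_nonneg])

lemma L2v_v: "0 \<le> t \<Longrightarrow> L2v (v t)"
  using v by (simp add: adm_velocity_def)

definition nl :: "real \<Rightarrow> (real \<times> real \<Rightarrow> real \<times> real) \<Rightarrow> int \<times> int \<Rightarrow> complex" where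
  "nl s G k = nl_flux p G k + nl_adv (v s) G k"

text \<open>The Lipschitz constant of the nonlinearity on gradients of size at most
  \<open>R * s powr (-1/4)\<close>: flux plus advection.\<close>

definition Lip :: "real \<Rightarrow> real" where "Lip R = 16 * pi * (1 + R) + b"

lemma Lip_nonneg: "0 \<le> R \<Longrightarrow> 0 \<le> Lip R"
  using b_nonneg by (simp add: Lip_def)

lemma nonlinearity_diff_le:
  assumes s: "0 < s" "s \<le> 1" and R: "0 \<le> R" and D: "0 \<le> D"
    and G: "L2v G" "L2normv G \<le> R * s powr (- 1 / 4)" and H: "L2v H" "L2normv H \<le> R * s powr (- 1 / 4)"
    and GH: "L2normv (\<lambda>x. G x - H x) \<le> D * s powr (- 1 / 4)"
  shows "cmod (nl_flux p G k - nl_flux p H k) \<le> (16 * pi * (1 + R) * D) * sqrt (kw k) * s powr (- beta)"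
    and "cmod (nl_adv (v s) G k - nl_adv (v s) H k) \<le> (b * D) * sqrt (kw k) * s powr (- beta)"
    and "cmod (nl s G k - nl s H k) \<le> (Lip R * D) * sqrt (kw k) * s powr (- beta)"
proof -
  have "cmod (nl_flux p G k - nl_flux p H k)
      \<le> 16 * pi * (1 + R) * sqrt (kw k) * (s powr (- 1 / 4)) powr (p - 2) * L2normv (\<lambda>x. G x - H x)"
    using nl_flux_diff_le[OF p _ R G H] s by simp
  also have "\<dots> \<le> 16 * pi * (1 + R) * sqrt (kw k) * (s powr (- 1 / 4)) powr (p - 2) * (D * s powr (- 1 / 4))"
    using R by (intro mult_left_mono GH) (auto simp: less_imp_le)
  also have "\<dots> = (16 * pi * (1 + R) * D) * sqrt (kw k) * ((s powr (- 1 / 4)) powr (p - 2) * s powr (- 1 / 4))"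
    by simp
  also have "(s powr (- 1 / 4)) powr (p - 2) * s powr (- 1 / 4) = s powr (- beta)"
  proof -
    have "- 1 / 4 * (p - 2) + - 1 / 4 = - beta" by (simp add: beta_def field_simps)
    then show ?thesis by (simp only: powr_powr powr_add[symmetric])
  qed
  finally show 1: "cmod (nl_flux p G k - nl_flux p H k) \<le> (16 * pi * (1 + R) * D) * sqrt (kw k) * s powr (- beta)" .
  have "cmod (nl_adv (v s) G k - nl_adv (v s) H k) \<le> L2normv (v s) * L2normv (\<lambda>x. G x - H x)"
    using s by (intro nl_adv_diff_le L2v_v G H) auto
  also have "\<dots> \<le> b * (D * s powr (- 1 / 4))"
    using s b_nonneg by (intro mult_mono vb GH) (auto simp: L2normv_eq)
  also have "\<dots> \<le> b * (D * (sqrt (kw k) * s powr (- beta)))"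
  proof -
    \<comment> \<open>Advection is the less singular term: for \<open>s \<le> 1\<close> and
      \<open>\<beta> > 1/4\<close> it fits under the power of the flux.\<close>
    have "s powr (- 1 / 4) \<le> s powr (- beta)" using s beta by (intro powr_mono') auto
    then have "1 * s powr (- 1 / 4) \<le> sqrt (kw k) * s powr (- beta)"
      by (intro mult_mono) (auto simp: kw_ge_1 less_imp_le)
    then show ?thesis using b_nonneg D by (intro mult_left_mono) auto
  qed
  finally show 2: "cmod (nl_adv (v s) G k - nl_adv (v s) H k) \<le> (b * D) * sqrt (kw k) * s powr (- beta)"
    by (simp add: mult_ac)
  have "nl s G k - nl s H k = (nl_flux p G k - nl_flux p H k) + (nl_adv (v s) G k - nl_adv (v s) H k)"
    by (simp add: nl_def)
  then have "cmod (nl s G k - nl s H k)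
      \<le> cmod (nl_flux p G k - nl_flux p H k) + cmod (nl_adv (v s) G k - nl_adv (v s) H k)"
    by (metis norm_triangle_ineq)
  with 1 2 show "cmod (nl s G k - nl s H k) \<le> (Lip R * D) * sqrt (kw k) * s powr (- beta)"
    by (simp add: Lip_def algebra_simps)
qed

lemma nl_zero: "nl_flux p (\<lambda>x. 0) k = 0" "nl_adv V (\<lambda>x. 0) k = 0" "nl s (\<lambda>x. 0) k = 0"
  by (simp_all add: nl_def nl_flux_def nl_adv_def fc_eq)

lemma nonlinearity_le:
  assumes s: "0 < s" "s \<le> 1" and R: "0 \<le> R" and G: "L2v G" "L2normv G \<le> R * s powr (- 1 / 4)"
  shows "cmod (nl_flux p G k) \<le> (Lip R * R) * sqrt (kw k) * s powr (- beta)"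
    and "cmod (nl_adv (v s) G k) \<le> (Lip R * R) * sqrt (kw k) * s powr (- beta)"
    and "cmod (nl s G k) \<le> (Lip R * R) * sqrt (kw k) * s powr (- beta)"
proof -
  have H: "L2v (\<lambda>x. 0)" "L2normv (\<lambda>x. 0) \<le> R * s powr (- 1 / 4)"
    using R L2v_0 by (simp_all add: L2normv_def)
  note * = nonlinearity_diff_le[OF s R R G H, unfolded nl_zero diff_zero, OF G(2), of k]
  have w: "0 \<le> sqrt (kw k) * s powr (- beta)" by (simp add: less_imp_le)
  have "(16 * pi * (1 + R) * R) * (sqrt (kw k) * s powr (- beta)) \<le> (Lip R * R) * (sqrt (kw k) * s powr (- beta))"
    using R b_nonneg by (intro mult_right_mono w) (auto simp: Lip_def)
  with *(1) show "cmod (nl_flux p G k) \<le> (Lip R * R) * sqrt (kw k) * s powr (- beta)" by (simp add: mult.assoc)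
  have "(b * R) * (sqrt (kw k) * s powr (- beta)) \<le> (Lip R * R) * (sqrt (kw k) * s powr (- beta))"
    using R by (intro mult_right_mono w) (auto simp: Lip_def)
  with *(2) show "cmod (nl_adv (v s) G k) \<le> (Lip R * R) * sqrt (kw k) * s powr (- beta)" by (simp add: mult.assoc)
  show "cmod (nl s G k) \<le> (Lip R * R) * sqrt (kw k) * s powr (- beta)" by (rule *(3))
qed

text \<open>The ball of radius \<open>M\<close> in the weighted \<open>H1\<close> norm. Time 0 is
  left out because the weight gives no \<open>H1\<close> control there; extension by zero makes
  measurability a statement about the whole line.\<close>

definition state :: "real \<Rightarrow> real \<Rightarrow> (real \<Rightarrow> int \<times> int \<Rightarrow> complex) \<Rightarrow> bool" where
  "state T M c \<longleftrightarrow> (\<forall>k. (\<lambda>t. c t k) \<in> borel_measurable borel) \<and>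
     (\<forall>t. 0 < t \<longrightarrow> t \<le> T \<longrightarrow> h1_le (c t) (M * t powr (- 1 / 4))) \<and>
     (\<forall>t. \<not> (0 < t \<and> t \<le> T) \<longrightarrow> c t = (\<lambda>k. 0))"

lemma state_measurable: "state T M c \<Longrightarrow> (\<lambda>t. c t k) \<in> borel_measurable borel"
  by (simp add: state_def)

lemma state_h1: "state T M c \<Longrightarrow> 0 < t \<Longrightarrow> t \<le> T \<Longrightarrow> h1_le (c t) (M * t powr (- 1 / 4))"
  by (simp add: state_def)

lemma state_ex_h1:
  assumes "state T M c" shows "h1_le (c t) (if 0 < t \<and> t \<le> T then M * t powr (- 1 / 4) else 0)"
  using assms h1_le_0[of 0] by (auto simp: state_def)

lemma state_nl_measurable:
  assumes "state T M c"
  shows "(\<lambda>s. nl_flux p (Gr (c s)) k) \<in> borel_measurable (leb t)"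
    and "(\<lambda>s. nl_adv (v s) (Gr (c s)) k) \<in> borel_measurable (leb t)"
    and "(\<lambda>s. nl s (Gr (c s)) k) \<in> borel_measurable (leb t)"
proof -
  have c: "(\<lambda>s. c s k) \<in> borel_measurable (leb t)" for k
    by (rule borel_measurable_lebesgue_on[OF state_measurable[OF assms]])
  show 1: "(\<lambda>s. nl_flux p (Gr (c s)) k) \<in> borel_measurable (leb t)"
    by (rule nl_flux_measurable[OF c])
  have vm: "(\<lambda>s. fc (\<lambda>x. fst (v s x)) k) \<in> borel_measurable (leb t)"
    "(\<lambda>s. fc (\<lambda>x. snd (v s x)) k) \<in> borel_measurable (leb t)" for k
    using v unfolding adm_velocity_def by (auto intro: measurable_restrict_mono[of _ lebesgue "{0..}"])
  show 2: "(\<lambda>s. nl_adv (v s) (Gr (c s)) k) \<in> borel_measurable (leb t)"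
    by (rule nl_adv_measurable[OF _ vm state_ex_h1[OF assms] c]) (simp add: L2v_v)
  show "(\<lambda>s. nl s (Gr (c s)) k) \<in> borel_measurable (leb t)"
    using 1 2 by (simp add: nl_def)
qed

lemma state_Gr:
  assumes "state T M c" "0 < s" "s \<le> T"
  shows "L2v (Gr (c s))" "L2normv (Gr (c s)) \<le> (4 * pi * M) * s powr (- 1 / 4)"
  using L2v_Gr[OF state_h1[OF assms]] L2normv_Gr_le[OF state_h1[OF assms]] by (auto simp: mult.assoc)

lemma state_nl_le:
  assumes c: "state T M c" and T: "T \<le> 1" "t \<le> T" and M: "0 \<le> M"
  shows "AE s in leb t. \<forall>k. cmod (nl_flux p (Gr (c s)) k) \<le> (Lip (4 * pi * M) * (4 * pi * M)) * sqrt (kw k) * s powr (- beta)"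
    and "AE s in leb t. \<forall>k. cmod (nl_adv (v s) (Gr (c s)) k) \<le> (Lip (4 * pi * M) * (4 * pi * M)) * sqrt (kw k) * s powr (- beta)"
    and "AE s in leb t. \<forall>k. cmod (nl s (Gr (c s)) k) \<le> (Lip (4 * pi * M) * (4 * pi * M)) * sqrt (kw k) * s powr (- beta)"
proof -
  have s: "0 < s \<and> s \<le> t \<and> s \<noteq> t \<Longrightarrow> 0 < s \<and> s \<le> 1 \<and> L2v (Gr (c s)) \<and> L2normv (Gr (c s)) \<le> (4 * pi * M) * s powr (- 1 / 4)" for s
    using state_Gr[OF c, of s] T by auto
  have M': "0 \<le> 4 * pi * M" using M by simp
  show "AE s in leb t. \<forall>k. cmod (nl_flux p (Gr (c s)) k) \<le> (Lip (4 * pi * M) * (4 * pi * M)) * sqrt (kw k) * s powr (- beta)"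
    using AE_lebesgue_on_Icc_pos[of t]
  proof eventually_elim
    case (elim s)
    show ?case using s[OF elim] nonlinearity_le(1)[of s "4 * pi * M" "Gr (c s)"] M' by blast
  qed
  show "AE s in leb t. \<forall>k. cmod (nl_adv (v s) (Gr (c s)) k) \<le> (Lip (4 * pi * M) * (4 * pi * M)) * sqrt (kw k) * s powr (- beta)"
    using AE_lebesgue_on_Icc_pos[of t]
  proof eventually_elim
    case (elim s)
    show ?case using s[OF elim] nonlinearity_le(2)[of s "4 * pi * M" "Gr (c s)"] M' by blast
  qed
  show "AE s in leb t. \<forall>k. cmod (nl s (Gr (c s)) k) \<le> (Lip (4 * pi * M) * (4 * pi * M)) * sqrt (kw k) * s powr (- beta)"
    using AE_lebesgue_on_Icc_pos[of t]
  proof eventually_elim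
    case (elim s)
    show ?case using s[OF elim] nonlinearity_le(3)[of s "4 * pi * M" "Gr (c s)"] M' by blast
  qed
qed

lemma state_nl_le_k:
  assumes c: "state T M c" and T: "T \<le> 1" "t \<le> T" and M: "0 \<le> M"
  shows "AE s in leb t. cmod (nl s (Gr (c s)) k) \<le> (Lip (4 * pi * M) * (4 * pi * M) * sqrt (kw k)) * s powr (- beta)"
  using state_nl_le(3)[OF assms] by eventually_elim blast

abbreviation duh :: "(real \<Rightarrow> int \<times> int \<Rightarrow> complex) \<Rightarrow> real \<Rightarrow> int \<times> int \<Rightarrow> complex" where
  "duh c \<equiv> duhamel (\<lambda>s. nl s (Gr (c s)))"

text \<open>The Lipschitz constant of the Duhamel operator on \<open>state T M\<close>. The factors
  \<open>4 * pi\<close> convert coefficient bounds into gradient bounds, and the last factor tends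
  to 0 with \<open>T\<close> because \<open>beta < 1/2\<close>.\<close>

definition contr :: "real \<Rightarrow> real \<Rightarrow> real" where
  "contr T M = Lip (4 * pi * M) * (4 * pi) * kernel_const * Beta (1 - beta) (beta - 1 / 4) * T powr (1 / 2 - beta)"

lemma Beta_factor_nonneg: "0 \<le> Beta (1 - beta) (beta - 1 / 4)"
  using beta by (simp add: Beta_def)

lemma duh_contraction:
  assumes c: "state T M c" and d: "state T M d" and T: "T \<le> 1" and M: "0 \<le> M" and D: "0 \<le> D"
    and cd: "\<And>s. 0 < s \<Longrightarrow> s \<le> T \<Longrightarrow> h1_le (\<lambda>k. c s k - d s k) (D * s powr (- 1 / 4))"
    and t: "0 < t" "t \<le> T"
  shows "h1_le (\<lambda>k. duh c t k - duh d t k) (contr T M * D * t powr (- 1 / 4))"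
proof -
  let ?n = "\<lambda>s k. nl s (Gr (c s)) k - nl s (Gr (d s)) k"
  have t1: "t \<le> 1" using t T by simp
  have M': "0 \<le> 4 * pi * M" using M by simp
  have eq: "duh c t k - duh d t k = duhamel ?n t k" for k
    by (rule duhamel_diff[OF state_nl_measurable(3)[OF c] state_nl_measurable(3)[OF d] beta(3)
          state_nl_le_k[OF c T t(2) M] state_nl_le_k[OF d T t(2) M]])
  \<comment> \<open>The general estimate with weight parameter 0: the only smallness is
    \<open>T powr (1 / 2 - beta)\<close>.\<close>
  have "h1_le (duhamel ?n t) ((Lip (4 * pi * M) * (4 * pi * D)) * kernel_const * Beta (1 - beta) (beta - 1 / 4) * T powr (1 / 2 - beta) * t powr (- 1 / 4) * exp (0 * t))"
    unfolding duhamel_def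
  proof (rule h1_leI, rule duhamel_bound[OF t(1) t1 beta(1,2)])
    show "(\<lambda>s. ?n s k) \<in> borel_measurable (leb t)" for k
      using state_nl_measurable(3)[OF c] state_nl_measurable(3)[OF d] by measurable
    show "AE s in leb t. \<forall>k. cmod (?n s k) \<le> (Lip (4 * pi * M) * (4 * pi * D)) * sqrt (kw k) * s powr (- beta) * exp (0 * s)"
      using AE_lebesgue_on_Icc_pos[of t]
    proof eventually_elim
      case (elim s)
      then have s: "0 < s" "s \<le> T" "s \<le> 1" using t T by auto
      show ?case
      proof
        fix k
        have "L2normv (\<lambda>x. Gr (c s) x - Gr (d s) x) \<le> (4 * pi * D) * s powr (- 1 / 4)"
          using L2normv_Gr_diff_le[OF state_h1[OF c s(1,2)] state_h1[OF d s(1,2)] cd[OF s(1,2)]] by (simp add: mult.assoc)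
        from nonlinearity_diff_le(3)[OF s(1,3) M' _ state_Gr[OF c s(1,2)] state_Gr[OF d s(1,2)] this, of k] D
        show "cmod (?n s k) \<le> (Lip (4 * pi * M) * (4 * pi * D)) * sqrt (kw k) * s powr (- beta) * exp (0 * s)" by simp
      qed
    qed
    show "exp (- (0 * s)) * s powr (1 / 2 - beta) \<le> T powr (1 / 2 - beta)" if "0 < s" "s \<le> t" for s
      using that t beta by (simp add: powr_mono2)
    show "0 \<le> Lip (4 * pi * M) * (4 * pi * D)" using Lip_nonneg[OF M'] D by simp
  qed auto
  then show ?thesis by (simp add: eq contr_def mult_ac)
qed

lemma nl_Gr_0: "nl s (Gr (\<lambda>k. 0)) k = 0"
  using nl_zero(3) by (simp add: Gr_0)

lemma state_0: "0 \<le> M \<Longrightarrow> state T M (\<lambda>t k. 0)"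
  by (auto simp: state_def intro: h1_le_0)

lemma duh_h1_le:
  assumes c: "state T M c" and T: "T \<le> 1" and M: "0 \<le> M" and t: "0 < t" "t \<le> T"
  shows "h1_le (duh c t) (contr T M * M * t powr (- 1 / 4))"
proof -
  have z: "duh (\<lambda>t k. 0) t k = 0" for k by (simp add: nl_Gr_0 duhamel_def)
  show ?thesis using duh_contraction[OF c state_0[OF M] T M M _ t] state_h1[OF c] by (simp add: z)
qed

lemma duh_continuous:
  assumes c: "state T M c" and T: "T \<le> 1" and M: "0 \<le> M"
  shows "continuous_on {0..T} (\<lambda>t. duh c t k)"
  by (rule duhamel_continuous[OF state_nl_measurable(3)[OF c] beta(3) state_nl_le_k[OF c T order_refl M]])

definition Phi :: "real \<Rightarrow> (int \<times> int \<Rightarrow> complex) \<Rightarrow> (real \<Rightarrow> int \<times> int \<Rightarrow> complex) \<Rightarrow> real \<Rightarrow> int \<times> int \<Rightarrow> complex" where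
  "Phi T U c t k = (if 0 < t \<and> t \<le> T then complex_of_real (sgm t k) * U k - duh c t k else 0)"

lemma Phi_continuous:
  assumes c: "state T M c" and T: "T \<le> 1" and M: "0 \<le> M"
  shows "continuous_on {0..T} (\<lambda>t. complex_of_real (sgm t k) * U k - duh c t k)"
  by (intro continuous_intros duh_continuous[OF assms]) (auto simp: sgm_def intro!: continuous_intros)

text \<open>The free evolution contributes at most \<open>2 * a\<close>, which is half the radius by
  \<open>4 * a \<le> M\<close>; the Duhamel term contributes at most the other half.\<close>

lemma state_Phi:
  assumes c: "state T M c" and T: "T \<le> 1" and U: "l2_le U a" and M: "4 * a \<le> M" and contr: "contr T M \<le> 1 / 2"
  shows "state T M (Phi T U c)"
  unfolding state_def
proof (intro conjI allI impI)
  have a: "0 \<le> a" by (rule l2_le_nonneg[OF U])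
  with M have M0: "0 \<le> M" by simp
  show "(\<lambda>t. Phi T U c t k) \<in> borel_measurable borel" for k
  proof -
    have "continuous_on {0<..T} (\<lambda>t. complex_of_real (sgm t k) * U k - duh c t k)"
      by (rule continuous_on_subset[OF Phi_continuous[OF c T M0]]) auto
    then have "(\<lambda>t. if t \<in> {0<..T} then complex_of_real (sgm t k) * U k - duh c t k else 0) \<in> borel_measurable borel"
      by (rule borel_measurable_continuous_on_if[rotated]) auto
    then show ?thesis by (simp add: Phi_def)
  qed
  show "h1_le (Phi T U c t) (M * t powr (- 1 / 4))" if t: "0 < t" "t \<le> T" for t
  proof -
    have "h1_le (\<lambda>k. complex_of_real (sgm t k) * U k - duh c t k) (2 * a * t powr (- 1 / 4) + contr T M * M * t powr (- 1 / 4))"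
      using t T by (intro h1_le_diff sgm_h1_le U duh_h1_le[OF c T M0]) auto
    moreover have "2 * a * t powr (- 1 / 4) + contr T M * M * t powr (- 1 / 4) = (2 * a + contr T M * M) * t powr (- 1 / 4)"
      by (simp add: algebra_simps)
    moreover have "(2 * a + contr T M * M) * t powr (- 1 / 4) \<le> M * t powr (- 1 / 4)"
      using mult_right_mono[OF contr M0] M by (intro mult_right_mono) auto
    ultimately show ?thesis using t by (simp add: Phi_def[abs_def] h1_le_weaken)
  qed
  show "Phi T U c t = (\<lambda>k. 0)" if "\<not> (0 < t \<and> t \<le> T)" for t
    using that by (auto simp: Phi_def fun_eq_iff)
qed

lemma fixed_point_exists:
  assumes T: "0 < T" "T \<le> 1" and U: "l2_le U a" and M: "4 * a \<le> M" and contr: "contr T M \<le> 1 / 2"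
  shows "\<exists>c. state T M c \<and> Phi T U c = c"
proof -
  have M0: "0 \<le> M" using M l2_le_nonneg[OF U] by simp
  define C where "C n = (Phi T U ^^ n) (\<lambda>t k. 0)" for n
  have CS: "C (Suc n) = Phi T U (C n)" for n by (simp add: C_def)
  have st: "state T M (C n)" for n
  proof (induction n)
    case 0 show ?case using state_0[OF M0] by (simp add: C_def)
  next
    case (Suc n) then show ?case unfolding CS by (rule state_Phi[OF _ T(2) U M contr])
  qed
  have Phi_diff: "h1_le (\<lambda>k. Phi T U c t k - Phi T U d t k) (D / 2 * t powr (- 1 / 4))"
    if "state T M c" "state T M d" "0 \<le> D" "0 < t" "t \<le> T"
      "\<And>s. 0 < s \<Longrightarrow> s \<le> T \<Longrightarrow> h1_le (\<lambda>k. c s k - d s k) (D * s powr (- 1 / 4))" for c d D t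
  proof -
    have "h1_le (\<lambda>k. duh c t k - duh d t k) (contr T M * D * t powr (- 1 / 4))"
      by (rule duh_contraction) (use that T M0 in auto)
    then have "h1_le (\<lambda>k. - (duh c t k - duh d t k)) (contr T M * D * t powr (- 1 / 4))"
      by (subst h1_le_uminus)
    also have "(\<lambda>k. - (duh c t k - duh d t k)) = (\<lambda>k. Phi T U c t k - Phi T U d t k)"
      using that by (simp add: Phi_def fun_eq_iff)
    finally show ?thesis
    proof (rule h1_le_weaken)
      show "contr T M * D * t powr (- 1 / 4) \<le> D / 2 * t powr (- 1 / 4)"
        using mult_right_mono[OF contr \<open>0 \<le> D\<close>] by (intro mult_right_mono) auto
    qed
  qed
  have step: "h1_le (\<lambda>k. C (Suc n) t k - C n t k) (M * (1 / 2) ^ n * t powr (- 1 / 4))" if "0 < t" "t \<le> T" for n t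
    using that
  proof (induction n arbitrary: t)
    case 0
    then show ?case using state_h1[OF st[of 1], of t] by (simp add: C_def)
  next
    case (Suc n)
    have "h1_le (\<lambda>k. Phi T U (C (Suc n)) t k - Phi T U (C n) t k) ((M * (1 / 2) ^ n) / 2 * t powr (- 1 / 4))"
      by (rule Phi_diff[OF st st _ Suc.prems Suc.IH]) (use M0 in auto)
    also have "(\<lambda>k. Phi T U (C (Suc n)) t k - Phi T U (C n) t k) = (\<lambda>k. C (Suc (Suc n)) t k - C (Suc n) t k)"
      by (simp only: CS)
    finally show ?case by (simp add: mult.assoc)
  qed
  \<comment> \<open>The factor \<open>1 - (1 / 2) ^ m\<close> is the exact partial sum of the
    geometric series; with the limiting constant alone the induction on \<open>m\<close> would not
    close.\<close>
  have tail: "h1_le (\<lambda>k. C (n + m) t k - C n t k) ((2 * M * (1 / 2) ^ n) * (1 - (1 / 2) ^ m) * t powr (- 1 / 4))"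
    if t: "0 < t" "t \<le> T" for n m t
  proof (induction m)
    case 0 show ?case using h1_le_0[of 0] by simp
  next
    case (Suc m)
    have "h1_le (\<lambda>k. (C (n + m) t k - C n t k) + (C (Suc (n + m)) t k - C (n + m) t k))
        ((2 * M * (1 / 2) ^ n) * (1 - (1 / 2) ^ m) * t powr (- 1 / 4) + M * (1 / 2) ^ (n + m) * t powr (- 1 / 4))"
      by (intro h1_le_add Suc.IH step t)
    then show ?case by (simp add: algebra_simps power_add)
  qed
  \<comment> \<open>The limit is taken mode by mode, which keeps measurability in time; the
    \<open>H1\<close> bounds survive by lower semicontinuity, \<open>h1_le_LIMSEQ\<close>.\<close>
  define c where "c t k = lim (\<lambda>n. C n t k)" for t k
  have conv: "(\<lambda>n. C n t k) \<longlonglongrightarrow> c t k" for t k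
  proof (cases "0 < t \<and> t \<le> T")
    case True
    have le: "cmod (C (Suc n) t k - C n t k) \<le> M * t powr (- 1 / 4) * (1 / 2) ^ n" for n
      using l2_le_norm[OF h1_le_imp_l2_le[OF step[of t n]], of k] True by (simp add: mult_ac)
    have "summable (\<lambda>n. C (Suc n) t k - C n t k)"
      by (rule summable_comparison_test'[where g = "\<lambda>n. M * t powr (- 1 / 4) * (1 / 2) ^ n" and N = 0])
        (use le in \<open>auto intro!: summable_mult summable_geometric\<close>)
    then have "convergent (\<lambda>n. C n t k - C 0 t k)"
      by (simp add: summable_iff_convergent sum_lessThan_telescope[of "\<lambda>i. C i t k"])
    then have "convergent (\<lambda>n. C n t k - C 0 t k + C 0 t k)"
      by (intro convergent_add convergent_const)
    then show ?thesis by (simp add: c_def convergent_LIMSEQ_iff)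
  next
    case False
    then have "C n t k = 0" for n using st[of n] by (auto simp: state_def)
    then show ?thesis by (simp add: c_def)
  qed
  have state_c: "state T M c"
    unfolding state_def
  proof (intro conjI allI impI)
    show "(\<lambda>t. c t k) \<in> borel_measurable borel" for k
      by (rule borel_measurable_LIMSEQ_metric[OF state_measurable[OF st] conv])
    show "h1_le (c t) (M * t powr (- 1 / 4))" if "0 < t" "t \<le> T" for t
      by (rule h1_le_LIMSEQ[OF state_h1[OF st that] conv tendsto_const])
    show "c t = (\<lambda>k. 0)" if "\<not> (0 < t \<and> t \<le> T)" for t
      using st that by (auto simp: c_def state_def)
  qed
  have near: "h1_le (\<lambda>k. c t k - C n t k) ((2 * M * (1 / 2) ^ n) * t powr (- 1 / 4))" if t: "0 < t" "t \<le> T" for n t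
  proof (rule h1_le_LIMSEQ[OF tail[OF t, of n]])
    show "(\<lambda>m. C (n + m) t k - C n t k) \<longlonglongrightarrow> c t k - C n t k" for k
      using tendsto_diff[OF LIMSEQ_ignore_initial_segment[OF conv[of t k], of n] tendsto_const[of "C n t k"]]
      by (simp add: add.commute)
    have "(\<lambda>m. (2 * M * (1 / 2) ^ n) * (1 - (1 / 2) ^ m) * t powr (- 1 / 4)) \<longlonglongrightarrow> (2 * M * (1 / 2) ^ n) * (1 - 0) * t powr (- 1 / 4)"
      by (intro tendsto_intros LIMSEQ_power_zero) auto
    then show "(\<lambda>m. (2 * M * (1 / 2) ^ n) * (1 - (1 / 2) ^ m) * t powr (- 1 / 4)) \<longlonglongrightarrow> (2 * M * (1 / 2) ^ n) * t powr (- 1 / 4)"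
      by simp
  qed
  have "Phi T U c t k = c t k" for t k
  proof (cases "0 < t \<and> t \<le> T")
    case True
    \<comment> \<open>The next iterate tends both to \<open>Phi T U c\<close>, by this contraction
      estimate, and to \<open>c\<close>.\<close>
    have le: "cmod (Phi T U c t k - C (Suc n) t k) \<le> M * t powr (- 1 / 4) * (1 / 2) ^ n" for n
    proof -
      have "h1_le (\<lambda>k. Phi T U c t k - Phi T U (C n) t k) ((2 * M * (1 / 2) ^ n) / 2 * t powr (- 1 / 4))"
        by (rule Phi_diff[OF state_c st]) (use M0 True near in auto)
      from l2_le_norm[OF h1_le_imp_l2_le[OF this], of k] show ?thesis by (simp add: CS mult_ac)
    qed
    have "(\<lambda>n. M * t powr (- 1 / 4) * (1 / 2) ^ n) \<longlonglongrightarrow> M * t powr (- 1 / 4) * 0"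
      by (intro tendsto_intros LIMSEQ_power_zero) auto
    then have z: "(\<lambda>n. M * t powr (- 1 / 4) * (1 / 2) ^ n) \<longlonglongrightarrow> 0" by simp
    have "(\<lambda>n. Phi T U c t k - C (Suc n) t k) \<longlonglongrightarrow> 0"
      using le by (intro Lim_null_comparison[OF _ z] always_eventually allI)
    moreover have "(\<lambda>n. Phi T U c t k - C (Suc n) t k) \<longlonglongrightarrow> Phi T U c t k - c t k"
      by (rule tendsto_diff[OF tendsto_const LIMSEQ_Suc[OF conv]])
    ultimately have "0 = Phi T U c t k - c t k" by (rule LIMSEQ_unique)
    then show ?thesis by simp
  next
    case False
    then show ?thesis using state_c by (auto simp: Phi_def state_def)
  qed
  then have "Phi T U c = c" by blast
  with state_c show ?thesis by blast
qed

end

subsection \<open>Continuity in time and joint integrability\<close>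

lemma l2_le_split:
  assumes tail: "\<And>K. finite K \<Longrightarrow> K \<inter> kbox n = {} \<Longrightarrow> l2n d K \<le> e"
  shows "l2_le d (l2n d (kbox n) + e)"
proof (rule l2_leI)
  fix K :: "(int \<times> int) set" assume K: "finite K"
  let ?f = "\<lambda>k. (cmod (d k))\<^sup>2"
  have "sum ?f K = sum ?f (K \<inter> kbox n) + sum ?f (K - kbox n)"
    using K by (metis add.commute sum.Int_Diff)
  then have "l2n d K \<le> sqrt (sum ?f (K \<inter> kbox n)) + sqrt (sum ?f (K - kbox n))"
    unfolding L2_set_def by (simp add: sqrt_add_le_add_sqrt sum_nonneg)
  also have "sqrt (sum ?f (K \<inter> kbox n)) \<le> l2n d (kbox n)"
    unfolding L2_set_def by (intro real_sqrt_le_mono sum_mono2) auto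
  also have "sqrt (sum ?f (K - kbox n)) \<le> e"
    using tail[of "K - kbox n"] K by (auto simp: L2_set_def)
  finally show "l2n d K \<le> l2n d (kbox n) + e" by simp
qed

text \<open>Compactness criterion: convergence of each mode gives norm convergence once the tails
  outside one box are uniformly small.\<close>

lemma eventually_l2_le:
  assumes lim: "\<And>k. ((\<lambda>s. d s k) \<longlongrightarrow> 0) F" and e: "0 < e"
    and tail: "\<forall>\<^sub>F s in F. \<forall>K. finite K \<longrightarrow> K \<inter> kbox n = {} \<longrightarrow> l2n (d s) K \<le> e / 2"
  shows "\<forall>\<^sub>F s in F. l2_le (d s) e"
proof -
  have "((\<lambda>s. l2n (d s) (kbox n)) \<longlongrightarrow> sqrt (\<Sum>k\<in>kbox n. (cmod 0)\<^sup>2)) F"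
    unfolding L2_set_def by (intro tendsto_intros lim)
  then have "((\<lambda>s. l2n (d s) (kbox n)) \<longlongrightarrow> 0) F" by simp
  then have "\<forall>\<^sub>F s in F. l2n (d s) (kbox n) < e / 2"
    using e by (intro order_tendstoD(2)) auto
  with tail show ?thesis
  proof eventually_elim
    case (elim s)
    have "l2_le (d s) (l2n (d s) (kbox n) + e / 2)"
      by (rule l2_le_split) (use elim in blast)
    then show ?case by (rule l2_le_weaken) (use elim in simp)
  qed
qed

lemma kw_outside_kbox:
  assumes "k \<notin> kbox n" shows "real n \<le> sqrt (kw k)"
proof -
  have "int n < \<bar>fst k\<bar> \<or> int n < \<bar>snd k\<bar>" using assms by (cases k) (auto simp: kbox_def)
  then have "real n \<le> \<bar>of_int (fst k)\<bar> \<or> real n \<le> \<bar>of_int (snd k)\<bar>" by linarith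
  then show ?thesis using abs_fst_le_sqrt_kw[of k] abs_snd_le_sqrt_kw[of k] by linarith
qed

lemma h1_le_tail:
  assumes d: "h1_le d R" and n: "0 < n" and K: "finite K" "K \<inter> kbox n = {}"
  shows "l2n d K \<le> R / real n"
proof -
  have "real n * l2n d K = L2_set (\<lambda>k. real n * cmod (d k)) K"
    by (simp add: L2_set_right_distrib)
  also have "\<dots> \<le> L2_set (\<lambda>k. sqrt (kw k) * cmod (d k)) K"
    using K(2) by (intro L2_set_mono mult_right_mono kw_outside_kbox) auto
  also have "\<dots> \<le> R" by (rule h1_leD[OF d K(1)])
  finally show ?thesis using n by (simp add: field_simps)
qed

lemma L2_set_le_of_kbox_tail:
  assumes tail: "\<And>m. n \<le> m \<Longrightarrow> (\<Sum>k\<in>kbox m - kbox n. (cmod (c k))\<^sup>2) \<le> e\<^sup>2" and e: "0 \<le> e"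
    and K: "finite K" "K \<inter> kbox n = {}"
  shows "l2n c K \<le> e"
proof -
  obtain m where m: "K \<subseteq> kbox m" using finite_subset_kbox[OF K(1)] .
  have "K \<subseteq> kbox (max m n) - kbox n" using m K(2) kbox_mono[of m "max m n"] by auto
  then have "(\<Sum>k\<in>K. (cmod (c k))\<^sup>2) \<le> (\<Sum>k\<in>kbox (max m n) - kbox n. (cmod (c k))\<^sup>2)"
    by (intro sum_mono2) auto
  also have "\<dots> \<le> e\<^sup>2" by (rule tail) simp
  finally show ?thesis unfolding L2_set_def using e by (simp add: real_le_lsqrt)
qed

text \<open>The initial datum has no \<open>H1\<close> bound to control tails. Its own
  \<open>l2\<close> tail serves instead, since \<open>sgm s k - 1\<close> has modulus at most
  1.\<close>

lemma sgm_tendsto_initial: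
  assumes U: "l2_le U a" and e: "0 < e"
  shows "\<forall>\<^sub>F s in at 0 within {0..T}. l2_le (\<lambda>k. complex_of_real (sgm s k) * U k - U k) e"
proof -
  obtain n where n: "\<And>m. n \<le> m \<Longrightarrow> (\<Sum>k\<in>kbox m - kbox n. (cmod (U k))\<^sup>2) \<le> (e / 2)\<^sup>2"
    using sum_kbox_tail_small[OF U, of "(e / 2)\<^sup>2"] e by auto
  show ?thesis
  proof (rule eventually_l2_le[OF _ e])
    fix k
    have "((\<lambda>s. complex_of_real (sgm s k) * U k - U k) \<longlongrightarrow> complex_of_real (sgm 0 k) * U k - U k) (at 0 within {0..T})"
      unfolding sgm_def by (intro tendsto_intros)
    then show "((\<lambda>s. complex_of_real (sgm s k) * U k - U k) \<longlongrightarrow> 0) (at 0 within {0..T})" by simp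
  next
    have "\<forall>\<^sub>F s in at 0 within {0..T}. 0 \<le> s" by (auto simp: eventually_at intro!: exI[of _ 1])
    then show "\<forall>\<^sub>F s in at 0 within {0..T}. \<forall>K. finite K \<longrightarrow> K \<inter> kbox n = {} \<longrightarrow>
        L2_set (\<lambda>k. cmod (complex_of_real (sgm s k) * U k - U k)) K \<le> e / 2"
    proof (eventually_elim, intro allI impI)
      fix s :: real and K :: "(int \<times> int) set"
      assume s: "0 \<le> s" and K: "finite K" "K \<inter> kbox n = {}"
      have "L2_set (\<lambda>k. cmod (complex_of_real (sgm s k) * U k - U k)) K \<le> l2n U K"
      proof (rule L2_set_mono)
        fix k
        have "complex_of_real (sgm s k) * U k - U k = complex_of_real (sgm s k - 1) * U k" by (simp add: algebra_simps)
        then have "cmod (complex_of_real (sgm s k) * U k - U k) = \<bar>sgm s k - 1\<bar> * cmod (U k)"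
          by (simp only: norm_mult norm_of_real)
        also have "\<dots> \<le> 1 * cmod (U k)"
          using sgm_pos[of s k] sgm_le_1[OF s, of k] by (intro mult_right_mono) auto
        finally show "cmod (complex_of_real (sgm s k) * U k - U k) \<le> cmod (U k)" by simp
      qed simp
      also have "\<dots> \<le> e / 2" by (rule L2_set_le_of_kbox_tail[OF n _ K]) (use e in auto)
      finally show "L2_set (\<lambda>k. cmod (complex_of_real (sgm s k) * U k - U k)) K \<le> e / 2" .
    qed
  qed
qed

text \<open>By Tonelli it suffices to bound the spatial \<open>L1\<close> norms, which the
  \<open>L2\<close> norms dominate on a space of mass 1.\<close>

lemma integrable_space_time:
  fixes g :: "real \<Rightarrow> real \<times> real \<Rightarrow> real \<times> real"
  assumes g: "(\<lambda>z. g (fst z) (snd z)) \<in> borel_measurable (borel \<Otimes>\<^sub>M borel)"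
    and L2v: "\<And>t. t \<in> {a..T} \<Longrightarrow> L2v (g t)" and B: "\<And>t. t \<in> {a..T} \<Longrightarrow> L2normv (g t) \<le> B"
  shows "integrable (lebesgue_on ({a..T} \<times> torus_sq)) (\<lambda>(t, x). g t x)"
proof -
  let ?h = "\<lambda>z. indicator ({a..T} \<times> torus_sq) z *\<^sub>R g (fst z) (snd z)"
  have gb: "(\<lambda>z. g (fst z) (snd z)) \<in> borel_measurable borel" using g by (simp add: borel_prod)
  have S: "{a..T} \<times> torus_sq \<in> sets borel" unfolding torus_sq_cbox by (intro borel_closed closed_Times) auto
  have hb: "?h \<in> borel_measurable borel"
    using gb S by measurable
  have gt: "g t \<in> borel_measurable borel" for t
    using measurable_compose[OF measurable_Pair1'[of t borel borel] g] by simp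
  have inner: "(\<integral>\<^sup>+x. ennreal (norm (?h (t, x))) \<partial>lborel) \<le> ennreal B * indicator {a..T} t" for t
  proof (cases "t \<in> {a..T}")
    case True
    have "(\<integral>\<^sup>+x. ennreal (norm (?h (t, x))) \<partial>lborel) = (\<integral>\<^sup>+x. ennreal (norm (g t x)) * indicator torus_sq x \<partial>lborel)"
      using True by (intro nn_integral_cong) (auto simp: indicator_def)
    also have "\<dots> = (\<integral>\<^sup>+x. ennreal (norm (g t x)) * indicator torus_sq x \<partial>lebesgue)"
      by (rule nn_integral_completion[symmetric])
    also have "\<dots> = (\<integral>\<^sup>+x. ennreal (norm (g t x)) \<partial>tor)"
      by (rule nn_integral_restrict_space[symmetric]) simp
    also have "\<dots> = ennreal (\<integral>x. norm (g t x) \<partial>tor)"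
      using L2_imp_L1[OF L2v_D(4)[OF L2v[OF True]]] by (intro nn_integral_eq_integral) (auto simp: L1_def)
    also have "\<dots> \<le> ennreal B"
      using integral_abs_le_L2norm[OF L2v_D(4)[OF L2v[OF True]]] B[OF True]
      by (intro ennreal_leI) (simp add: L2normv_eq)
    finally show ?thesis using True by simp
  next
    case False
    then have "indicator ({a..T} \<times> torus_sq) (t, x) = (0::real)" for x by (auto simp: indicator_def)
    then show ?thesis by simp
  qed
  have "integrable lborel ?h"
  proof (rule integrableI_bounded)
    show "?h \<in> borel_measurable lborel" using hb by simp
    have "(\<integral>\<^sup>+z. ennreal (norm (?h z)) \<partial>lborel) = (\<integral>\<^sup>+z. ennreal (norm (?h z)) \<partial>(lborel \<Otimes>\<^sub>M lborel))"
      by (simp only: lborel_prod)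
    also have "\<dots> = (\<integral>\<^sup>+t. \<integral>\<^sup>+x. ennreal (norm (?h (t, x))) \<partial>lborel \<partial>lborel)"
    proof (rule lborel.nn_integral_fst[symmetric])
      have "(\<lambda>z. ennreal (norm (?h z))) \<in> borel_measurable borel" using hb by measurable
      then show "(\<lambda>z. ennreal (norm (?h z))) \<in> borel_measurable (lborel \<Otimes>\<^sub>M lborel)"
        by (simp add: lborel_prod)
    qed
    also have "\<dots> \<le> (\<integral>\<^sup>+t. ennreal B * indicator {a..T} t \<partial>lborel)"
      by (intro nn_integral_mono inner)
    also have "\<dots> < \<infinity>"
      by (simp add: nn_integral_cmult_indicator ennreal_mult_less_top emeasure_lborel_Icc_eq)
    finally show "(\<integral>\<^sup>+z. ennreal (norm (?h z)) \<partial>lborel) < \<infinity>" .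
  qed
  then have "integrable lebesgue ?h" using hb by (simp add: integrable_completion)
  then show ?thesis using S by (subst integrable_restrict_space) (auto simp: case_prod_beta)
qed

text \<open>Preserving Hermitian symmetry makes the fixed point the coefficient family of a real
  function, so that \<open>fc_RF\<close> returns it unchanged.\<close>

lemma duhamel_uminus:
  assumes "\<And>s. n s (- k) = cnj (n s k)"
  shows "duhamel n t (- k) = cnj (duhamel n t k)"
  unfolding duhamel_def
  by (subst Bochner_Integration.integral_cnj[symmetric]) (simp add: assms sgm_uminus)

lemma nl_flux_uminus: "nl_flux p G (- k) = cnj (nl_flux p G k)"
  by (simp add: nl_flux_def fc_uminus algebra_simps)

lemma nl_adv_uminus: "nl_adv V G (- k) = cnj (nl_adv V G k)"
  by (simp add: nl_adv_def fc_uminus)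

context advected_flux
begin

subsection \<open>Existence\<close>

lemma mild_solution_exists:
  assumes T: "0 < T" "T \<le> 1" and u0: "L2 u0" and M: "4 * L2norm u0 \<le> M" and contr: "contr T M \<le> 1 / 2"
  shows "\<exists>u. mild_solution p v u0 T u \<and> S_T T u"
proof -
  define U where "U = fc u0"
  have U: "l2_le U (L2norm u0)" unfolding U_def by (rule Bessel[OF u0])
  have M0: "0 \<le> M" using M L2norm_nonneg[of u0] by linarith
  obtain c where c: "state T M c" and fixp: "Phi T U c = c"
    using fixed_point_exists[OF T U M contr] by blast
  \<comment> \<open>Agrees with the fixed point for positive times, but takes the value
    \<open>U\<close> at time 0, where a \<open>state\<close> is zero by convention.\<close>
  define f where "f t k = complex_of_real (sgm t k) * U k - duh c t k" for t k
  have f0: "f 0 = U" by (simp add: f_def duhamel_0 fun_eq_iff)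
  have fc_eq_c: "f t = c t" if "0 < t" "t \<le> T" for t
    using fun_cong[OF fixp, of t] that by (auto simp: Phi_def f_def fun_eq_iff)
  have sym: "f t (- k) = cnj (f t k)" for t k
  proof -
    have "duh c t (- k) = cnj (duh c t k)"
      by (rule duhamel_uminus) (simp add: nl_def nl_flux_uminus nl_adv_uminus)
    then show ?thesis by (simp add: f_def U_def fc_uminus sgm_uminus)
  qed
  have h1: "h1_le (f t) (M * t powr (- 1 / 4))" if "0 < t" "t \<le> T" for t
    using state_h1[OF c that] by (simp add: fc_eq_c[OF that])
  have l2: "\<exists>B. l2_le (f t) B" if "t \<in> {0..T}" for t
  proof (cases "t = 0")
    case True
    then show ?thesis using U f0 by auto
  next
    case False
    then show ?thesis using h1_le_imp_l2_le[OF h1[of t]] that by auto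
  qed
  define u where "u t = RF (f t)" for t
  have L2u: "L2 (u t)" if "t \<in> {0..T}" for t
    using l2[OF that] L2_RF unfolding u_def by blast
  have fcu: "fc (u t) k = f t k" if t: "t \<in> {0..T}" for t k
  proof -
    obtain B where B: "l2_le (f t) B" using l2[OF t] by blast
    show ?thesis by (simp add: u_def fc_RF[OF B] sym)
  qed
  have cont: "continuous_on {0..T} (\<lambda>t. f t k)" for k
    unfolding f_def by (rule Phi_continuous[OF c T(2) M0])
  have lim: "((\<lambda>s. f s k - f t k) \<longlongrightarrow> 0) (at t within {0..T})" if "t \<in> {0..T}" for t k
    using cont[of k] that by (simp add: continuous_on_def LIM_zero)
  define L where "L = Lip (4 * pi * M) * (4 * pi * M)"
  have L0: "0 \<le> L" unfolding L_def using Lip_nonneg[of "4 * pi * M"] M0 by simp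
  \<comment> \<open>At time 0 the free part is treated by the tail of the datum and the Duhamel part
    by its \<open>L2\<close> bound of order \<open>s powr (1 / 2 - beta)\<close>. At positive times
    the \<open>H1\<close> bound is uniform nearby and makes the tails small.\<close>
  have near: "\<forall>\<^sub>F s in at t within {0..T}. l2_le (\<lambda>k. f s k - f t k) e" if t: "t \<in> {0..T}" and e: "0 < e" for t e
  proof (cases "t = 0")
    case True
    define A where "A = L * kernel_const * Beta (1 - beta) (1 / 2)"
    have ev0: "\<forall>\<^sub>F s in at 0 within {0..T}. 0 < s \<and> s \<le> T"
      using T by (auto simp: eventually_at intro!: exI[of _ 1])
    have "((\<lambda>s. A * s powr (1 / 2 - beta)) \<longlongrightarrow> A * 0) (at 0 within {0..T})"
    proof (intro tendsto_mult tendsto_const)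
      show "((\<lambda>s. s powr (1 / 2 - beta)) \<longlongrightarrow> 0) (at 0 within {0..T})"
      proof -
        have "\<forall>\<^sub>F s in at 0 within {0..T}. 0 \<le> s" using ev0 by eventually_elim simp
        then show ?thesis
          using tendsto_powr'[of "\<lambda>s. s" 0 "at 0 within {0..T}" "\<lambda>s. 1 / 2 - beta" "1 / 2 - beta"] beta
          by (simp add: tendsto_ident_at)
      qed
    qed
    then have "\<forall>\<^sub>F s in at 0 within {0..T}. A * s powr (1 / 2 - beta) < e / 2"
      using e by (intro order_tendstoD(2)) auto
    moreover have "\<forall>\<^sub>F s in at 0 within {0..T}. l2_le (\<lambda>k. complex_of_real (sgm s k) * U k - U k) (e / 2)"
      using e by (intro sgm_tendsto_initial[OF U]) auto
    ultimately have "\<forall>\<^sub>F s in at 0 within {0..T}. l2_le (\<lambda>k. f s k - f 0 k) e"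
      using ev0
    proof eventually_elim
      case (elim s)
      have "l2_le (duh c s) (A * s powr (1 / 2 - beta))"
        unfolding duhamel_def A_def L_def
        by (intro l2_leI duhamel_bound_L2 beta(3) state_nl_measurable(3)[OF c] state_nl_le(3)[OF c T(2) _ M0] L0[unfolded L_def])
          (use elim T in auto)
      then have "l2_le (\<lambda>k. (complex_of_real (sgm s k) * U k - U k) - duh c s k) (e / 2 + A * s powr (1 / 2 - beta))"
        by (rule l2_le_diff[OF elim(2)])
      also have "(\<lambda>k. (complex_of_real (sgm s k) * U k - U k) - duh c s k) = (\<lambda>k. f s k - f 0 k)"
        by (simp add: f0 fun_eq_iff) (simp add: f_def)
      finally show ?case by (rule l2_le_weaken) (use elim in simp)
    qed
    then show ?thesis using True by simp
  next
    case False
    then have t0: "0 < t" "t \<le> T" using t by auto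
    \<comment> \<open>Bounds the \<open>H1\<close> norm of \<open>f s - f t\<close> for all
      \<open>s > t / 2\<close>; the box size \<open>n\<close> is then chosen so that
      \<open>R / n \<le> e / 2\<close>.\<close>
    define R where "R = M * (t / 2) powr (- 1 / 4) + M * t powr (- 1 / 4)"
    obtain n where n: "2 * R / e < real n" "0 < n"
    proof -
      obtain n where "2 * R / e < real n" using reals_Archimedean2 by blast
      then have "2 * R / e < real (Suc n)" by simp
      then show ?thesis using that[of "Suc n"] by blast
    qed
    have "\<forall>\<^sub>F s in at t within {0..T}. t / 2 < s \<and> s \<le> T"
      using t0 by (auto simp: eventually_at dist_real_def abs_if split: if_splits intro!: exI[of _ "t / 2"])
    then have "\<forall>\<^sub>F s in at t within {0..T}. \<forall>K. finite K \<longrightarrow> K \<inter> kbox n = {} \<longrightarrow>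
        L2_set (\<lambda>k. cmod (f s k - f t k)) K \<le> e / 2"
    proof (eventually_elim, intro allI impI)
      fix s and K :: "(int \<times> int) set"
      assume s: "t / 2 < s \<and> s \<le> T" and K: "finite K" "K \<inter> kbox n = {}"
      have "s powr (- 1 / 4) \<le> (t / 2) powr (- 1 / 4)"
        using s t0 by (intro powr_mono2') auto
      then have "M * s powr (- 1 / 4) \<le> M * (t / 2) powr (- 1 / 4)" using M0 by (rule mult_left_mono)
      then have "h1_le (\<lambda>k. f s k - f t k) R"
        using h1_le_diff[OF h1[of s] h1[OF t0]] s t0 unfolding R_def by (auto intro: h1_le_weaken)
      from h1_le_tail[OF this n(2) K] have "L2_set (\<lambda>k. cmod (f s k - f t k)) K \<le> R / real n" .
      also have "\<dots> \<le> e / 2" using n e by (simp add: field_simps)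
      finally show "L2_set (\<lambda>k. cmod (f s k - f t k)) K \<le> e / 2" .
    qed
    then show ?thesis by (rule eventually_l2_le[OF lim[OF t] e])
  qed
  have CL2: "C_L2 T u"
    unfolding C_L2_def
  proof (intro conjI ballI)
    fix t assume t: "t \<in> {0..T}"
    show "L2 (u t)" by (rule L2u[OF t])
    show "((\<lambda>s. L2norm (\<lambda>x. u s x - u t x)) \<longlongrightarrow> 0) (at t within {0..T})"
    proof (rule tendstoI)
      fix e :: real assume e: "0 < e"
      have "\<forall>\<^sub>F s in at t within {0..T}. s \<in> {0..T}" by (auto simp: eventually_at intro!: exI[of _ 1])
      with near[OF t half_gt_zero[OF e]]
      show "\<forall>\<^sub>F s in at t within {0..T}. dist (L2norm (\<lambda>x. u s x - u t x)) 0 < e"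
      proof (eventually_elim)
        case (elim s)
        then obtain B C where "l2_le (f s) B" "l2_le (f t) C" using l2 t by blast
        from L2norm_RF_diff_le[OF this] elim have "L2norm (\<lambda>x. u s x - u t x) \<le> e / 2" unfolding u_def by blast
        then show ?case using e by simp
      qed
    qed
  qed
  have wg: "weak_grad (u t) (Gr (c t))" if t: "0 < t" "t \<le> T" for t
    using weak_grad_RF(1)[OF h1[OF t] sym] unfolding u_def fc_eq_c[OF t] .
  note Gr_c = state_Gr[OF c]
  have ST: "S_T T u"
    unfolding S_T_def
  proof (intro conjI CL2 exI ballI)
    fix t assume "t \<in> {0<..T}"
    then have t: "0 < t" "t \<le> T" by auto
    show "weak_grad (u t) (Gr (c t))" by (rule wg[OF t])
    show "L2v (Gr (c t))" by (rule Gr_c(1)[OF t])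
    have "t powr (1 / 4) * L2normv (Gr (c t)) \<le> t powr (1 / 4) * ((4 * pi * M) * t powr (- 1 / 4))"
      by (intro mult_left_mono Gr_c(2)[OF t]) simp
    also have "\<dots> = (4 * pi * M) * (t powr (1 / 4) * t powr (- 1 / 4))" by simp
    also have "t powr (1 / 4) * t powr (- 1 / 4) = 1" using t by (simp flip: powr_add)
    finally show "t powr (1 / 4) * L2normv (Gr (c t)) \<le> 4 * pi * M" by simp
  qed
  define G where "G t = Gr (c t)" for t
  have "mild_solution p v u0 T u"
    unfolding mild_solution_def
  proof (intro conjI CL2 exI[of _ G])
    show "AE t in leb T. weak_grad (u t) (G t)"
      using AE_lebesgue_on_Icc_pos[of T] unfolding G_def by eventually_elim (use wg in auto)
    show "\<forall>a\<in>{0<..T}. integrable (lebesgue_on ({a..T} \<times> torus_sq)) (\<lambda>(t, x). G t x)"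
    proof
      fix a assume a: "a \<in> {0<..T}"
      show "integrable (lebesgue_on ({a..T} \<times> torus_sq)) (\<lambda>(t, x). G t x)"
      proof (rule integrable_space_time)
        show "(\<lambda>z. G (fst z) (snd z)) \<in> borel_measurable (borel \<Otimes>\<^sub>M borel)"
          unfolding G_def by (rule Gr_jointly_measurable[OF state_measurable[OF c]])
        fix t assume "t \<in> {a..T}"
        then have t: "0 < t" "t \<le> T" "a \<le> t" using a by auto
        show "L2v (G t)" unfolding G_def by (rule Gr_c(1)[OF t(1,2)])
        have "L2normv (G t) \<le> (4 * pi * M) * t powr (- 1 / 4)" unfolding G_def by (rule Gr_c(2)[OF t(1,2)])
        also have "\<dots> \<le> (4 * pi * M) * a powr (- 1 / 4)"
          using a t M0 by (intro mult_left_mono powr_mono2') auto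
        finally show "L2normv (G t) \<le> (4 * pi * M) * a powr (- 1 / 4)" .
      qed
    qed
    show "AE s in leb T. L1 (\<lambda>x. fst (flux p (G s x))) \<and> L1 (\<lambda>x. snd (flux p (G s x))) \<and> L1 (\<lambda>x. v s x \<bullet> G s x)"
      using AE_lebesgue_on_Icc_pos[of T]
    proof eventually_elim
      case (elim s)
      then have s: "0 < s" "s \<le> T" by auto
      show ?case unfolding G_def using flux_L1[OF p Gr_c(1)[OF s]] adv_L1[OF L2v_v Gr_c(1)[OF s]] s by auto
    qed
    show "\<forall>t\<in>{0..T}. l2_bochner t (div_term p G t) \<and> l2_bochner t (adv_term v G t) \<and>
        (\<forall>k. fc (u t) k = complex_of_real (sgm t k) * fc u0 k
          - (\<integral>s. div_term p G t s k \<partial>leb t) - (\<integral>s. adv_term v G t s k \<partial>leb t))"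
    proof (intro ballI conjI allI)
      fix t assume tT: "t \<in> {0..T}"
      then have t: "t \<le> T" "t \<le> 1" using T by auto
      have div: "div_term p G t = (\<lambda>s k. complex_of_real (sgm (t - s) k) * nl_flux p (Gr (c s)) k)"
        by (intro ext) (simp only: div_term_eq G_def)
      have adv: "adv_term v G t = (\<lambda>s k. complex_of_real (sgm (t - s) k) * nl_adv (v s) (Gr (c s)) k)"
        by (intro ext) (simp only: adv_term_eq G_def)
      show "l2_bochner t (div_term p G t)"
        unfolding div
        by (rule l2_bochner_duhamel[OF t(2) beta(3) _ state_nl_measurable(1)[OF c] state_nl_le(1)[OF c T(2) t(1) M0]])
          (use L0 L_def in simp)
      show "l2_bochner t (adv_term v G t)"
        unfolding adv
        by (rule l2_bochner_duhamel[OF t(2) beta(3) _ state_nl_measurable(2)[OF c] state_nl_le(2)[OF c T(2) t(1) M0]])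
          (use L0 L_def in simp)
      fix k
      have le1: "AE s in leb t. cmod (nl_flux p (Gr (c s)) k) \<le> (L * sqrt (kw k)) * s powr (- beta)"
        using state_nl_le(1)[OF c T(2) t(1) M0] unfolding L_def by eventually_elim blast
      have le2: "AE s in leb t. cmod (nl_adv (v s) (Gr (c s)) k) \<le> (L * sqrt (kw k)) * s powr (- beta)"
        using state_nl_le(2)[OF c T(2) t(1) M0] unfolding L_def by eventually_elim blast
      have "duh c t k = (\<integral>s. div_term p G t s k + adv_term v G t s k \<partial>leb t)"
        unfolding duhamel_def div adv nl_def by (simp add: distrib_left)
      also have "\<dots> = (\<integral>s. div_term p G t s k \<partial>leb t) + (\<integral>s. adv_term v G t s k \<partial>leb t)"
        unfolding div adv
        by (intro Bochner_Integration.integral_add duhamel_integrable[OF state_nl_measurable(1)[OF c] beta(3) le1]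
            duhamel_integrable[OF state_nl_measurable(2)[OF c] beta(3) le2])
      finally show "fc (u t) k = complex_of_real (sgm t k) * fc u0 k
          - (\<integral>s. div_term p G t s k \<partial>leb t) - (\<integral>s. adv_term v G t s k \<partial>leb t)"
        using fcu[OF tT, of k] by (simp add: f_def U_def)
    qed
  qed
  with ST show ?thesis by blast
qed

end

subsection \<open>Uniqueness\<close>

text \<open>Both gradients have the same coefficients, so they agree almost everywhere. This
  transfers the weighted bound of \<open>S_T\<close> to the gradient occurring in the mild
  formulation.\<close>

lemma weak_grad_unique:
  assumes "weak_grad u G" "weak_grad u H" and H: "L2v H"
  shows "L2v G" "L2normv G = L2normv H"
proof -
  have L1: "L1 (\<lambda>x. fst (G x))" "L1 (\<lambda>x. snd (G x))" using assms by (auto simp: weak_grad_def)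
  have f: "AE x in tor. fst (G x) = fst (H x)" and s: "AE x in tor. snd (G x) = snd (H x)"
    using assms by (auto simp: weak_grad_def intro!: fc_eq_imp_AE_eq)
  have [measurable]: "(\<lambda>x. fst (G x)) \<in> borel_measurable tor" "(\<lambda>x. snd (G x)) \<in> borel_measurable tor"
    using L1 by (auto simp: L1_def borel_measurable_integrable)
  have L2_cong: "L2 g" if "L2 h" "g \<in> borel_measurable tor" "AE x in tor. g x = h x" for g h
  proof (rule L2_I[OF that(2)])
    show "integrable tor (\<lambda>x. (h x)\<^sup>2)" using that by (simp add: L2_def)
    show "AE x in tor. (g x)\<^sup>2 \<le> (h x)\<^sup>2" using that(3) by eventually_elim simp
  qed
  show G: "L2v G" unfolding L2v_def
    using L2_cong[OF L2v_D(1)[OF H] _ f] L2_cong[OF L2v_D(2)[OF H] _ s] by simp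
  have "AE x in tor. norm (G x) = norm (H x)" using f s by eventually_elim (simp add: norm_prod_def)
  then show "L2normv G = L2normv H"
    unfolding L2normv_eq using L2v_D(3)[OF G] L2v_D(3)[OF H] by (intro L2norm_cong_AE) auto
qed

text \<open>\<open>(l * s) powr e \<le> 1 + l * s \<le> exp (l * s)\<close>. The right side tends to
  0 for large \<open>l\<close>, uniformly in \<open>s\<close>.\<close>

lemma exp_weight_le:
  fixes l s e :: real
  assumes "0 < l" "0 < s" "0 < e" "e < 1"
  shows "exp (- (l * s)) * s powr e \<le> l powr (- e)"
proof -
  have "(l * s) powr e \<le> 1 + l * s"
    using powr_le_scaled_linear[of e 1 "l * s"] assms by simp
  also have "\<dots> \<le> exp (l * s)" by (rule exp_ge_add_one_self)
  finally have "l powr e * s powr e \<le> exp (l * s)" using assms by (simp add: powr_mult)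
  then show ?thesis using assms by (simp add: exp_minus powr_minus field_simps)
qed

lemma small_powr_exists:
  fixes A e :: real
  assumes "0 \<le> A" "0 < e"
  shows "\<exists>T. 0 < T \<and> T \<le> 1 \<and> A * T powr e \<le> 1 / 2"
proof (intro exI conjI)
  \<comment> \<open>\<open>2 * A + 1\<close> in place of \<open>2 * A\<close> covers
    \<open>A = 0\<close> and forces the bound \<open>?T \<le> 1\<close>.\<close>
  let ?T = "(1 / (2 * A + 1)) powr (1 / e)"
  show "0 < ?T" using assms by simp
  show "?T \<le> 1" using assms by (intro powr_le1) auto
  have "?T powr e = 1 / (2 * A + 1)" using assms by (simp add: powr_powr)
  then have "A * ?T powr e = A / (2 * A + 1)" by simp
  also have "\<dots> \<le> 1 / 2" using assms by (simp add: field_simps)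
  finally show "A * ?T powr e \<le> 1 / 2" .
qed

context advected_flux
begin

lemma mild_solution_duhamel:
  assumes mild: "mild_solution p v u0 T u" and ST: "S_T T u" and T: "0 < T"
  shows "\<exists>C G. 0 \<le> C \<and>
    (AE s in leb T. weak_grad (u s) (G s) \<and> L2v (G s) \<and> L2normv (G s) \<le> C * s powr (- 1 / 4)) \<and>
    (\<forall>k. (\<lambda>s. nl s (G s) k) \<in> borel_measurable (leb T)) \<and>
    (\<forall>t\<in>{0..T}. \<forall>k. fc (u t) k = complex_of_real (sgm t k) * fc u0 k - duhamel (\<lambda>s. nl s (G s)) t k)"
proof -
  obtain G where G1: "AE t in leb T. weak_grad (u t) (G t)"
    and G2: "\<And>t. t \<in> {0..T} \<Longrightarrow> l2_bochner t (div_term p G t) \<and> l2_bochner t (adv_term v G t) \<and>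
             (\<forall>k. fc (u t) k = complex_of_real (sgm t k) * fc u0 k
                    - (\<integral>s. div_term p G t s k \<partial>leb t)
                    - (\<integral>s. adv_term v G t s k \<partial>leb t))"
    using mild unfolding mild_solution_def by blast
  obtain H C where H: "\<And>t. t \<in> {0<..T} \<Longrightarrow> weak_grad (u t) (H t) \<and> L2v (H t) \<and> t powr (1 / 4) * L2normv (H t) \<le> C"
    using ST unfolding S_T_def by blast
  have "0 \<le> T powr (1 / 4) * L2normv (H T)" by (simp add: L2normv_eq)
  also have "\<dots> \<le> C" using H[of T] T by simp
  finally have C0: "0 \<le> C" .
  have ae: "AE s in leb T. weak_grad (u s) (G s) \<and> L2v (G s) \<and> L2normv (G s) \<le> C * s powr (- 1 / 4)"
    using G1 AE_lebesgue_on_Icc_pos[of T]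
  proof eventually_elim
    case (elim s)
    then have s: "s \<in> {0<..T}" "0 < s" by auto
    have "L2normv (H s) = s powr (- 1 / 4) * (s powr (1 / 4) * L2normv (H s))"
      using s by (simp add: mult.assoc[symmetric] flip: powr_add)
    also have "\<dots> \<le> s powr (- 1 / 4) * C" using H[OF s(1)] by (intro mult_left_mono) auto
    finally have "L2normv (H s) \<le> C * s powr (- 1 / 4)" by (simp add: mult.commute)
    then show ?case using weak_grad_unique[OF elim(1), of "H s"] H[OF s(1)] elim(1) by simp
  qed
  \<comment> \<open>The gradient is arbitrary here, so measurability of the nonlinear coefficients
    is recovered from the Bochner condition at the final time by dividing out the semigroup mode by
    mode.\<close>
  have inv: "complex_of_real (sgm (s - T) k) * (complex_of_real (sgm (T - s) k) * z) = z" for s k z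
  proof -
    have "sgm (s - T) k * sgm (T - s) k = 1" by (simp flip: sgm_add)
    then have "complex_of_real (sgm (s - T) k) * complex_of_real (sgm (T - s) k) = 1"
      by (metis of_real_1 of_real_mult)
    then show ?thesis by (simp add: mult.assoc[symmetric])
  qed
  have meas_sgm: "(\<lambda>s. complex_of_real (sgm (s - T) k)) \<in> borel_measurable (leb T)" for k
    by (rule borel_measurable_lebesgue_on) (simp add: sgm_def)
  have m1: "(\<lambda>s. nl_flux p (G s) k) \<in> borel_measurable (leb T)" for k
  proof -
    have "(\<lambda>s. div_term p G T s k) \<in> borel_measurable (leb T)"
      using G2[of T] T by (simp add: l2_bochner_def)
    with meas_sgm have "(\<lambda>s. complex_of_real (sgm (s - T) k) * div_term p G T s k) \<in> borel_measurable (leb T)"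
      by (rule borel_measurable_times)
    then show ?thesis by (simp add: div_term_eq inv)
  qed
  have m2: "(\<lambda>s. nl_adv (v s) (G s) k) \<in> borel_measurable (leb T)" for k
  proof -
    have "(\<lambda>s. adv_term v G T s k) \<in> borel_measurable (leb T)"
      using G2[of T] T by (simp add: l2_bochner_def)
    with meas_sgm have "(\<lambda>s. complex_of_real (sgm (s - T) k) * adv_term v G T s k) \<in> borel_measurable (leb T)"
      by (rule borel_measurable_times)
    then show ?thesis by (simp add: adv_term_eq inv)
  qed
  have int: "integrable (leb t) (\<lambda>s. c s k)" if c: "l2_bochner t c" for t c and k :: "int \<times> int"
  proof (rule Bochner_Integration.integrable_bound)
    show "integrable (leb t) (\<lambda>s. sqrt (infsum (\<lambda>k. (cmod (c s k))\<^sup>2) UNIV))"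
      and "(\<lambda>s. c s k) \<in> borel_measurable (leb t)" using c by (auto simp: l2_bochner_def)
    have "AE s in leb t. (\<lambda>k. (cmod (c s k))\<^sup>2) summable_on UNIV" using c by (simp add: l2_bochner_def)
    then show "AE s in leb t. norm (c s k) \<le> norm (sqrt (infsum (\<lambda>k. (cmod (c s k))\<^sup>2) UNIV))"
    proof eventually_elim
      case (elim s)
      have "(cmod (c s k))\<^sup>2 \<le> infsum (\<lambda>k. (cmod (c s k))\<^sup>2) UNIV"
        using finite_sum_le_infsum[OF elim, of "{k}"] by simp
      then have "cmod (c s k) \<le> sqrt (infsum (\<lambda>k. (cmod (c s k))\<^sup>2) UNIV)" by (rule real_le_rsqrt)
      then show ?case by (simp add: infsum_nonneg)
    qed
  qed
  show ?thesis
  proof (intro exI conjI allI ballI)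
    show "0 \<le> C" by (rule C0)
    show "AE s in leb T. weak_grad (u s) (G s) \<and> L2v (G s) \<and> L2normv (G s) \<le> C * s powr (- 1 / 4)"
      by (rule ae)
    show "(\<lambda>s. nl s (G s) k) \<in> borel_measurable (leb T)" for k
      unfolding nl_def by (intro borel_measurable_add m1 m2)
    fix t k assume t: "t \<in> {0..T}"
    have i: "integrable (leb t) (\<lambda>s. div_term p G t s k)" "integrable (leb t) (\<lambda>s. adv_term v G t s k)"
      using int[of t "div_term p G t" k] int[of t "adv_term v G t" k] G2[OF t] by auto
    have "duhamel (\<lambda>s. nl s (G s)) t k = (\<integral>s. div_term p G t s k + adv_term v G t s k \<partial>leb t)"
      unfolding duhamel_def nl_def div_term_eq adv_term_eq by (simp add: distrib_left)
    also have "\<dots> = (\<integral>s. div_term p G t s k \<partial>leb t) + (\<integral>s. adv_term v G t s k \<partial>leb t)"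
      using i by (rule Bochner_Integration.integral_add)
    finally show "fc (u t) k = complex_of_real (sgm t k) * fc u0 k - duhamel (\<lambda>s. nl s (G s)) t k"
      using G2[OF t] by simp
  qed
qed

lemma mild_solution_unique:
  assumes T: "0 < T" "T \<le> 1"
    and u: "mild_solution p v u0 T u" "S_T T u" and w: "mild_solution p v u0 T w" "S_T T w"
    and t: "t \<in> {0..T}"
  shows "L2norm (\<lambda>x. u t x - w t x) = 0"
proof -
  obtain C G where C: "0 \<le> C"
    and G: "AE s in leb T. weak_grad (u s) (G s) \<and> L2v (G s) \<and> L2normv (G s) \<le> C * s powr (- 1 / 4)"
    and Gm: "\<And>k. (\<lambda>s. nl s (G s) k) \<in> borel_measurable (leb T)"
    and Ge: "\<And>t k. t \<in> {0..T} \<Longrightarrow> fc (u t) k = complex_of_real (sgm t k) * fc u0 k - duhamel (\<lambda>s. nl s (G s)) t k"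
    using mild_solution_duhamel[OF u T(1)] by blast
  obtain C' H where C': "0 \<le> C'"
    and H: "AE s in leb T. weak_grad (w s) (H s) \<and> L2v (H s) \<and> L2normv (H s) \<le> C' * s powr (- 1 / 4)"
    and Hm: "\<And>k. (\<lambda>s. nl s (H s) k) \<in> borel_measurable (leb T)"
    and He: "\<And>t k. t \<in> {0..T} \<Longrightarrow> fc (w t) k = complex_of_real (sgm t k) * fc u0 k - duhamel (\<lambda>s. nl s (H s)) t k"
    using mild_solution_duhamel[OF w T(1)] by blast
  define R where "R = C + C'"
  have R: "0 \<le> R" using C C' by (simp add: R_def)
  have GH: "AE s in leb T. 0 < s \<and> s \<le> T \<and>
      weak_grad (u s) (G s) \<and> L2v (G s) \<and> L2normv (G s) \<le> R * s powr (- 1 / 4) \<and>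
      weak_grad (w s) (H s) \<and> L2v (H s) \<and> L2normv (H s) \<le> R * s powr (- 1 / 4)"
    using G H AE_lebesgue_on_Icc_pos[of T]
  proof eventually_elim
    case (elim s)
    have "C * s powr (- 1 / 4) \<le> R * s powr (- 1 / 4)" "C' * s powr (- 1 / 4) \<le> R * s powr (- 1 / 4)"
      using C C' by (auto simp: R_def intro!: mult_right_mono)
    with elim show ?case by (meson order_trans)
  qed
  define n where "n s k = nl s (G s) k - nl s (H s) k" for s k
  define d where "d t k = fc (u t) k - fc (w t) k" for t k
  have nm: "(\<lambda>s. n s k) \<in> borel_measurable (leb t)" if "t \<le> T" for t k
  proof -
    have "(\<lambda>s. n s k) \<in> borel_measurable (leb T)" unfolding n_def by (intro borel_measurable_diff Gm Hm)
    then show ?thesis by (rule measurable_restrict_mono) (use that in auto)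
  qed
  have leG: "AE s in leb T. \<forall>k. cmod (nl s (G s) k) \<le> (Lip R * R) * sqrt (kw k) * s powr (- beta)"
    using GH
  proof eventually_elim
    case (elim s)
    then show ?case using nonlinearity_le(3)[of s R "G s"] R T by auto
  qed
  have leH: "AE s in leb T. \<forall>k. cmod (nl s (H s) k) \<le> (Lip R * R) * sqrt (kw k) * s powr (- beta)"
    using GH
  proof eventually_elim
    case (elim s)
    then show ?case using nonlinearity_le(3)[of s R "H s"] R T by auto
  qed
  have d_eq: "d t k = - duhamel n t k" if t: "t \<in> {0..T}" for t k
  proof -
    have tT: "t \<le> T" using t by simp
    have 1: "AE s in leb t. cmod (nl s (G s) k) \<le> (Lip R * R * sqrt (kw k)) * s powr (- beta)"
      using AE_lebesgue_on_Icc_mono[OF leG tT] by eventually_elim blast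
    have 2: "AE s in leb t. cmod (nl s (H s) k) \<le> (Lip R * R * sqrt (kw k)) * s powr (- beta)"
      using AE_lebesgue_on_Icc_mono[OF leH tT] by eventually_elim blast
    have m: "(\<lambda>s. nl s (G s) k) \<in> borel_measurable (leb t)" "(\<lambda>s. nl s (H s) k) \<in> borel_measurable (leb t)"
      using measurable_restrict_mono[OF Gm, of "{0..t}"] measurable_restrict_mono[OF Hm, of "{0..t}"] tT by auto
    have "duhamel (\<lambda>s. nl s (G s)) t k - duhamel (\<lambda>s. nl s (H s)) t k = duhamel n t k"
      unfolding n_def using m beta(3) 1 2 by (rule duhamel_diff)
    then have "- duhamel n t k = duhamel (\<lambda>s. nl s (H s)) t k - duhamel (\<lambda>s. nl s (G s)) t k"
      by (metis minus_diff_eq)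
    then show ?thesis unfolding d_def Ge[OF t] He[OF t] by simp
  qed
  define A where "A = Lip R * (4 * pi) * kernel_const * Beta (1 - beta) (beta - 1 / 4)"
  have A: "0 \<le> A" unfolding A_def using Lip_nonneg[OF R] kernel_const_pos Beta_factor_nonneg by simp
  define e where "e = 1 / 2 - beta"
  have e: "0 < e" "e < 1" using beta by (auto simp: e_def)
  \<comment> \<open>Chosen so that \<open>l powr (- e) = 1 / (2 * A + 1)\<close>, which makes the
    weighted contraction factor \<open>A * l powr (- e)\<close> at most 1/2 however large the
    solutions are.\<close>
  define l where "l = (2 * A + 1) powr (1 / e)"
  have l0: "0 < l" using A by (simp add: l_def)
  have "l powr (- e) = 1 / (2 * A + 1)" using A e by (simp add: l_def powr_powr powr_neg_one)
  then have "A * l powr (- e) = A / (2 * A + 1)" by simp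
  also have "\<dots> \<le> 1 / 2" using A by (simp add: field_simps)
  finally have Al: "A * l powr (- e) \<le> 1 / 2" .
  \<comment> \<open>One pass from a gradient bound to a coefficient bound, used with
    \<open>m = 0\<close>, \<open>kappa = 1\<close> for a first bound and with \<open>m = l\<close>,
    \<open>kappa = l powr (- e)\<close> for the iteration.\<close>
  have step: "h1_le (d t) (A * D * kappa * t powr (- 1 / 4) * exp (m * t))"
    if t: "0 < t" "t \<le> T" and D: "0 \<le> D" and m: "0 \<le> m"
      and ge: "\<And>s. 0 < s \<Longrightarrow> s \<le> t \<Longrightarrow> exp (- (m * s)) * s powr (1 / 2 - beta) \<le> kappa"
      and le: "AE s in leb T. L2normv (\<lambda>x. G s x - H s x) \<le> (4 * pi * D * exp (m * s)) * s powr (- 1 / 4)"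
    for t D kappa m
  proof -
    have t1: "t \<le> 1" using t T by simp
    have "h1_le (duhamel n t) ((Lip R * (4 * pi * D)) * kernel_const * Beta (1 - beta) (beta - 1 / 4) * kappa * t powr (- 1 / 4) * exp (m * t))"
      unfolding duhamel_def
    proof (rule h1_leI, rule duhamel_bound[OF t(1) t1 beta(1,2) _ _ m nm[OF t(2)] _ ge])
      show "0 \<le> Lip R * (4 * pi * D)" using Lip_nonneg[OF R] D by simp
      have "AE s in leb T. \<forall>k. cmod (n s k) \<le> Lip R * (4 * pi * D) * sqrt (kw k) * s powr (- beta) * exp (m * s)"
        using GH le
      proof eventually_elim
        case (elim s)
        show ?case
        proof
          fix k
          have "cmod (n s k) \<le> (Lip R * (4 * pi * D * exp (m * s))) * sqrt (kw k) * s powr (- beta)"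
            unfolding n_def using elim T R D by (intro nonlinearity_diff_le(3)) auto
          then show "cmod (n s k) \<le> Lip R * (4 * pi * D) * sqrt (kw k) * s powr (- beta) * exp (m * s)"
            by (simp add: mult_ac)
        qed
      qed
      then show "AE s in leb t. \<forall>k. cmod (n s k) \<le> Lip R * (4 * pi * D) * sqrt (kw k) * s powr (- beta) * exp (m * s)"
        by (rule AE_lebesgue_on_Icc_mono[OF _ t(2)])
    qed
    then have "h1_le (\<lambda>k. - duhamel n t k) (A * D * kappa * t powr (- 1 / 4) * exp (m * t))"
      unfolding h1_le_uminus by (simp add: A_def mult_ac)
    moreover have "d t = (\<lambda>k. - duhamel n t k)" using d_eq[of t] t by (auto simp: fun_eq_iff)
    ultimately show ?thesis by simp
  qed
  \<comment> \<open>The triangle inequality bounds the gradient difference by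
    \<open>2 * R * s powr (- 1 / 4)\<close>; dividing by \<open>4 * pi\<close> cancels the factor
    that \<open>step\<close> attaches to its parameter \<open>D\<close>.\<close>
  define D0 where "D0 = A * (2 * R / (4 * pi))"
  have base: "h1_le (d t) (D0 * t powr (- 1 / 4) * exp (l * t))" if t: "0 < t" "t \<le> T" for t
  proof -
    have "h1_le (d t) (A * (2 * R / (4 * pi)) * 1 * t powr (- 1 / 4) * exp (0 * t))"
    proof (rule step[OF t])
      show "exp (- (0 * s)) * s powr (1 / 2 - beta) \<le> 1" if "0 < s" "s \<le> t" for s
        using that t T beta by (simp add: powr_le1)
      show "AE s in leb T. L2normv (\<lambda>x. G s x - H s x) \<le> (4 * pi * (2 * R / (4 * pi)) * exp (0 * s)) * s powr (- 1 / 4)"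
        using GH
      proof eventually_elim
        case (elim s)
        have "L2normv (\<lambda>x. G s x - H s x) \<le> L2norm (\<lambda>x. norm (G s x) + norm (H s x))"
          unfolding L2normv_eq
        proof (rule L2norm_mono)
          show "L2 (\<lambda>x. norm (G s x) + norm (H s x))" using elim by (intro L2_add L2v_D(4)) auto
          show "(\<lambda>x. norm (G s x - H s x)) \<in> borel_measurable tor" 
            using L2v_D(4)[OF L2v_diff] elim by (simp add: L2_def)
          show "AE x in tor. \<bar>norm (G s x - H s x)\<bar> \<le> \<bar>norm (G s x) + norm (H s x)\<bar>"
            by (rule AE_I2) (simp add: norm_triangle_ineq4)
        qed
        also have "\<dots> \<le> L2normv (G s) + L2normv (H s)"
          unfolding L2normv_eq using elim by (intro L2norm_triangle L2v_D(4)) auto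
        finally show ?case using elim by simp
      qed
    qed (use R in auto)
    then show ?thesis
    proof (rule h1_le_weaken)
      have "D0 * t powr (- 1 / 4) * 1 \<le> D0 * t powr (- 1 / 4) * exp (l * t)"
        using A R l0 t by (intro mult_left_mono) (auto simp: D0_def)
      then show "A * (2 * R / (4 * pi)) * 1 * t powr (- 1 / 4) * exp (0 * t) \<le> D0 * t powr (- 1 / 4) * exp (l * t)"
        by (simp add: D0_def)
    qed
  qed
  have D0: "0 \<le> D0" using A R by (simp add: D0_def)
  have iter: "h1_le (d t) ((D0 * (1 / 2) ^ i) * t powr (- 1 / 4) * exp (l * t))" if t: "0 < t" "t \<le> T" for t i
    using t
  proof (induction i arbitrary: t)
    case 0
    then show ?case using base by simp
  next
    case (Suc i)
    let ?D = "D0 * (1 / 2) ^ i"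
    have D: "0 \<le> ?D" using D0 by simp
    have "h1_le (d t) (A * ?D * l powr (- e) * t powr (- 1 / 4) * exp (l * t))"
    proof (rule step[OF Suc.prems D])
      show "exp (- (l * s)) * s powr (1 / 2 - beta) \<le> l powr (- e)" if "0 < s" "s \<le> t" for s
        using exp_weight_le[OF l0 that(1) e] by (simp add: e_def)
      show "AE s in leb T. L2normv (\<lambda>x. G s x - H s x) \<le> (4 * pi * ?D * exp (l * s)) * s powr (- 1 / 4)"
        using GH
      proof eventually_elim
        case (elim s)
        have "h1_le (\<lambda>k. fc (u s) k - fc (w s) k) (?D * s powr (- 1 / 4) * exp (l * s))"
          using Suc.IH[of s] elim by (simp add: d_def[abs_def])
        then have "L2normv (\<lambda>x. G s x - H s x) \<le> 4 * pi * (?D * s powr (- 1 / 4) * exp (l * s))"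
          using elim by (intro L2normv_weak_grad_diff_le) auto
        then show ?case by (simp add: mult_ac)
      qed
    qed (use l0 in auto)
    then show ?case
    proof (rule h1_le_weaken)
      have "(A * l powr (- e)) * (?D * t powr (- 1 / 4) * exp (l * t)) \<le> 1 / 2 * (?D * t powr (- 1 / 4) * exp (l * t))"
        using D by (intro mult_right_mono Al) auto
      then show "A * ?D * l powr (- e) * t powr (- 1 / 4) * exp (l * t) \<le> D0 * (1 / 2) ^ Suc i * t powr (- 1 / 4) * exp (l * t)"
        by (simp add: mult_ac)
    qed
  qed
  have d0: "d t k = 0" for k
  proof (cases "t = 0")
    case True
    then show ?thesis using d_eq[OF t, of k] by (simp add: duhamel_0)
  next
    case False
    then have t': "0 < t" "t \<le> T" using t by auto
    have "(\<lambda>i. (D0 * (1 / 2) ^ i) * t powr (- 1 / 4) * exp (l * t)) \<longlonglongrightarrow> (D0 * 0) * t powr (- 1 / 4) * exp (l * t)"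
      by (intro tendsto_intros LIMSEQ_power_zero) auto
    then have "cmod (d t k) \<le> (D0 * 0) * t powr (- 1 / 4) * exp (l * t)"
      by (rule LIMSEQ_le_const) (use l2_le_norm[OF h1_le_imp_l2_le[OF iter[OF t']]] in auto)
    then show ?thesis by simp
  qed
  have L2: "L2 (u t)" "L2 (w t)" using u(2) w(2) t by (auto simp: S_T_def C_L2_def)
  have "fc (\<lambda>x. u t x - w t x) = (\<lambda>k. 0)"
    using d0 by (auto simp: fc_diff L2_imp_L1 L2 d_def)
  then have "l2_le (fc (\<lambda>x. u t x - w t x)) 0" by (simp add: l2_le_def L2_set_def)
  then have "L2norm (\<lambda>x. u t x - w t x) \<le> 0" by (intro L2norm_le_fc L2_diff L2)
  then show ?thesis by (simp add: antisym)
qed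

end

section \<open>Choice of the existence time from the two norms\<close>

theorem mainTheorem8:
  fixes p :: real
  assumes "2 < p" and "p < 3"
  shows "\<forall>a b. \<exists>T. 0 < T \<and> T \<le> 1 \<and>
    (\<forall>(u0 :: real \<times> real \<Rightarrow> real) (v :: real \<Rightarrow> real \<times> real \<Rightarrow> real \<times> real).
       L2 u0 \<and> L2norm u0 = a \<and> adm_velocity v \<and> (SUP t\<in>{0..}. L2normv (v t)) = b \<longrightarrow>
       (\<exists>u. mild_solution p v u0 T u \<and> S_T T u) \<and>
       (\<forall>u w. mild_solution p v u0 T u \<and> S_T T u \<and> mild_solution p v u0 T w \<and> S_T T w \<longrightarrow>
          (\<forall>t\<in>{0..T}. L2norm (\<lambda>x. u t x - w t x) = 0)))"
proof (intro allI, goal_cases)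
  case (1 a b)
  \<comment> \<open>The time has to be fixed before the data, hence outside the locale:
    \<open>be\<close> and \<open>A\<close> repeat \<open>beta\<close> and the constant of
    \<open>contr\<close> for \<open>M = 4 * a\<close>, the smallest radius that admits data of norm
    \<open>a\<close>.\<close>
  define be where "be = (p - 1) / 4"
  define A where "A = (16 * pi * (1 + 4 * pi * (4 * a)) + b) * (4 * pi) * kernel_const * Beta (1 - be) (be - 1 / 4)"
  \<comment> \<open>The absolute value is taken because \<open>a\<close> and \<open>b\<close> are
    arbitrary reals at this point, so that \<open>A\<close> may be negative.\<close>
  obtain T where T: "0 < T" "T \<le> 1" "\<bar>A\<bar> * T powr (1 / 2 - be) \<le> 1 / 2"
    using small_powr_exists[of "\<bar>A\<bar>" "1 / 2 - be"] assms by (auto simp: be_def)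
  have "A * T powr (1 / 2 - be) \<le> \<bar>A\<bar> * T powr (1 / 2 - be)" by (intro mult_right_mono) auto
  with T(3) have AT: "A * T powr (1 / 2 - be) \<le> 1 / 2" by linarith
  have *: "(\<exists>u. mild_solution p v u0 T u \<and> S_T T u) \<and>
       (\<forall>u w. mild_solution p v u0 T u \<and> S_T T u \<and> mild_solution p v u0 T w \<and> S_T T w \<longrightarrow>
          (\<forall>t\<in>{0..T}. L2norm (\<lambda>x. u t x - w t x) = 0))"
    if u0: "L2 u0" "L2norm u0 = a" and v: "adm_velocity v" "(SUP t\<in>{0..}. L2normv (v t)) = b" for u0 v
  proof -
    interpret advected_flux p b v
    proof
      show "L2normv (v t) \<le> b" if "0 \<le> t" for t
      proof -
        have "L2normv (v t) \<le> (SUP t\<in>{0..}. L2normv (v t))"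
          using v(1) that by (intro cSUP_upper) (auto simp: adm_velocity_def)
        then show ?thesis using v(2) by simp
      qed
    qed (use assms v in auto)
    have "contr T (4 * a) \<le> 1 / 2"
      using AT by (simp add: contr_def Lip_def A_def beta_def be_def)
    then have "\<exists>u. mild_solution p v u0 T u \<and> S_T T u"
      using mild_solution_exists[OF T(1,2) u0(1), of "4 * a"] u0(2) by simp
    then show ?thesis using mild_solution_unique[OF T(1,2)] by blast
  qed
  show ?case using T(1,2) * by blast
qed

end
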